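(* Let $n\in\mathbb N$ and let $E\in H^\infty(\mathbb B^d_{\mathbb N})\otimes\mathbb C^{n\times n}$ be an idempotent. Then there exist an orthogonal projection $P\in\mathbb C^{n\times n}$ and an $S\in\mathrm{GL}_n(H^\infty(\mathbb B^d_{\mathbb N}))$ such that $$E=S^{-1}\left(I_{H^2(\mathbb B^d_{\mathbb N})}\otimes P\right)S.$$
   Context: Fix the number of variables $d\in\mathbb N\cup\{\infty\}$. $\mathbb F^d$ is the free monoid of words in the letters $1,\dots,d$; $Z^\alpha=Z_{i_1}\cdots Z_{i_k}$ for $\alpha=i_1\cdots i_k$. $\mathbb B^d_{\mathbb N}=\bigsqcup_{n\in\mathbb N}\mathbb B^d_n$, where $\mathbb B^d_n$ is the set of $d$-tuples of $n\times n$ complex matrices whose row operator $(Z_1,\dots,Z_d)$ has norm $<1$. $H^2(\mathbb B^d_{\mathbb N})$ (the full Fock space) is the Hilbert space of power series $f(Z)=\sum_{\alpha\in\mathbb F^d}\hat f_\alpha Z^\alpha$ with $\|f\|^2=\sum|\hat f_\alpha|^2<\infty$. $H^\infty(\mathbb B^d_{\mathbb N})$ is the algebra of uniformly bounded functions on $\mathbb B^d_{\mathbb N}$ given by such power series, identified with the algebra of left multiplication operators on $H^2(\mathbb B^d_{\mathbb N})$; equivalently it is the weak-$*$ closed unital algebra generated by the left free shifts $(L_kf)(Z)=Z_kf(Z)$. Elements of $H^\infty(\mathbb B^d_{\mathbb N})\otimes\mathbb C^{n\times n}$ are $n\times n$ matrices over $H^\infty(\mathbb B^d_{\mathbb N})$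 acting on $H^2(\mathbb B^d_{\mathbb N})\otimes\mathbb C^n$, and $\mathrm{GL}_n(H^\infty(\mathbb B^d_{\mathbb N}))$ is the group of invertible elements of this algebra. *)

theory Defs
  imports
    "HOL-Analysis.Infinite_Sum"
    "Jordan_Normal_Form.Schur_Decomposition"
begin

section \<open>Formal power series in non-commuting variables\<close>

text \<open>
  The letters are the elements of a type \<open>'a\<close>, and \<open>'a list\<close> is the free monoid on them. With
  \<open>'a\<close> countable (hence finite nonempty or countably infinite) the number of letters ranges
  exactly over \<open>d = 1, 2, \<dots>, \<infinity>\<close>. A series is given by its coefficients; \<open>H2\<close> and \<open>Hinf\<close> below
  are sets of such series.
\<close>

typedef 'a nc_series = "UNIV :: ('a list \<Rightarrow> complex) set"
  morphisms nc_coeff Nc_series ..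

setup_lifting type_definition_nc_series

lemma nc_series_eqI: "(\<And>w. nc_coeff f w = nc_coeff g w) \<Longrightarrow> f = g"
  by (metis ext nc_coeff_inject)

lemma nc_coeff_Nc_series [simp]: "nc_coeff (Nc_series c) = c"
  by (simp add: Nc_series_inverse)

text \<open>
  The coefficient of \<open>f * g\<close> at a word sums over all its factorisations, that is,
  \<open>Z\<^sup>\<alpha> Z\<^sup>\<beta> = Z\<^sup>\<alpha>\<^sup>\<beta>\<close>. So \<open>f * g\<close> is at the same time the pointwise product of functions and the
  left multiplication by \<open>f\<close> applied to \<open>g\<close>.
\<close>

instantiation nc_series :: (type) ring_1
begin

lift_definition zero_nc_series :: "'a nc_series" is "\<lambda>w. 0" .
lift_definition one_nc_series :: "'a nc_series" is "\<lambda>w. if w = [] then 1 else 0" .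
lift_definition plus_nc_series :: "'a nc_series \<Rightarrow> 'a nc_series \<Rightarrow> 'a nc_series"
  is "\<lambda>f g w. f w + g w" .
lift_definition minus_nc_series :: "'a nc_series \<Rightarrow> 'a nc_series \<Rightarrow> 'a nc_series"
  is "\<lambda>f g w. f w - g w" .
lift_definition uminus_nc_series :: "'a nc_series \<Rightarrow> 'a nc_series"
  is "\<lambda>f w. - f w" .
lift_definition times_nc_series :: "'a nc_series \<Rightarrow> 'a nc_series \<Rightarrow> 'a nc_series"
  is "\<lambda>f g w. \<Sum>k\<le>length w. f (take k w) * g (drop k w)" .

instance
proof
  fix f g h :: "'a nc_series"
  show "f * g * h = f * (g * h)"
  proof (transfer, rule ext)
    fix f g h :: "'a list \<Rightarrow> complex" and w :: "'a list"
    let ?n = "length w"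
    let ?t = "\<lambda>j i. f (take j w) * g (take i (drop j w)) * h (drop (i + j) w)"
    have "(\<Sum>k\<le>?n. (\<Sum>j\<le>length (take k w). f (take j (take k w)) * g (drop j (take k w)))
              * h (drop k w))
          = (\<Sum>k\<le>?n. \<Sum>j\<le>k. ?t j (k - j))"
      by (intro sum.cong refl)
         (auto simp: sum_distrib_right min_absorb2 drop_take min_absorb1 intro!: sum.cong)
    also have "\<dots> = (\<Sum>(j,i)\<in>{(j,i). j + i \<le> ?n}. ?t j i)"
      by (simp add: sum.triangle_reindex_eq)
    also have "{(j,i). j + i \<le> ?n} = Sigma {..?n} (\<lambda>j. {..?n - j})"
      by auto
    also have "(\<Sum>(j,i)\<in>Sigma {..?n} (\<lambda>j. {..?n - j}). ?t j i)
               = (\<Sum>j\<le>?n. \<Sum>i\<le>?n - j. ?t j i)"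
      by (simp add: sum.Sigma)
    also have "\<dots> = (\<Sum>j\<le>?n. f (take j w) *
                (\<Sum>i\<le>length (drop j w). g (take i (drop j w)) * h (drop i (drop j w))))"
      by (simp add: sum_distrib_left mult.assoc)
    finally show "(\<Sum>k\<le>?n. (\<Sum>j\<le>length (take k w). f (take j (take k w)) * g (drop j (take k w)))
              * h (drop k w)) = (\<Sum>j\<le>?n. f (take j w) *
                (\<Sum>i\<le>length (drop j w). g (take i (drop j w)) * h (drop i (drop j w))))" .
  qed
  show "1 * f = f"
  proof (transfer, rule ext)
    fix f :: "'a list \<Rightarrow> complex" and w :: "'a list"
    have "(\<Sum>k\<le>length w. (if take k w = [] then 1 else 0) * f (drop k w))
          = (\<Sum>k\<le>length w. if k = 0 then f w else 0)"
      by (intro sum.cong) auto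
    then show "(\<Sum>k\<le>length w. (if take k w = [] then 1 else 0) * f (drop k w)) = f w"
      by simp
  qed
  show "f * 1 = f"
  proof (transfer, rule ext)
    fix f :: "'a list \<Rightarrow> complex" and w :: "'a list"
    have "(\<Sum>k\<le>length w. f (take k w) * (if drop k w = [] then 1 else 0))
          = (\<Sum>k\<le>length w. if k = length w then f w else 0)"
      by (intro sum.cong) auto
    then show "(\<Sum>k\<le>length w. f (take k w) * (if drop k w = [] then 1 else 0)) = f w"
      by simp
  qed
  show "(f + g) * h = f * h + g * h" "f * (g + h) = f * g + f * h"
    by (transfer, simp add: algebra_simps sum.distrib)+
  show "(0 :: 'a nc_series) \<noteq> 1"
    by transfer (auto dest: fun_cong[of _ _ "[]"])
qed (transfer; simp add: algebra_simps)+

end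

definition nc_const :: "complex \<Rightarrow> 'a nc_series" where
  "nc_const c = Nc_series (\<lambda>w. if w = [] then c else 0)"

definition H2 :: "'a nc_series set" where
  "H2 = {f. (\<lambda>w. (cmod (nc_coeff f w))\<^sup>2) summable_on UNIV}"


section \<open>The row ball and bounded functions on it\<close>

definition vec_norm2 :: "complex vec \<Rightarrow> real" where
  "vec_norm2 v = sqrt (\<Sum>i<dim_vec v. (cmod (v $ i))\<^sup>2)"

text \<open>
  The \<open>m \<times> m\<close> level of the row ball: the operator \<open>(x\<^sub>k) \<mapsto> \<Sum>k. Z\<^sub>k x\<^sub>k\<close> from the Hilbert direct
  sum of copies of \<open>\<complex>\<^sup>m\<close> indexed by the letters into \<open>\<complex>\<^sup>m\<close> has norm less than \<open>1\<close>. The bound is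
  required on the dense subspace of finitely supported families, which also covers infinitely
  many letters.
\<close>

definition row_ball :: "nat \<Rightarrow> ('a \<Rightarrow> complex mat) set" where
  "row_ball m = {Z. (\<forall>k. Z k \<in> carrier_mat m m) \<and>
     (\<exists>r. 0 \<le> r \<and> r < 1 \<and>
       (\<forall>F x. finite F \<longrightarrow> (\<forall>k\<in>F. x k \<in> carrier_vec m) \<longrightarrow>
          vec_norm2 (vec m (\<lambda>i. \<Sum>k\<in>F. (Z k *\<^sub>v x k) $ i))
            \<le> r * sqrt (\<Sum>k\<in>F. (vec_norm2 (x k))\<^sup>2)))}"

fun word_eval :: "nat \<Rightarrow> ('a \<Rightarrow> complex mat) \<Rightarrow> 'a list \<Rightarrow> complex mat" where
  "word_eval m Z [] = 1\<^sub>m m"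
| "word_eval m Z (k # w) = Z k * word_eval m Z w"

text \<open>
  For \<open>f\<close> in \<open>H2\<close> and \<open>Z\<close> in the row ball every entry of the series converges absolutely
  (Cauchy-Schwarz), so the unordered sum is the usual value \<open>f(Z)\<close>.
\<close>

definition nc_eval :: "nat \<Rightarrow> 'a nc_series \<Rightarrow> ('a \<Rightarrow> complex mat) \<Rightarrow> complex mat" where
  "nc_eval m f Z =
     mat m m (\<lambda>(i,j). \<Sum>\<^sub>\<infinity>w\<in>UNIV. nc_coeff f w * (word_eval m Z w $$ (i,j)))"

text \<open>The constant \<open>C\<close> bounds the operator norm of \<open>f(Z)\<close> uniformly over all matrix sizes.\<close>

definition Hinf :: "'a nc_series set" where
  "Hinf = {f \<in> H2. \<exists>C. \<forall>m. \<forall>Z\<in>row_ball m. \<forall>v\<in>carrier_vec m.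
             vec_norm2 (nc_eval m f Z *\<^sub>v v) \<le> C * vec_norm2 v}"


section \<open>Matrices over the algebra of bounded functions\<close>

definition Hinf_mat :: "nat \<Rightarrow> 'a nc_series mat set" where
  "Hinf_mat n = {F \<in> carrier_mat n n. \<forall>i<n. \<forall>j<n. F $$ (i,j) \<in> Hinf}"

definition orthogonal_projection :: "nat \<Rightarrow> complex mat \<Rightarrow> bool" where
  "orthogonal_projection n P \<longleftrightarrow> P \<in> carrier_mat n n \<and> P * P = P \<and> mat_adjoint P = P"

text \<open>The element \<open>I \<otimes> P\<close>; the two lemmas below justify this reading.\<close>

definition ampliation :: "complex mat \<Rightarrow> 'a nc_series mat" where
  "ampliation P = map_mat nc_const P"

text \<open>
  An element of \<open>Hinf_mat n\<close> acts on columns \<open>h\<close> of \<open>n\<close> series by \<open>F *\<^sub>v h\<close>. The ampliation of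
  \<open>P\<close> applies \<open>P\<close> to each coefficient column of \<open>h\<close>.
\<close>

lemma nc_coeff_sum: "nc_coeff (\<Sum>i\<in>A. f i) w = (\<Sum>i\<in>A. nc_coeff (f i) w)"
proof -
  have "nc_coeff (0 :: 'a nc_series) w = 0" "nc_coeff (a + b) w = nc_coeff a w + nc_coeff b w"
    for a b :: "'a nc_series" by (transfer; simp)+
  then show ?thesis by (induction A rule: infinite_finite_induct) auto
qed

lemma nc_coeff_const_mult: "nc_coeff (nc_const c * g) w = c * nc_coeff g w"
proof -
  have "nc_coeff (nc_const c * g) w
        = (\<Sum>k\<le>length w. (if take k w = [] then c else 0) * nc_coeff g (drop k w))"
    by (simp add: times_nc_series.rep_eq nc_const_def)
  also have "\<dots> = (\<Sum>k\<le>length w. if k = 0 then c * nc_coeff g w else 0)"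
    by (intro sum.cong) auto
  finally show ?thesis by simp
qed

lemma ampliation_acts_coefficientwise:
  assumes "P \<in> carrier_mat n n" "h \<in> carrier_vec n" "i < n"
  shows "nc_coeff ((ampliation P *\<^sub>v h) $ i) w = (P *\<^sub>v map_vec (\<lambda>g. nc_coeff g w) h) $ i"
  using assms
  by (auto simp: ampliation_def scalar_prod_def nc_coeff_sum nc_coeff_const_mult)

text \<open>
  The action on columns over \<open>H2\<close> determines the matrix, so identities between matrices over
  \<open>Hinf\<close> and between the corresponding operators are the same.
\<close>

lemma zero_in_H2: "0 \<in> H2"
  by (simp add: H2_def zero_nc_series.rep_eq)

lemma one_in_H2: "(1 :: 'a nc_series) \<in> H2"
proof -
  have "(\<lambda>w. (cmod (nc_coeff (1 :: 'a nc_series) w))\<^sup>2) summable_on UNIV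
        \<longleftrightarrow> (\<lambda>w. (cmod (nc_coeff (1 :: 'a nc_series) w))\<^sup>2) summable_on {[]}"
    by (rule summable_on_cong_neutral) (auto simp: one_nc_series.rep_eq)
  then show ?thesis by (simp add: H2_def)
qed

lemma nc_mat_eq_iff_action_eq:
  fixes F G :: "'a nc_series mat"
  assumes F: "F \<in> carrier_mat n n" and G: "G \<in> carrier_mat n n"
  shows "F = G \<longleftrightarrow> (\<forall>h\<in>carrier_vec n. (\<forall>i<n. h $ i \<in> H2) \<longrightarrow> F *\<^sub>v h = G *\<^sub>v h)"
proof
  assume *: "\<forall>h\<in>carrier_vec n. (\<forall>i<n. h $ i \<in> H2) \<longrightarrow> F *\<^sub>v h = G *\<^sub>v h"
  show "F = G"
  proof (rule eq_matI)
    fix i j assume "i < dim_row G" "j < dim_col G"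
    then have i: "i < n" and j: "j < n" using G by auto
    have "\<forall>l<n. (unit_vec n j :: 'a nc_series vec) $ l \<in> H2"
      by (simp add: unit_vec_def one_in_H2 zero_in_H2)
    with * have "F *\<^sub>v unit_vec n j = G *\<^sub>v unit_vec n j"
      by simp
    then have "(F *\<^sub>v unit_vec n j) $ i = (G *\<^sub>v unit_vec n j) $ i" by simp
    then show "F $$ (i,j) = G $$ (i,j)" using F G i j by simp
  qed (use F G in auto)
qed simp

end

theory Submission
  imports Defs "HOL-Analysis.Convex"
begin

text \<open>
  Let \<open>E\<close> be an idempotent matrix over \<open>Hinf\<close>, acting on columns of series from the left, and let
  \<open>E\<^sub>0\<close> be the matrix of its constant terms. The range \<open>M\<close> of \<open>E\<close> is stable under multiplication
  by letters from the right, so it has a Beurling description. For a vector \<open>e\<close> in the range of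
  \<open>E\<^sub>0\<close>, the element of \<open>M\<close> with constant term \<open>e\<close> and least norm is orthogonal to all elements
  of \<open>M\<close> without constant term; such wandering vectors, translated from the right by different
  words, are orthogonal to each other. Let the columns of \<open>A\<close> be the wandering vectors with
  constant terms \<open>E\<^sub>0 e\<^sub>j\<close> (\<open>wandering_frame_exists\<close>). By orthogonality \<open>g \<mapsto> A g\<close>, restricted
  to the columns \<open>g\<close> with \<open>E\<^sub>0 g = g\<close>, is bounded (\<open>upper_bound\<close>) and does not decrease the norm
  (\<open>lower_bound\<close>).

  Let \<open>B\<close> be the matrix obtained in the same way from \<open>1 - E\<close>. Then \<open>\<Theta> = A E\<^sub>0 + B (1 - E\<^sub>0)\<close> has
  constant term \<open>1\<close>, so that it has an inverse \<open>S\<close> among matrices of formal series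
  (\<open>formal_inverse\<close>), and \<open>E \<Theta> = \<Theta> E\<^sub>0\<close>. Hence \<open>E = \<Theta> E\<^sub>0 S\<close>, and only boundedness remains. That of
  \<open>\<Theta>\<close> is the upper bound. Moreover \<open>E h = A (E\<^sub>0 S h)\<close> and likewise for \<open>1 - E\<close>, so the lower bound
  estimates the two parts of \<open>S h\<close> by \<open>E h\<close> and \<open>h - E h\<close>, which are bounded in terms of \<open>h\<close>.
  Finally the constant idempotent \<open>E\<^sub>0\<close> is similar to the orthogonal projection onto its range.

  These estimates concern left multiplication on square-summable series, whereas \<open>Hinf\<close> is defined
  by values on the row ball. The two descriptions agree (\<open>Hinf_iff_l2_multiplier\<close>): evaluation at
  compressed left shifts turns a uniform bound on the ball into a bound of the multiplication
  operator, and the converse is the von Neumann inequality for row contractions, obtained here from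
  a Poisson kernel cut off at words of bounded length.
\<close>

section \<open>Square-summable families\<close>

definition l2 :: "('b \<Rightarrow> complex) \<Rightarrow> bool" where
  "l2 x \<longleftrightarrow> (\<lambda>b. (cmod (x b))\<^sup>2) summable_on UNIV"

definition sqnorm :: "('b \<Rightarrow> complex) \<Rightarrow> real" where
  "sqnorm x = (\<Sum>\<^sub>\<infinity>b. (cmod (x b))\<^sup>2)"

definition l2_inner :: "('b \<Rightarrow> complex) \<Rightarrow> ('b \<Rightarrow> complex) \<Rightarrow> complex" where
  "l2_inner x y = (\<Sum>\<^sub>\<infinity>b. cnj (x b) * y b)"

lemma sqnorm_nonneg: "0 \<le> sqnorm x"
  unfolding sqnorm_def by (rule infsum_nonneg) simp

lemma sum_le_sqnorm: "l2 x \<Longrightarrow> finite B \<Longrightarrow> (\<Sum>b\<in>B. (cmod (x b))\<^sup>2) \<le> sqnorm x"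
  unfolding l2_def sqnorm_def by (rule finite_sum_le_infsum) auto

lemma l2I:
  assumes "\<And>B. finite B \<Longrightarrow> (\<Sum>b\<in>B. (cmod (x b))\<^sup>2) \<le> c"
  shows "l2 x" "sqnorm x \<le> c"
proof -
  show "l2 x"
    unfolding l2_def
    by (rule nonneg_bdd_above_summable_on) (use assms in \<open>auto simp: bdd_above_def\<close>)
  then show "sqnorm x \<le> c"
    unfolding l2_def sqnorm_def by (rule infsum_le_finite_sums) (use assms in auto)
qed

lemma l2_finite_support:
  assumes "finite B" "\<And>b. b \<notin> B \<Longrightarrow> x b = 0"
  shows "l2 x" "sqnorm x = (\<Sum>b\<in>B. (cmod (x b))\<^sup>2)"
proof -
  have "((\<lambda>b. (cmod (x b))\<^sup>2) has_sum (\<Sum>b\<in>B. (cmod (x b))\<^sup>2)) UNIV"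
    by (rule has_sum_finite_neutralI[of B]) (use assms in auto)
  then show "l2 x" "sqnorm x = (\<Sum>b\<in>B. (cmod (x b))\<^sup>2)"
    unfolding l2_def sqnorm_def by (auto simp: has_sum_iff)
qed

lemma cmod_add_squared_le: "(cmod (a + b))\<^sup>2 \<le> 2 * (cmod a)\<^sup>2 + 2 * (cmod b)\<^sup>2"
proof -
  have "(cmod (a + b))\<^sup>2 \<le> (cmod a + cmod b)\<^sup>2"
    by (intro power_mono norm_triangle_ineq) auto
  also have "\<dots> \<le> 2 * (cmod a)\<^sup>2 + 2 * (cmod b)\<^sup>2"
    using sum_squares_bound[of "cmod a" "cmod b"] by (simp add: power2_sum)
  finally show ?thesis .
qed

lemma l2_add:
  assumes "l2 x" "l2 y"
  shows "l2 (\<lambda>b. x b + y b)" "sqnorm (\<lambda>b. x b + y b) \<le> 2 * sqnorm x + 2 * sqnorm y"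
proof -
  have *: "(\<Sum>b\<in>B. (cmod (x b + y b))\<^sup>2) \<le> 2 * sqnorm x + 2 * sqnorm y" if "finite B" for B
  proof -
    have "(\<Sum>b\<in>B. (cmod (x b + y b))\<^sup>2) \<le> (\<Sum>b\<in>B. 2 * (cmod (x b))\<^sup>2 + 2 * (cmod (y b))\<^sup>2)"
      by (intro sum_mono cmod_add_squared_le)
    also have "\<dots> = 2 * (\<Sum>b\<in>B. (cmod (x b))\<^sup>2) + 2 * (\<Sum>b\<in>B. (cmod (y b))\<^sup>2)"
      by (simp add: sum.distrib sum_distrib_left)
    finally show ?thesis
      using sum_le_sqnorm[OF assms(1) that] sum_le_sqnorm[OF assms(2) that] by linarith
  qed
  show "l2 (\<lambda>b. x b + y b)" "sqnorm (\<lambda>b. x b + y b) \<le> 2 * sqnorm x + 2 * sqnorm y"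
    using l2I[OF *] by auto
qed

lemma sqnorm_scale:
  "l2 x \<Longrightarrow> l2 (\<lambda>b. c * x b)" "sqnorm (\<lambda>b. c * x b) = (cmod c)\<^sup>2 * sqnorm x"
  unfolding l2_def sqnorm_def
  by (auto simp: norm_mult power_mult_distrib summable_on_cmult_right infsum_cmult_right')

lemma sqnorm_uminus: "sqnorm (\<lambda>b. - x b) = sqnorm x"
  by (simp add: sqnorm_def)

lemma l2_uminus: "l2 x \<Longrightarrow> l2 (\<lambda>b. - x b)"
  by (simp add: l2_def)

lemma l2_diff: "l2 x \<Longrightarrow> l2 y \<Longrightarrow> l2 (\<lambda>b. x b - y b)"
  using l2_add(1)[of x "\<lambda>b. - y b"] l2_uminus[of y] by simp

lemma l2_inner_summable:
  assumes "l2 x" "l2 y"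
  shows "(\<lambda>b. cnj (x b) * y b) summable_on UNIV"
proof -
  have "(\<lambda>b. norm (cnj (x b) * y b)) summable_on UNIV"
  proof (rule summable_on_comparison_test)
    show "(\<lambda>b. (cmod (x b))\<^sup>2 + (cmod (y b))\<^sup>2) summable_on UNIV"
      using assms unfolding l2_def by (rule summable_on_add)
    show "norm (cnj (x b) * y b) \<le> (cmod (x b))\<^sup>2 + (cmod (y b))\<^sup>2" for b
      using sum_squares_bound[of "cmod (x b)" "cmod (y b)"]
        mult_nonneg_nonneg[OF norm_ge_zero[of "x b"] norm_ge_zero[of "y b"]]
      unfolding norm_mult complex_mod_cnj by linarith
  qed simp
  then show ?thesis by (rule abs_summable_summable)
qed

lemma l2_inner_add_right:
  "l2 x \<Longrightarrow> l2 y \<Longrightarrow> l2 z \<Longrightarrow> l2_inner x (\<lambda>b. y b + z b) = l2_inner x y + l2_inner x z"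
  unfolding l2_inner_def
  by (simp add: distrib_left infsum_add l2_inner_summable)

lemma l2_inner_scale_right: "l2_inner x (\<lambda>b. c * y b) = c * l2_inner x y"
proof -
  have "(\<lambda>b. cnj (x b) * (c * y b)) = (\<lambda>b. c * (cnj (x b) * y b))" by (auto simp: ac_simps)
  then show ?thesis unfolding l2_inner_def by (simp add: infsum_cmult_right')
qed

lemma l2_inner_sum_right:
  assumes "finite J" "l2 x" "\<And>j. j \<in> J \<Longrightarrow> l2 (y j)"
  shows "l2 (\<lambda>b. \<Sum>j\<in>J. y j b)" "l2_inner x (\<lambda>b. \<Sum>j\<in>J. y j b) = (\<Sum>j\<in>J. l2_inner x (y j))"
proof -
  have "l2 (\<lambda>b. \<Sum>j\<in>J. y j b) \<and> l2_inner x (\<lambda>b. \<Sum>j\<in>J. y j b) = (\<Sum>j\<in>J. l2_inner x (y j))"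
    using assms(1,3)
  proof induction
    case empty
    show ?case by (simp add: l2_def l2_inner_def)
  next
    case (insert j J)
    then show ?case by (simp add: l2_add(1) l2_inner_add_right[OF assms(2)])
  qed
  then show "l2 (\<lambda>b. \<Sum>j\<in>J. y j b)" "l2_inner x (\<lambda>b. \<Sum>j\<in>J. y j b) = (\<Sum>j\<in>J. l2_inner x (y j))"
    by auto
qed

lemma sqnorm_add:
  assumes "l2 x" "l2 y"
  shows "sqnorm (\<lambda>b. x b + y b) = sqnorm x + sqnorm y + 2 * Re (l2_inner x y)"
proof -
  have eq: "(cmod (x b + y b))\<^sup>2 = (cmod (x b))\<^sup>2 + (cmod (y b))\<^sup>2 + 2 * Re (cnj (x b) * y b)" for b
    unfolding cmod_power2 by (simp add: power2_eq_square algebra_simps)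
  have s: "(\<lambda>b. Re (cnj (x b) * y b)) summable_on UNIV"
    by (rule summable_on_Re[OF l2_inner_summable[OF assms]])
  have xy: "(\<lambda>b. (cmod (x b))\<^sup>2 + (cmod (y b))\<^sup>2) summable_on UNIV"
    using assms unfolding l2_def by (rule summable_on_add)
  have "sqnorm (\<lambda>b. x b + y b)
        = (\<Sum>\<^sub>\<infinity>b. ((cmod (x b))\<^sup>2 + (cmod (y b))\<^sup>2) + 2 * Re (cnj (x b) * y b))"
    by (simp only: sqnorm_def eq)
  also have "\<dots> = (\<Sum>\<^sub>\<infinity>b. (cmod (x b))\<^sup>2 + (cmod (y b))\<^sup>2) + (\<Sum>\<^sub>\<infinity>b. 2 * Re (cnj (x b) * y b))"
    by (rule infsum_add[OF xy summable_on_cmult_right[OF s]])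
  also have "(\<Sum>\<^sub>\<infinity>b. (cmod (x b))\<^sup>2 + (cmod (y b))\<^sup>2) = sqnorm x + sqnorm y"
    unfolding sqnorm_def by (rule infsum_add) (use assms in \<open>auto simp: l2_def\<close>)
  also have "(\<Sum>\<^sub>\<infinity>b. 2 * Re (cnj (x b) * y b)) = 2 * Re (l2_inner x y)"
    unfolding l2_inner_def infsum_cmult_right' infsum_Re[OF l2_inner_summable[OF assms]] ..
  finally show ?thesis by simp
qed

lemma sqnorm_parallelogram:
  assumes "l2 x" "l2 y"
  shows "sqnorm (\<lambda>b. x b + y b) + sqnorm (\<lambda>b. x b - y b) = 2 * sqnorm x + 2 * sqnorm y"
proof -
  have "l2_inner x (\<lambda>b. - y b) = - l2_inner x y"
    using l2_inner_scale_right[of x "-1" y] by simp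
  then have "sqnorm (\<lambda>b. x b - y b) = sqnorm x + sqnorm y - 2 * Re (l2_inner x y)"
    using sqnorm_add[OF assms(1) l2_uminus[OF assms(2)]] by (simp add: sqnorm_uminus)
  then show ?thesis using sqnorm_add[OF assms] by simp
qed

lemma cmod_le_sqnorm: "l2 x \<Longrightarrow> (cmod (x b))\<^sup>2 \<le> sqnorm x"
  using sum_le_sqnorm[of x "{b}"] by simp

lemma orthogonal_if_norm_minimal:
  assumes x: "l2 x" and y: "l2 y"
    and min: "\<And>t. sqnorm x \<le> sqnorm (\<lambda>b. x b + t * y b)"
  shows "l2_inner x y = 0"
proof -
  define p where "p = l2_inner x y"
  have ineq: "0 \<le> (cmod t)\<^sup>2 * sqnorm y + 2 * Re (t * p)" for t
    using min[of t] sqnorm_add[OF x sqnorm_scale(1)[OF y, of t]]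
    by (simp add: sqnorm_scale(2) l2_inner_scale_right p_def)
  \<comment> \<open>With \<open>t = - s p\<^sup>*\<close> the inequality fails for small \<open>s\<close> unless \<open>p = 0\<close>; this \<open>s\<close> is small enough.\<close>
  define s where "s = 1 / (sqnorm y + 1)"
  have s: "s > 0" "s * sqnorm y < 1"
    using sqnorm_nonneg[of y] by (auto simp: s_def divide_simps)
  have "Re (- of_real s * cnj p * p) = - s * (cmod p)\<^sup>2"
    by (subst cmod_power2) (simp add: power2_eq_square algebra_simps)
  then have "0 \<le> s\<^sup>2 * (cmod p)\<^sup>2 * sqnorm y - 2 * s * (cmod p)\<^sup>2"
    using ineq[of "- of_real s * cnj p"]
 by (simp add: norm_mult power_mult_distrib)
  also have "\<dots> = s * (cmod p)\<^sup>2 * (s * sqnorm y - 2)" by (simp add: power2_eq_square algebra_simps)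
  finally have "0 \<le> s * (cmod p)\<^sup>2 * (s * sqnorm y - 2)" .
  moreover have "s * (cmod p)\<^sup>2 * (s * sqnorm y - 2) \<le> s * (cmod p)\<^sup>2 * (-1)"
    using s by (intro mult_left_mono) auto
  ultimately have "s * (cmod p)\<^sup>2 \<le> 0" by linarith
  then have "(cmod p)\<^sup>2 \<le> 0" using s(1) by (simp add: mult_le_0_iff)
  then show ?thesis by (simp add: p_def)
qed

text \<open>
  The element of the coset \<open>x0 + V\<close> of least norm. Along a minimising sequence the parallelogram law
  makes the values at each index a Cauchy sequence, and finite partial sums bound the norm of the
  pointwise limit by the infimum. So \<open>V\<close> is assumed closed under pointwise limits, a condition that
  can be read off for solution sets of equations in finitely many coefficients each.
\<close>

lemma norm_minimal_in_coset:
  assumes add: "\<And>x y. x \<in> V \<Longrightarrow> y \<in> V \<Longrightarrow> (\<lambda>b. x b + y b) \<in> V"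
    and scale: "\<And>c x. x \<in> V \<Longrightarrow> (\<lambda>b. c * x b) \<in> V"
    and closed: "\<And>f x. (\<And>k. f k \<in> V) \<Longrightarrow> (\<And>b. (\<lambda>k. f k b) \<longlonglongrightarrow> x b) \<Longrightarrow> x \<in> V"
    and zero: "(\<lambda>b. 0) \<in> V" and x0: "l2 x0"
  shows "\<exists>x. l2 x \<and> (\<lambda>b. x b - x0 b) \<in> V \<and> (\<forall>y\<in>V. l2 y \<longrightarrow> l2_inner x y = 0)"
proof -
  define A where "A = {x. l2 x \<and> (\<lambda>b. x b - x0 b) \<in> V}"
  define d where "d = (INF x\<in>A. sqnorm x)"
  have "x0 \<in> A" using x0 zero by (simp add: A_def)
  have bdd: "bdd_below (sqnorm ` A)" by (rule bdd_belowI[of _ 0]) (auto simp: sqnorm_nonneg)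
  have d_le: "d \<le> sqnorm x" if "x \<in> A" for x
    unfolding d_def by (rule cINF_lower[OF bdd that])
  have "\<exists>x\<in>A. sqnorm x < d + 1 / real (Suc k)" for k
  proof -
    have "(INF x\<in>A. sqnorm x) < d + 1 / real (Suc k)" unfolding d_def[symmetric] by simp
    then show ?thesis using \<open>x0 \<in> A\<close> bdd by (subst (asm) cINF_less_iff) auto
  qed
  then obtain f where f: "\<And>k. f k \<in> A" and fd: "\<And>k. sqnorm (f k) < d + 1 / real (Suc k)"
    by metis
  have l2f: "l2 (f k)" for k using f by (simp add: A_def)
  have mid: "(\<lambda>b. (1/2) * (f k b + f l b)) \<in> A" for k l
  proof -
    have "(\<lambda>b. (1/2) * ((f k b - x0 b) + (f l b - x0 b))) \<in> V"
      using f[of k] f[of l] by (intro scale add) (auto simp: A_def)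
    moreover have "(\<lambda>b. (1/2) * ((f k b - x0 b) + (f l b - x0 b)))
        = (\<lambda>b. (1/2) * (f k b + f l b) - x0 b)" by (auto simp: field_simps)
    ultimately have "(\<lambda>b. (1/2) * (f k b + f l b) - x0 b) \<in> V" by simp
    then show ?thesis
      unfolding A_def using sqnorm_scale(1)[OF l2_add(1)[OF l2f l2f], of "1/2"] by simp
  qed
  have close: "(cmod (f k b - f l b))\<^sup>2 \<le> 2 / real (Suc k) + 2 / real (Suc l)" for k l b
  proof -
    have "4 * d \<le> sqnorm (\<lambda>b. f k b + f l b)"
      using d_le[OF mid[of k l]] unfolding sqnorm_scale(2) by (simp add: norm_divide power2_eq_square)
    moreover have "sqnorm (\<lambda>b. f k b + f l b) + sqnorm (\<lambda>b. f k b - f l b)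
        = 2 * sqnorm (f k) + 2 * sqnorm (f l)"
      by (rule sqnorm_parallelogram[OF l2f l2f])
    moreover have "(cmod (f k b - f l b))\<^sup>2 \<le> sqnorm (\<lambda>b. f k b - f l b)"
      by (rule cmod_le_sqnorm[OF l2_diff[OF l2f l2f]])
    ultimately have "(cmod (f k b - f l b))\<^sup>2 \<le> 2 * (1 / real (Suc k)) + 2 * (1 / real (Suc l))"
      using fd[of k] fd[of l] by linarith
    then show ?thesis by simp
  qed
  have "Cauchy (\<lambda>k. f k b)" for b
  proof (rule metric_CauchyI)
    fix e :: real assume e: "0 < e"
    obtain K where "inverse (real (Suc K)) < e\<^sup>2 / 4"
      using reals_Archimedean[of "e\<^sup>2 / 4"] e by auto
    then have K: "4 * inverse (real (Suc K)) < e\<^sup>2" by simp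
    have "dist (f k b) (f l b) < e" if "k \<ge> K" "l \<ge> K" for k l
    proof -
      have "inverse (real (Suc k)) \<le> inverse (real (Suc K))"
        "inverse (real (Suc l)) \<le> inverse (real (Suc K))"
        using that by (auto intro!: le_imp_inverse_le)
      then have "(cmod (f k b - f l b))\<^sup>2 < e\<^sup>2"
        using close[of k b l] K unfolding divide_inverse by linarith
      then show ?thesis using e by (simp add: dist_norm power_less_imp_less_base)
    qed
    then show "\<exists>M. \<forall>m\<ge>M. \<forall>n\<ge>M. dist (f m b) (f n b) < e" by blast
  qed
  then have "\<forall>b. \<exists>l. (\<lambda>k. f k b) \<longlonglongrightarrow> l" by (simp add: Cauchy_convergent_iff convergent_def)
  then obtain x where lim: "\<And>b. (\<lambda>k. f k b) \<longlonglongrightarrow> x b" by metis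
  have *: "(\<Sum>b\<in>B. (cmod (x b))\<^sup>2) \<le> d" if "finite B" for B
  proof (rule LIMSEQ_le)
    show "(\<lambda>k. \<Sum>b\<in>B. (cmod (f k b))\<^sup>2) \<longlonglongrightarrow> (\<Sum>b\<in>B. (cmod (x b))\<^sup>2)"
      by (intro tendsto_intros lim)
    show "(\<lambda>k. d + 1 / real (Suc k)) \<longlonglongrightarrow> d"
      using tendsto_add[OF tendsto_const LIMSEQ_inverse_real_of_nat, of d] by (simp add: divide_inverse)
    show "\<exists>N. \<forall>k\<ge>N. (\<Sum>b\<in>B. (cmod (f k b))\<^sup>2) \<le> d + 1 / real (Suc k)"
      using sum_le_sqnorm[OF l2f that] fd by (meson less_le_trans order_less_imp_le order_trans)
  qed
  have l2x: "l2 x" and xd: "sqnorm x \<le> d" using l2I[OF *] by auto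
  have xV: "(\<lambda>b. x b - x0 b) \<in> V"
    by (rule closed[of "\<lambda>k b. f k b - x0 b"]) (use f lim in \<open>auto simp: A_def intro!: tendsto_intros\<close>)
  show ?thesis
  proof (intro exI[of _ x] conjI ballI impI l2x xV)
    fix y assume y: "y \<in> V" "l2 y"
    show "l2_inner x y = 0"
    proof (rule orthogonal_if_norm_minimal[OF l2x y(2)])
      fix t
      have "(\<lambda>b. (x b - x0 b) + t * y b) \<in> V" by (intro add scale xV y)
      then have "(\<lambda>b. x b + t * y b) \<in> A"
        using l2_add(1)[OF l2x sqnorm_scale(1)[OF y(2)]] by (simp add: A_def algebra_simps)
      then show "sqnorm x \<le> sqnorm (\<lambda>b. x b + t * y b)" using d_le xd by force
    qed
  qed
qed

section \<open>Bounded functions are bounded left multipliers\<close>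

text \<open>
  The constant refers to squared norms.
\<close>

definition l2_multiplier :: "real \<Rightarrow> 'a nc_series \<Rightarrow> bool" where
  "l2_multiplier c f \<longleftrightarrow> (\<forall>g. l2 (nc_coeff g) \<longrightarrow>
     l2 (nc_coeff (f * g)) \<and> sqnorm (nc_coeff (f * g)) \<le> c * sqnorm (nc_coeff g))"

lemma vec_norm2_squared: "(vec_norm2 v)\<^sup>2 = (\<Sum>i<dim_vec v. (cmod (v $ i))\<^sup>2)"
  by (simp add: vec_norm2_def sum_nonneg)

lemma vec_norm2_nonneg: "0 \<le> vec_norm2 v"
  by (simp add: vec_norm2_def sum_nonneg)

lemma cmod_sum_at_most_one_squared:
  assumes "finite P" "\<And>p q. p \<in> P \<Longrightarrow> q \<in> P \<Longrightarrow> Q p \<Longrightarrow> Q q \<Longrightarrow> p = q"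
  shows "(cmod (\<Sum>p\<in>P. if Q p then a p else 0))\<^sup>2 = (\<Sum>p\<in>P. if Q p then (cmod (a p))\<^sup>2 else 0)"
proof (cases "\<exists>p\<in>P. Q p")
  case True
  then obtain p where p: "p \<in> P" "Q p" by blast
  have *: "(\<Sum>q\<in>P. if Q q then h q else 0) = h p" for h :: "_ \<Rightarrow> 'c::comm_monoid_add"
  proof -
    have "(\<Sum>q\<in>P. if Q q then h q else 0) = (\<Sum>q\<in>P. if q = p then h q else 0)"
      using assms(2) p by (intro sum.cong) auto
    then show ?thesis using assms(1) p by simp
  qed
  show ?thesis by (simp only: *)
next
  case False
  have "(\<Sum>q\<in>P. if Q q then h q else 0) = 0" for h :: "_ \<Rightarrow> 'c::comm_monoid_add"
    using False by (intro sum.neutral) auto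
  from this[of a] this[of "\<lambda>p. (cmod (a p))\<^sup>2"] show ?thesis by simp
qed

lemma infsum_single:
  assumes "\<And>x. x \<noteq> a \<Longrightarrow> f x = 0"
  shows "(\<Sum>\<^sub>\<infinity>x. f x) = (f a :: complex)"
proof -
  have "(f has_sum f a) UNIV"
    by (rule has_sum_finite_neutralI[of "{a}"]) (use assms in auto)
  then show ?thesis by (rule infsumI)
qed

text \<open>
  The left shifts compressed to the span of finitely many words, a set closed under deleting
  first letters, and scaled by \<open>r\<close>. They are finite matrices in the row ball, and evaluating a
  series at them reproduces, up to powers of \<open>r\<close>, left multiplication by that series.
\<close>

locale truncated_shifts =
  fixes B :: "'a list set" and ix :: "nat \<Rightarrow> 'a list" and m :: nat and r :: real
  assumes ix: "bij_betw ix {..<m} B"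
    and suffix_closed: "\<And>k w. k # w \<in> B \<Longrightarrow> w \<in> B"
    and r: "0 \<le> r" "r < 1"
begin

definition shift :: "'a \<Rightarrow> complex mat" where
  "shift k = mat m m (\<lambda>(i,j). if ix i = k # ix j then of_real r else 0)"

lemma shift_carrier [simp]: "shift k \<in> carrier_mat m m" "dim_row (shift k) = m" "dim_col (shift k) = m"
  by (simp_all add: shift_def)

lemma shift_index: "i < m \<Longrightarrow> j < m \<Longrightarrow> shift k $$ (i,j) = (if ix i = k # ix j then of_real r else 0)"
  by (simp add: shift_def)

lemma ix_inj: "i < m \<Longrightarrow> j < m \<Longrightarrow> ix i = ix j \<longleftrightarrow> i = j"
  using ix by (auto simp: bij_betw_def inj_on_def)

lemma ix_mem: "i < m \<Longrightarrow> ix i \<in> B"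
  using ix by (auto simp: bij_betw_def)

lemma ix_surj: "b \<in> B \<Longrightarrow> \<exists>i<m. ix i = b"
  using ix by (auto simp: bij_betw_def)

lemma drop_mem: "w \<in> B \<Longrightarrow> drop k w \<in> B"
proof (induction k)
  case (Suc k)
  then show ?case
    by (cases "drop k w") (auto simp: drop_Suc tl_drop[symmetric] dest: suffix_closed)
qed simp

lemma word_eval_carrier: "word_eval m shift w \<in> carrier_mat m m"
  by (induction w) (auto intro: mult_carrier_mat)

lemma word_eval_shift:
  "i < m \<Longrightarrow> j < m \<Longrightarrow>
   word_eval m shift w $$ (i,j) = (if ix i = w @ ix j then of_real (r ^ length w) else 0)"
proof (induction w arbitrary: i)
  case Nil
  then show ?case by (simp add: ix_inj)
next
  case (Cons k w)
  have "word_eval m shift (k # w) $$ (i,j)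
        = (\<Sum>l<m. (if ix i = k # ix l then of_real r else 0) *
                   (if ix l = w @ ix j then of_real (r ^ length w) else 0))"
    using Cons word_eval_carrier[of w]
    by (simp add: scalar_prod_def shift_index atLeast0LessThan)
  also have "\<dots> = (if ix i = k # w @ ix j then of_real (r ^ length (k # w)) else 0)"
  proof (cases "ix i = k # w @ ix j")
    case True
    then have "w @ ix j \<in> B" using ix_mem[OF Cons.prems(1)] suffix_closed by simp
    then obtain l0 where l0: "l0 < m" "ix l0 = w @ ix j" using ix_surj by blast
    have "(\<Sum>l<m. (if ix i = k # ix l then of_real r else 0) *
                   (if ix l = w @ ix j then of_real (r ^ length w) else 0))
          = (\<Sum>l<m. if l = l0 then of_real r * of_real (r ^ length w) else (0 :: complex))"
      using l0 True by (intro sum.cong) (auto simp: ix_inj simp flip: l0(2))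
    then show ?thesis using l0 True by simp
  qed (auto intro!: sum.neutral)
  finally show ?case by simp
qed

lemma shift_in_row_ball: "shift \<in> row_ball m"
proof -
  have *: "vec_norm2 (vec m (\<lambda>i. \<Sum>k\<in>F. (shift k *\<^sub>v x k) $ i))
        \<le> r * sqrt (\<Sum>k\<in>F. (vec_norm2 (x k))\<^sup>2)"
    if F: "finite F" and x: "\<And>k. k \<in> F \<Longrightarrow> x k \<in> carrier_vec m" for F and x :: "'a \<Rightarrow> complex vec"
  proof -
    let ?P = "F \<times> {..<m}"
    let ?Q = "\<lambda>i (k,j). ix i = k # ix j"
    let ?a = "\<lambda>(k,j). of_real r * x k $ j"
    have entry: "(\<Sum>k\<in>F. (shift k *\<^sub>v x k) $ i) = (\<Sum>p\<in>?P. if ?Q i p then ?a p else 0)"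
      if i: "i < m" for i
    proof -
      have "(\<Sum>k\<in>F. (shift k *\<^sub>v x k) $ i)
            = (\<Sum>k\<in>F. \<Sum>j<m. if ix i = k # ix j then of_real r * x k $ j else 0)"
        using x i by (intro sum.cong refl)
          (auto simp: scalar_prod_def shift_def atLeast0LessThan intro!: sum.cong)
      then show ?thesis unfolding sum.cartesian_product by (auto intro!: sum.cong)
    qed
    have "(vec_norm2 (vec m (\<lambda>i. \<Sum>k\<in>F. (shift k *\<^sub>v x k) $ i)))\<^sup>2
          = (\<Sum>i<m. (cmod (\<Sum>p\<in>?P. if ?Q i p then ?a p else 0))\<^sup>2)"
      unfolding vec_norm2_squared by (intro sum.cong) (auto simp: entry simp del: index_mult_mat_vec)
    also have "\<dots> = (\<Sum>i<m. \<Sum>p\<in>?P. if ?Q i p then (cmod (?a p))\<^sup>2 else 0)"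
      by (intro sum.cong refl cmod_sum_at_most_one_squared) (use F ix_inj in auto)
    also have "\<dots> = (\<Sum>p\<in>?P. \<Sum>i<m. if ?Q i p then (cmod (?a p))\<^sup>2 else 0)"
      by (rule sum.swap)
    also have "\<dots> \<le> (\<Sum>p\<in>?P. (cmod (?a p))\<^sup>2)"
    proof (rule sum_mono)
      fix p assume "p \<in> ?P"
      show "(\<Sum>i<m. if ?Q i p then (cmod (?a p))\<^sup>2 else 0) \<le> (cmod (?a p))\<^sup>2"
      proof (cases "\<exists>i<m. ?Q i p")
        case True
        then obtain i0 where i0: "i0 < m" "?Q i0 p" by blast
        have "(\<Sum>i<m. if ?Q i p then (cmod (?a p))\<^sup>2 else 0)
              = (\<Sum>i<m. if i = i0 then (cmod (?a p))\<^sup>2 else 0)"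
          using i0 ix_inj by (intro sum.cong refl) (metis (mono_tags, lifting) case_prod_unfold lessThan_iff)
        then show ?thesis using i0 by simp
      next
        case False
        then have "(\<Sum>i<m. if ?Q i p then (cmod (?a p))\<^sup>2 else 0) = 0"
          by (intro sum.neutral) auto
        then show ?thesis by simp
      qed
    qed
    also have "\<dots> = r\<^sup>2 * (\<Sum>k\<in>F. (vec_norm2 (x k))\<^sup>2)"
      using x[THEN carrier_vecD] by (simp add: vec_norm2_squared sum.cartesian_product' sum_distrib_left
          norm_mult power_mult_distrib)
    finally have "(vec_norm2 (vec m (\<lambda>i. \<Sum>k\<in>F. (shift k *\<^sub>v x k) $ i)))\<^sup>2
        \<le> r\<^sup>2 * (\<Sum>k\<in>F. (vec_norm2 (x k))\<^sup>2)" .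
    then have "sqrt ((vec_norm2 (vec m (\<lambda>i. \<Sum>k\<in>F. (shift k *\<^sub>v x k) $ i)))\<^sup>2)
        \<le> sqrt (r\<^sup>2 * (\<Sum>k\<in>F. (vec_norm2 (x k))\<^sup>2))"
      by (rule real_sqrt_le_mono)
    then show ?thesis using r by (simp add: real_sqrt_mult vec_norm2_nonneg)
  qed
  show ?thesis unfolding row_ball_def using * r by auto
qed

lemma nc_eval_shift:
  assumes "i < m"
  shows "(nc_eval m f shift *\<^sub>v vec m (\<lambda>j. g (ix j))) $ i
    = (\<Sum>k\<le>length (ix i). of_real (r ^ k) * (nc_coeff f (take k (ix i)) * g (drop k (ix i))))"
proof -
  let ?a = "ix i"
  let ?h = "\<lambda>b. (\<Sum>\<^sub>\<infinity>w. nc_coeff f w * (if ?a = w @ b then of_real (r ^ length w) else 0)) * g b"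
  have "(nc_eval m f shift *\<^sub>v vec m (\<lambda>j. g (ix j))) $ i = (\<Sum>j<m. ?h (ix j))"
    using assms by (simp add: nc_eval_def scalar_prod_def atLeast0LessThan word_eval_shift cong: infsum_cong)
  also have "\<dots> = (\<Sum>b\<in>B. ?h b)" by (rule sum.reindex_bij_betw[OF ix])
  also have "\<dots> = (\<Sum>b\<in>(\<lambda>k. drop k ?a) ` {..length ?a}. ?h b)"
  proof (rule sum.mono_neutral_right)
    show "finite B" using ix bij_betw_finite by blast
    show "(\<lambda>k. drop k ?a) ` {..length ?a} \<subseteq> B" using ix_mem[OF assms] drop_mem by auto
    show "\<forall>b\<in>B - (\<lambda>k. drop k ?a) ` {..length ?a}. ?h b = 0"
    proof
      fix b assume b: "b \<in> B - (\<lambda>k. drop k ?a) ` {..length ?a}"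
      have "?a \<noteq> w @ b" for w
      proof
        assume "?a = w @ b"
        then have "b = drop (length w) ?a" "length w \<le> length ?a" by simp_all
        then show False using b by blast
      qed
      then show "?h b = 0" by simp
    qed
  qed
  also have "\<dots> = (\<Sum>k\<le>length ?a. ?h (drop k ?a))"
  proof (subst sum.reindex)
    show "inj_on (\<lambda>k. drop k ?a) {..length ?a}"
      by (rule inj_onI) (metis atMost_iff diff_diff_cancel length_drop)
  qed simp
  also have "\<dots> = (\<Sum>k\<le>length ?a. of_real (r ^ k) * (nc_coeff f (take k ?a) * g (drop k ?a)))"
  proof (intro sum.cong refl)
    fix k assume k: "k \<in> {..length ?a}"
    have *: "?a = w @ drop k ?a \<longleftrightarrow> w = take k ?a" for w
      by (metis append_same_eq append_take_drop_id)
    have "(\<Sum>\<^sub>\<infinity>w. nc_coeff f w * (if ?a = w @ drop k ?a then of_real (r ^ length w) else 0))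
          = nc_coeff f (take k ?a) * of_real (r ^ k)"
      using k by (subst infsum_single[of "take k ?a"]) (auto simp: * min_absorb2)
    then show "?h (drop k ?a) = of_real (r ^ k) * (nc_coeff f (take k ?a) * g (drop k ?a))" by simp
  qed
  finally show ?thesis .
qed

end

text \<open>
  A partial sum of the squared coefficients of \<open>f * g\<close> over a finite set of words involves only
  finitely many coefficients of \<open>g\<close>, those at the suffixes of these words. On the set of all these
  suffixes the truncated shifts compute it up to powers of \<open>r\<close>, with a bound that is uniform in
  \<open>r < 1\<close> and in the size of the set.
\<close>

lemma Hinf_imp_l2_multiplier:
  assumes "f \<in> Hinf"
  shows "\<exists>c. l2_multiplier c f"
proof -
  obtain C where C: "\<And>m Z v. Z \<in> row_ball m \<Longrightarrow> v \<in> carrier_vec m \<Longrightarrow>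
      vec_norm2 (nc_eval m f Z *\<^sub>v v) \<le> C * vec_norm2 v"
    using assms unfolding Hinf_def by blast
  have "(\<Sum>w\<in>T. (cmod (nc_coeff (f * g) w))\<^sup>2) \<le> C\<^sup>2 * sqnorm (nc_coeff g)"
    if g: "l2 (nc_coeff g)" and T: "finite T" for g T
  proof -
    define B where "B = (\<Union>w\<in>T. (\<lambda>k. drop k w) ` {..length w})"
    have finB: "finite B" using T by (simp add: B_def)
    have TB: "T \<subseteq> B"
    proof
      fix w assume "w \<in> T"
      then show "w \<in> B" unfolding B_def by (intro UN_I[of w] image_eqI[of _ _ 0]) auto
    qed
    have closed: "w \<in> B" if "k # w \<in> B" for k w
    proof -
      obtain u i where u: "u \<in> T" "k # w = drop i u" "i \<le> length u" using \<open>k # w \<in> B\<close> by (auto simp: B_def)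
      have "w = drop (Suc i) u" using u(2) by (metis drop_Suc list.sel(3) tl_drop)
      moreover have "Suc i \<le> length u" using u(2,3)
        by (metis drop_all le_antisym list.distinct(1) not_less_eq_eq)
      ultimately show ?thesis using u(1) by (auto simp: B_def)
    qed
    obtain ix where "bij_betw ix {0..<card B} B" using ex_bij_betw_nat_finite[OF finB] by blast
    then have ix: "bij_betw ix {..<card B} B" by (simp add: atLeast0LessThan)
    let ?m = "card B"
    let ?p = "\<lambda>r w. \<Sum>k\<le>length w. of_real (r ^ k) * (nc_coeff f (take k w) * nc_coeff g (drop k w))"
    have bound: "(\<Sum>w\<in>B. (cmod (?p r w))\<^sup>2) \<le> C\<^sup>2 * sqnorm (nc_coeff g)" if "0 \<le> r" "r < 1" for r
    proof -
      interpret truncated_shifts B ix ?m r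
        using ix closed that by unfold_locales
      let ?v = "vec ?m (\<lambda>j. nc_coeff g (ix j))"
      have "(\<Sum>w\<in>B. (cmod (?p r w))\<^sup>2) = (\<Sum>i<?m. (cmod (?p r (ix i)))\<^sup>2)"
        by (rule sum.reindex_bij_betw[OF ix, symmetric])
      also have "\<dots> = (vec_norm2 (nc_eval ?m f shift *\<^sub>v ?v))\<^sup>2"
        unfolding vec_norm2_squared by (simp add: nc_eval_def nc_eval_shift[symmetric] del: of_real_power index_mult_mat_vec)
      also have "\<dots> \<le> (C * vec_norm2 ?v)\<^sup>2"
        by (intro power_mono C shift_in_row_ball vec_norm2_nonneg) simp
      also have "\<dots> = C\<^sup>2 * (\<Sum>i<?m. (cmod (nc_coeff g (ix i)))\<^sup>2)"
        by (simp add: power_mult_distrib vec_norm2_squared)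
      also have "(\<Sum>i<?m. (cmod (nc_coeff g (ix i)))\<^sup>2) = (\<Sum>w\<in>B. (cmod (nc_coeff g w))\<^sup>2)"
        by (rule sum.reindex_bij_betw[OF ix])
      also have "C\<^sup>2 * \<dots> \<le> C\<^sup>2 * sqnorm (nc_coeff g)"
        by (intro mult_left_mono sum_le_sqnorm g finB) simp
      finally show ?thesis .
    qed
    have "(\<Sum>w\<in>B. (cmod (?p 1 w))\<^sup>2) \<le> C\<^sup>2 * sqnorm (nc_coeff g)"
    proof (rule tendsto_upperbound)
      show "((\<lambda>r. \<Sum>w\<in>B. (cmod (?p r w))\<^sup>2) \<longlongrightarrow> (\<Sum>w\<in>B. (cmod (?p 1 w))\<^sup>2)) (at_left 1)"
        by (intro tendsto_intros)
      show "\<forall>\<^sub>F r in at_left 1. (\<Sum>w\<in>B. (cmod (?p r w))\<^sup>2) \<le> C\<^sup>2 * sqnorm (nc_coeff g)"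
        using eventually_at_left_real[of 0 "1::real"] by (auto elim!: eventually_mono intro!: bound simp del: of_real_power)
    qed simp
    moreover have "?p 1 w = nc_coeff (f * g) w" for w by (simp add: times_nc_series.rep_eq)
    ultimately have "(\<Sum>w\<in>B. (cmod (nc_coeff (f * g) w))\<^sup>2) \<le> C\<^sup>2 * sqnorm (nc_coeff g)" by simp
    moreover have "(\<Sum>w\<in>T. (cmod (nc_coeff (f * g) w))\<^sup>2) \<le> (\<Sum>w\<in>B. (cmod (nc_coeff (f * g) w))\<^sup>2)"
      by (intro sum_mono2 finB TB) auto
    ultimately show ?thesis by linarith
  qed
  then have "l2_multiplier (C\<^sup>2) f" unfolding l2_multiplier_def using l2I by metis
  then show ?thesis by blast
qed

section \<open>Bounded left multipliers are bounded functions\<close>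

lemma cmod_sum_cnj_mult_squared_le:
  "(cmod (\<Sum>i\<in>I. cnj (x i) * y i))\<^sup>2 \<le> (\<Sum>i\<in>I. (cmod (x i))\<^sup>2) * (\<Sum>i\<in>I. (cmod (y i))\<^sup>2)"
proof -
  have "cmod (\<Sum>i\<in>I. cnj (x i) * y i) \<le> (\<Sum>i\<in>I. cmod (x i) * cmod (y i))"
    by (rule order_trans[OF norm_sum]) (simp add: norm_mult)
  then have "(cmod (\<Sum>i\<in>I. cnj (x i) * y i))\<^sup>2 \<le> (\<Sum>i\<in>I. cmod (x i) * cmod (y i))\<^sup>2"
    by (intro power_mono) auto
  also have "\<dots> \<le> (\<Sum>i\<in>I. (cmod (x i))\<^sup>2) * (\<Sum>i\<in>I. (cmod (y i))\<^sup>2)"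
    by (rule Cauchy_Schwarz_ineq_sum)
  finally show ?thesis .
qed

text \<open>
  The inductive step is the Schur complement: minimising the form over the last coordinate leaves a
  positive definite form in the others.
\<close>

lemma cholesky:
  fixes D :: "nat \<Rightarrow> nat \<Rightarrow> complex"
  assumes "\<And>i j. i < m \<Longrightarrow> j < m \<Longrightarrow> D j i = cnj (D i j)"
    and "\<And>x. \<exists>i<m. x i \<noteq> 0 \<Longrightarrow> 0 < Re (\<Sum>i<m. \<Sum>j<m. cnj (x i) * D i j * x j)"
  shows "\<exists>b. \<forall>i<m. \<forall>j<m. D i j = (\<Sum>l<m. cnj (b l i) * b l j)"
  using assms
proof (induction m arbitrary: D)
  case (Suc m)
  note herm = Suc.prems(1) and pos = Suc.prems(2)
  define d where "d = Re (D m m)"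
  have "0 < Re (\<Sum>i<Suc m. \<Sum>j<Suc m. cnj (if i = m then 1 else 0) * D i j * (if j = m then 1 else 0))"
    by (rule pos) auto
  moreover have "(\<Sum>i<Suc m. \<Sum>j<Suc m. cnj (if i = m then 1 else 0) * D i j * (if j = m then 1 else 0)) = D m m"
    by (simp add: if_distrib[of cnj] if_distribR cong: if_cong)
  ultimately have d: "d > 0" by (simp add: d_def)
  have Dmm: "D m m = of_real d"
    using herm[of m m] by (auto simp: d_def complex_eq_iff)
  have Dm: "D i m = cnj (D m i)" if "i < m" for i using herm[of m i] that by simp
  define D' where "D' i j = D i j - cnj (D m i) * D m j / of_real d" for i j
  have "\<exists>b. \<forall>i<m. \<forall>j<m. D' i j = (\<Sum>l<m. cnj (b l i) * b l j)"
  proof (rule Suc.IH)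
    show "D' j i = cnj (D' i j)" if "i < m" "j < m" for i j
      using herm[of i j] that by (simp add: D'_def ac_simps)
    show "0 < Re (\<Sum>i<m. \<Sum>j<m. cnj (x i) * D' i j * x j)" if x: "\<exists>i<m. x i \<noteq> 0" for x
    proof -
      define s where "s = (\<Sum>j<m. D m j * x j)"
      \<comment> \<open>the last coordinate at which the form is least\<close>
      define y where "y = x(m := - s / of_real d)"
      have "0 < Re (\<Sum>i<Suc m. \<Sum>j<Suc m. cnj (y i) * D i j * y j)"
        by (rule pos) (use x in \<open>auto simp: y_def intro: less_SucI\<close>)
      also have "(\<Sum>i<Suc m. \<Sum>j<Suc m. cnj (y i) * D i j * y j)
          = (\<Sum>i<m. \<Sum>j<m. cnj (y i) * D i j * y j) + (\<Sum>i<m. cnj (y i) * D i m * y m)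
            + ((\<Sum>j<m. cnj (y m) * D m j * y j) + cnj (y m) * D m m * y m)"
        by (simp add: sum.distrib)
      also have "(\<Sum>i<m. \<Sum>j<m. cnj (y i) * D i j * y j) = (\<Sum>i<m. \<Sum>j<m. cnj (x i) * D i j * x j)"
        by (simp add: y_def)
      also have "(\<Sum>i<m. cnj (y i) * D i m * y m) = cnj s * y m"
        unfolding s_def cnj_sum sum_distrib_right by (intro sum.cong) (auto simp: y_def Dm)
      also have "(\<Sum>j<m. cnj (y m) * D m j * y j) = cnj (y m) * s"
        unfolding s_def sum_distrib_left by (intro sum.cong) (auto simp: y_def)
      also have "D m m = of_real d" by (rule Dmm)
      also have "(\<Sum>i<m. \<Sum>j<m. cnj (x i) * D i j * x j) + cnj s * y m
            + (cnj (y m) * s + cnj (y m) * of_real d * y m)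
          = (\<Sum>i<m. \<Sum>j<m. cnj (x i) * D i j * x j) - cnj s * s / of_real d"
        using d by (simp add: y_def field_simps)
      also have "cnj s * s / of_real d = (\<Sum>i<m. \<Sum>j<m. cnj (x i) * (cnj (D m i) * D m j / of_real d) * x j)"
        unfolding s_def cnj_sum sum_product sum_divide_distrib by (intro sum.cong) auto
      also have "(\<Sum>i<m. \<Sum>j<m. cnj (x i) * D i j * x j) - \<dots> = (\<Sum>i<m. \<Sum>j<m. cnj (x i) * D' i j * x j)"
        by (simp add: D'_def sum_subtractf algebra_simps)
      finally show ?thesis .
    qed
  qed
  then obtain b where b: "\<And>i j. i < m \<Longrightarrow> j < m \<Longrightarrow> D' i j = (\<Sum>l<m. cnj (b l i) * b l j)" by blast
  define b' where "b' l i = (if l = m then D m i / of_real (sqrt d) else if i = m then 0 else b l i)" for l i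
  have dd: "complex_of_real (sqrt d) * complex_of_real (sqrt d) = of_real d"
    using d by (simp flip: of_real_mult)
  have "D i j = (\<Sum>l<Suc m. cnj (b' l i) * b' l j)" if ij: "i < Suc m" "j < Suc m" for i j
  proof -
    have "(\<Sum>l<Suc m. cnj (b' l i) * b' l j)
          = (\<Sum>l<m. cnj (b' l i) * b' l j) + cnj (D m i) * D m j / of_real d"
      using dd by (simp add: b'_def)
    also have "(\<Sum>l<m. cnj (b' l i) * b' l j) = (if i = m \<or> j = m then 0 else D' i j)"
      using ij b[of i j] by (auto simp: b'_def intro!: sum.cong)
    also have "\<dots> + cnj (D m i) * D m j / of_real d = D i j"
      using ij d Dm by (auto simp: D'_def Dmm less_Suc_eq)
    finally show ?thesis by simp
  qed
  then show ?case by blast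
qed simp

definition level_words :: "'a set \<Rightarrow> nat \<Rightarrow> 'a list set" where
  "level_words F j = {w. set w \<subseteq> F \<and> length w = j}"

definition short_words :: "'a set \<Rightarrow> nat \<Rightarrow> 'a list set" where
  "short_words F N = {w. set w \<subseteq> F \<and> length w \<le> N}"

lemma finite_level_words: "finite F \<Longrightarrow> finite (level_words F j)"
  unfolding level_words_def by (rule finite_lists_length_eq)

lemma finite_short_words: "finite F \<Longrightarrow> finite (short_words F N)"
  unfolding short_words_def by (rule finite_lists_length_le)

lemma sum_level_words_Suc:
  assumes "finite F"
  shows "(\<Sum>w\<in>level_words F (Suc j). h w) = (\<Sum>w\<in>level_words F j. \<Sum>k\<in>F. h (w @ [k]))"
proof -
  have "(\<Sum>w\<in>level_words F (Suc j). h w) = (\<Sum>(w,k)\<in>level_words F j \<times> F. h (w @ [k]))"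
  proof (rule sum.reindex_bij_witness[where i = "\<lambda>(w,k). w @ [k]" and j = "\<lambda>w. (butlast w, last w)"])
    fix w assume w: "w \<in> level_words F (Suc j)"
    then have ne: "w \<noteq> []" by (auto simp: level_words_def)
    then show "(case (butlast w, last w) of (w, k) \<Rightarrow> w @ [k]) = w" by simp
    show "(butlast w, last w) \<in> level_words F j \<times> F"
      using w ne last_in_set[of w] by (auto simp: level_words_def dest: in_set_butlastD)
    show "(case (butlast w, last w) of (w, k) \<Rightarrow> h (w @ [k])) = h w" using ne by simp
  qed (auto simp: level_words_def)
  then show ?thesis by (simp add: sum.cartesian_product)
qed

lemma sum_short_words:
  assumes "finite F"
  shows "(\<Sum>w\<in>short_words F N. h w) = (\<Sum>j\<le>N. \<Sum>w\<in>level_words F j. h w)"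
proof (induction N)
  case 0
  have "short_words F 0 = level_words F 0" by (auto simp: short_words_def level_words_def)
  then show ?case by simp
next
  case (Suc N)
  have "short_words F (Suc N) = short_words F N \<union> level_words F (Suc N)"
    by (auto simp: short_words_def level_words_def)
  moreover have "short_words F N \<inter> level_words F (Suc N) = {}"
    by (auto simp: short_words_def level_words_def)
  ultimately show ?case
    using Suc assms by (simp add: sum.union_disjoint finite_level_words finite_short_words)
qed

lemma sum_splittings_short_words:
  "(\<Sum>b\<in>short_words F N. \<Sum>k\<le>length b. h (take k b) (drop k b))
    = (\<Sum>a\<in>short_words F N. \<Sum>w\<in>short_words F (N - length a). h a w)" if "finite F"
proof -
  have "(\<Sum>b\<in>short_words F N. \<Sum>k\<le>length b. h (take k b) (drop k b))
      = (\<Sum>(b,k)\<in>Sigma (short_words F N) (\<lambda>b. {..length b}). h (take k b) (drop k b))"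
    by (rule sum.Sigma) (auto simp: finite_short_words that)
  also have "\<dots> = (\<Sum>(a,w)\<in>Sigma (short_words F N) (\<lambda>a. short_words F (N - length a)). h a w)"
    by (rule sum.reindex_bij_witness[where i = "\<lambda>(a,w). (a @ w, length a)"
          and j = "\<lambda>(b,k). (take k b, drop k b)"])
       (auto simp: short_words_def dest: in_set_takeD in_set_dropD)
  also have "\<dots> = (\<Sum>a\<in>short_words F N. \<Sum>w\<in>short_words F (N - length a). h a w)"
    by (rule sum.Sigma[symmetric]) (auto simp: finite_short_words that)
  finally show ?thesis .
qed

lemma l2_multiplier_const_nonneg:
  fixes f :: "'a nc_series"
  assumes "l2_multiplier c f"
  shows "0 \<le> c"
proof -
  have 1: "l2 (nc_coeff (1 :: 'a nc_series))" "sqnorm (nc_coeff (1 :: 'a nc_series)) = 1"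
    using l2_finite_support[of "{[]}" "nc_coeff (1 :: 'a nc_series)"] by (auto simp: one_nc_series.rep_eq)
  then have "sqnorm (nc_coeff (f * 1)) \<le> c" using assms unfolding l2_multiplier_def by force
  then show ?thesis using sqnorm_nonneg order_trans by blast
qed

lemma has_sum_finite_sum:
  fixes f :: "'i \<Rightarrow> 'b \<Rightarrow> 'c :: {topological_comm_monoid_add}"
  assumes "\<And>i. i \<in> I \<Longrightarrow> (f i has_sum s i) A"
  shows "((\<lambda>x. \<Sum>i\<in>I. f i x) has_sum (\<Sum>i\<in>I. s i)) A"
  using assms by (induction I rule: infinite_finite_induct) (auto intro: has_sum_add)

text \<open>
  Vectors are functions of which only the values on \<open>{..<m}\<close> matter, and \<open>word_adj w\<close> is the adjoint
  of \<open>Z\<^sup>w\<close>, as \<open>sum_word_eval\<close> states. Adjoints are preferred because the row condition becomes a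
  bound for a sum of squares (\<open>nrm_letter_adj_le\<close>), which can be iterated over words.
\<close>

locale row_contraction =
  fixes m :: nat and Z :: "'a \<Rightarrow> complex mat" and r :: real
  assumes Z: "\<And>k. Z k \<in> carrier_mat m m" and r: "0 \<le> r" "r < 1"
    and row_bound: "\<And>F x. finite F \<Longrightarrow> (\<And>k. k \<in> F \<Longrightarrow> x k \<in> carrier_vec m) \<Longrightarrow>
          vec_norm2 (vec m (\<lambda>i. \<Sum>k\<in>F. (Z k *\<^sub>v x k) $ i)) \<le> r * sqrt (\<Sum>k\<in>F. (vec_norm2 (x k))\<^sup>2)"
begin

definition ip :: "(nat \<Rightarrow> complex) \<Rightarrow> (nat \<Rightarrow> complex) \<Rightarrow> complex" where
  "ip x y = (\<Sum>i<m. cnj (x i) * y i)"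

definition nrm :: "(nat \<Rightarrow> complex) \<Rightarrow> real" where
  "nrm x = (\<Sum>i<m. (cmod (x i))\<^sup>2)"

definition letter_adj :: "'a \<Rightarrow> (nat \<Rightarrow> complex) \<Rightarrow> nat \<Rightarrow> complex" where
  "letter_adj k y j = (\<Sum>i<m. cnj (Z k $$ (i,j)) * y i)"

fun word_adj :: "'a list \<Rightarrow> (nat \<Rightarrow> complex) \<Rightarrow> nat \<Rightarrow> complex" where
  "word_adj [] y = y"
| "word_adj (k # w) y = word_adj w (letter_adj k y)"

lemma word_adj_append: "word_adj (a @ w) y = word_adj w (word_adj a y)"
  by (induction a arbitrary: y) auto

lemma nrm_nonneg: "0 \<le> nrm x" by (simp add: nrm_def sum_nonneg)

lemma ip_self: "ip x x = of_real (nrm x)"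
  unfolding ip_def nrm_def of_real_sum by (intro sum.cong refl) (metis complex_norm_square mult.commute)

lemma word_eval_carrier: "word_eval m Z w \<in> carrier_mat m m"
  by (induction w) (use Z in \<open>auto intro: mult_carrier_mat\<close>)

lemma sum_word_eval:
  "j < m \<Longrightarrow> (\<Sum>i<m. cnj (y i) * word_eval m Z w $$ (i,j)) = cnj (word_adj w y j)"
proof (induction w arbitrary: y)
  case Nil
  then show ?case by (simp add: if_distrib cong: if_cong)
next
  case (Cons k w)
  have "(\<Sum>i<m. cnj (y i) * word_eval m Z (k # w) $$ (i,j))
      = (\<Sum>i<m. cnj (y i) * (\<Sum>l<m. Z k $$ (i,l) * word_eval m Z w $$ (l,j)))"
    using Cons.prems Z[of k] word_eval_carrier[of w]
    by (intro sum.cong refl) (auto simp: scalar_prod_def atLeast0LessThan intro!: sum.cong)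
  also have "\<dots> = (\<Sum>l<m. \<Sum>i<m. cnj (y i) * (Z k $$ (i,l) * word_eval m Z w $$ (l,j)))"
    unfolding sum_distrib_left by (rule sum.swap)
  also have "\<dots> = (\<Sum>l<m. cnj (letter_adj k y l) * word_eval m Z w $$ (l,j))"
    unfolding letter_adj_def cnj_sum sum_distrib_right by (intro sum.cong refl) simp
  finally show ?case using Cons by simp
qed

text \<open>
  The adjoint of the row of the \<open>Z\<^sub>k\<close> is a column of the same norm: use the row bound for
  \<open>x\<^sub>k = Z\<^sub>k\<^sup>* y\<close>.
\<close>

lemma nrm_letter_adj_le:
  assumes F: "finite F"
  shows "(\<Sum>k\<in>F. nrm (letter_adj k y)) \<le> r\<^sup>2 * nrm y"
proof -
  define s where "s = (\<Sum>k\<in>F. nrm (letter_adj k y))"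
  have s0: "0 \<le> s" by (simp add: s_def sum_nonneg nrm_nonneg)
  define x where "x k = vec m (letter_adj k y)" for k
  define z where "z = vec m (\<lambda>i. \<Sum>k\<in>F. (Z k *\<^sub>v x k) $ i)"
  have zi: "z $ i = (\<Sum>k\<in>F. \<Sum>j<m. Z k $$ (i,j) * letter_adj k y j)" if "i < m" for i
    using that Z unfolding z_def x_def
    by (auto simp: scalar_prod_def atLeast0LessThan carrier_matD[OF Z] intro!: sum.cong)
  have "ip y (\<lambda>i. z $ i) = (\<Sum>i<m. \<Sum>k\<in>F. \<Sum>j<m. cnj (y i) * (Z k $$ (i,j) * letter_adj k y j))"
    by (simp add: ip_def zi sum_distrib_left)
  also have "\<dots> = (\<Sum>k\<in>F. \<Sum>i<m. \<Sum>j<m. cnj (y i) * (Z k $$ (i,j) * letter_adj k y j))"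
    by (rule sum.swap)
  also have "\<dots> = (\<Sum>k\<in>F. ip (letter_adj k y) (letter_adj k y))"
  proof (rule sum.cong[OF refl])
    fix k
    have "(\<Sum>i<m. \<Sum>j<m. cnj (y i) * (Z k $$ (i,j) * letter_adj k y j))
        = (\<Sum>j<m. \<Sum>i<m. cnj (y i) * (Z k $$ (i,j) * letter_adj k y j))" by (rule sum.swap)
    also have "\<dots> = (\<Sum>j<m. (\<Sum>i<m. cnj (y i) * Z k $$ (i,j)) * letter_adj k y j)"
      by (simp add: sum_distrib_right mult.assoc)
    also have "\<dots> = ip (letter_adj k y) (letter_adj k y)"
      unfolding ip_def by (intro sum.cong refl) (simp add: letter_adj_def ac_simps)
    finally show "(\<Sum>i<m. \<Sum>j<m. cnj (y i) * (Z k $$ (i,j) * letter_adj k y j))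
        = ip (letter_adj k y) (letter_adj k y)" .
  qed
  also have "\<dots> = of_real s" by (simp add: s_def ip_self)
  finally have "s\<^sup>2 = (cmod (ip y (\<lambda>i. z $ i)))\<^sup>2" by simp
  also have "\<dots> \<le> nrm y * nrm (\<lambda>i. z $ i)"
    unfolding ip_def nrm_def by (rule cmod_sum_cnj_mult_squared_le)
  also have "nrm (\<lambda>i. z $ i) = (vec_norm2 z)\<^sup>2"
    by (simp add: nrm_def vec_norm2_squared z_def)
  also have "nrm y * (vec_norm2 z)\<^sup>2 \<le> nrm y * (r * sqrt s)\<^sup>2"
  proof -
    have "vec_norm2 z \<le> r * sqrt (\<Sum>k\<in>F. (vec_norm2 (x k))\<^sup>2)"
      unfolding z_def by (rule row_bound[OF F]) (simp add: x_def)
    also have "(\<Sum>k\<in>F. (vec_norm2 (x k))\<^sup>2) = s"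
      by (simp add: x_def vec_norm2_squared s_def nrm_def)
    finally show ?thesis by (intro mult_left_mono power_mono vec_norm2_nonneg nrm_nonneg)
  qed
  also have "\<dots> = (r\<^sup>2 * nrm y) * s" using s0 by (simp add: power_mult_distrib)
  finally have "s * s \<le> (r\<^sup>2 * nrm y) * s" by (simp add: power2_eq_square)
  then have "s \<le> r\<^sup>2 * nrm y"
    using s0 by (cases "s = 0") (auto simp: nrm_nonneg)
  then show ?thesis by (simp add: s_def)
qed

lemma nrm_level_le:
  assumes F: "finite F"
  shows "(\<Sum>w\<in>level_words F j. nrm (word_adj w y)) \<le> r ^ (2 * j) * nrm y"
proof (induction j)
  case 0
  have "level_words F 0 = {[]}" by (auto simp: level_words_def)
  then show ?case by simp
next
  case (Suc j)
  have "(\<Sum>w\<in>level_words F (Suc j). nrm (word_adj w y))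
      = (\<Sum>w\<in>level_words F j. \<Sum>k\<in>F. nrm (letter_adj k (word_adj w y)))"
    by (simp add: sum_level_words_Suc[OF F] word_adj_append)
  also have "\<dots> \<le> (\<Sum>w\<in>level_words F j. r\<^sup>2 * nrm (word_adj w y))"
    by (intro sum_mono nrm_letter_adj_le F)
  also have "\<dots> \<le> r\<^sup>2 * (r ^ (2 * j) * nrm y)"
    unfolding sum_distrib_left[symmetric] by (intro mult_left_mono Suc) simp
  finally show ?case by (simp add: power2_eq_square)
qed

text \<open>
  The words of length \<open>j\<close> contribute at most \<open>r\<^sup>2\<^sup>j\<close>. This square summability makes the series
  that defines \<open>nc_eval\<close> converge absolutely.
\<close>

lemma l2_word_eval_entry:
  assumes i: "i < m" and j: "j < m"
  shows "l2 (\<lambda>w. word_eval m Z w $$ (i,j))"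
proof (rule l2I(1))
  fix T :: "'a list set" assume T: "finite T"
  define e where "e = (\<lambda>l. if l = i then 1 else (0::complex))"
  have nrm_e: "nrm e = 1"
  proof -
    have "nrm e = (\<Sum>l<m. if l = i then 1 else 0)" unfolding nrm_def e_def by (intro sum.cong) auto
    then show ?thesis using i by simp
  qed
  have entry: "(cmod (word_eval m Z w $$ (i,j)))\<^sup>2 \<le> nrm (word_adj w e)" for w
  proof -
    have "cnj (word_adj w e j) = (\<Sum>l<m. if l = i then word_eval m Z w $$ (l,j) else 0)"
      unfolding sum_word_eval[OF j, symmetric] e_def by (intro sum.cong) auto
    then have "cmod (word_eval m Z w $$ (i,j)) = cmod (word_adj w e j)"
      using i by (simp add: sum.delta flip: complex_mod_cnj[of "word_adj w e j"])
    then show ?thesis unfolding nrm_def using j member_le_sum[of j "{..<m}" "\<lambda>l. (cmod (word_adj w e l))\<^sup>2"] by simp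
  qed
  define F where "F = \<Union> (set ` T)"
  define N where "N = Max (insert 0 (length ` T))"
  have F: "finite F" using T by (simp add: F_def)
  have sub: "T \<subseteq> short_words F N" using T by (fastforce simp: short_words_def F_def N_def intro: Max_ge)
  have "(\<Sum>w\<in>T. (cmod (word_eval m Z w $$ (i,j)))\<^sup>2) \<le> (\<Sum>w\<in>short_words F N. nrm (word_adj w e))"
  proof (rule order_trans)
    show "(\<Sum>w\<in>T. (cmod (word_eval m Z w $$ (i,j)))\<^sup>2) \<le> (\<Sum>w\<in>T. nrm (word_adj w e))"
      by (intro sum_mono entry)
    show "(\<Sum>w\<in>T. nrm (word_adj w e)) \<le> (\<Sum>w\<in>short_words F N. nrm (word_adj w e))"
      by (intro sum_mono2 finite_short_words F sub nrm_nonneg)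
  qed
  also have "\<dots> \<le> (\<Sum>k\<le>N. r ^ (2 * k))"
    unfolding sum_short_words[OF F] using nrm_level_le[OF F, where y = e] by (intro sum_mono) (simp add: nrm_e)
  also have "\<dots> = (\<Sum>k<Suc N. (r\<^sup>2) ^ k)"
    by (simp only: power_mult lessThan_Suc_atMost)
  also have "\<dots> \<le> (\<Sum>k. (r\<^sup>2) ^ k)"
  proof (rule sum_le_suminf)
    have "r\<^sup>2 < 1" using r by (simp add: power_less_one_iff)
    then show "summable (\<lambda>k. (r\<^sup>2) ^ k)" by (intro summable_geometric) simp
  qed auto
  finally show "(\<Sum>w\<in>T. (cmod (word_eval m Z w $$ (i,j)))\<^sup>2) \<le> (\<Sum>k. (r\<^sup>2) ^ k)" .
qed

text \<open>
  The form of \<open>D = 1 - \<Sum>k\<in>F. Z\<^sub>k Z\<^sub>k\<^sup>*\<close>, the square of the defect operator.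
\<close>

definition defect :: "'a set \<Rightarrow> (nat \<Rightarrow> complex) \<Rightarrow> (nat \<Rightarrow> complex) \<Rightarrow> complex" where
  "defect F x y = ip x y - (\<Sum>k\<in>F. ip (letter_adj k x) (letter_adj k y))"

text \<open>
  A telescoping sum. As \<open>N\<close> grows the last term vanishes and the identity becomes
  \<open>(\<Sum>w. Z\<^sup>w D Z\<^sup>w\<^sup>*) = 1\<close>, which says that the Poisson kernel is isometric.
\<close>

lemma sum_defect_short_words:
  assumes F: "finite F"
  shows "(\<Sum>w\<in>short_words F N. defect F (word_adj w x) (word_adj w y))
    = ip x y - (\<Sum>w\<in>level_words F (Suc N). ip (word_adj w x) (word_adj w y))"
proof -
  let ?L = "\<lambda>j. \<Sum>w\<in>level_words F j. ip (word_adj w x) (word_adj w y)"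
  have "(\<Sum>w\<in>level_words F j. defect F (word_adj w x) (word_adj w y)) = ?L j - ?L (Suc j)" for j
    by (simp add: defect_def sum_subtractf sum_level_words_Suc[OF F] word_adj_append)
  then have "(\<Sum>w\<in>short_words F N. defect F (word_adj w x) (word_adj w y)) = ?L 0 - ?L (Suc N)"
    using sum_telescope[of ?L N] by (simp add: sum_short_words[OF F])
  moreover have "level_words F 0 = {[]}" by (auto simp: level_words_def)
  ultimately show ?thesis by simp
qed

text \<open>
  Since \<open>r < 1\<close>, the form is positive definite and has a Cholesky factor, which takes the place of the
  square root of \<open>D\<close>.
\<close>

lemma defect_factorisation:
  assumes F: "finite F"
  shows "\<exists>b. \<forall>x y. defect F x y = (\<Sum>l<m. cnj (\<Sum>i<m. b l i * x i) * (\<Sum>i<m. b l i * y i))"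
proof -
  define D where "D i j = (if i = j then 1 else 0) - (\<Sum>k\<in>F. \<Sum>l<m. Z k $$ (i,l) * cnj (Z k $$ (j,l)))"
    for i j
  have form: "defect F x y = (\<Sum>i<m. \<Sum>j<m. cnj (x i) * D i j * y j)" for x y
  proof -
    have 1: "ip x y = (\<Sum>i<m. \<Sum>j<m. cnj (x i) * (if i = j then 1 else 0) * y j)"
    proof -
      have "(\<Sum>j<m. cnj (x i) * (if i = j then 1 else 0) * y j) = cnj (x i) * y i" if "i < m" for i
      proof -
        have "(\<Sum>j<m. cnj (x i) * (if i = j then 1 else 0) * y j) = (\<Sum>j<m. if i = j then cnj (x i) * y j else 0)"
          by (intro sum.cong) auto
        then show ?thesis using that by simp
      qed
      then show ?thesis by (simp add: ip_def)
    qed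
    have 2: "ip (letter_adj k x) (letter_adj k y)
        = (\<Sum>i<m. \<Sum>j<m. cnj (x i) * (\<Sum>l<m. Z k $$ (i,l) * cnj (Z k $$ (j,l))) * y j)" for k
    proof -
      have "ip (letter_adj k x) (letter_adj k y)
          = (\<Sum>l<m. \<Sum>i<m. \<Sum>j<m. cnj (x i) * (Z k $$ (i,l) * cnj (Z k $$ (j,l))) * y j)"
        unfolding ip_def letter_adj_def cnj_sum sum_product by (intro sum.cong) auto
      also have "\<dots> = (\<Sum>i<m. \<Sum>j<m. \<Sum>l<m. cnj (x i) * (Z k $$ (i,l) * cnj (Z k $$ (j,l))) * y j)"
        by (subst sum.swap) (intro sum.cong refl sum.swap)
      finally show ?thesis by (simp only: sum_distrib_left sum_distrib_right)
    qed
    have "(\<Sum>k\<in>F. ip (letter_adj k x) (letter_adj k y))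
        = (\<Sum>i<m. \<Sum>j<m. \<Sum>k\<in>F. cnj (x i) * (\<Sum>l<m. Z k $$ (i,l) * cnj (Z k $$ (j,l))) * y j)"
      unfolding 2 by (subst sum.swap) (intro sum.cong refl sum.swap)
    then show ?thesis
      unfolding defect_def 1 D_def
      by (simp only: sum_subtractf[symmetric] sum_distrib_left[symmetric] sum_distrib_right[symmetric]
          left_diff_distrib right_diff_distrib)
  qed
  have "\<exists>b. \<forall>i<m. \<forall>j<m. D i j = (\<Sum>l<m. cnj (b l i) * b l j)"
  proof (rule cholesky)
    show "D j i = cnj (D i j)" for i j by (simp add: D_def mult.commute)
    fix x :: "nat \<Rightarrow> complex" assume "\<exists>i<m. x i \<noteq> 0"
    then obtain i where i: "i < m" "x i \<noteq> 0" by blast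
    have "0 < (cmod (x i))\<^sup>2" using i by simp
    also have "\<dots> \<le> nrm x" unfolding nrm_def using i by (intro member_le_sum) auto
    finally have pos: "0 < nrm x" .
    have "r\<^sup>2 < 1" using r by (simp add: power_less_one_iff)
    have "(\<Sum>k\<in>F. nrm (letter_adj k x)) \<le> r\<^sup>2 * nrm x" by (rule nrm_letter_adj_le[OF F])
    also have "\<dots> < 1 * nrm x" using \<open>r\<^sup>2 < 1\<close> pos by (rule mult_strict_right_mono)
    finally have "0 < Re (defect F x x)" by (simp add: defect_def ip_self)
    then show "0 < Re (\<Sum>i<m. \<Sum>j<m. cnj (x i) * D i j * x j)" by (simp only: form)
  qed
  then obtain b where b: "\<And>i j. i < m \<Longrightarrow> j < m \<Longrightarrow> D i j = (\<Sum>l<m. cnj (b l i) * b l j)" by blast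
  have "defect F x y = (\<Sum>l<m. cnj (\<Sum>i<m. b l i * x i) * (\<Sum>i<m. b l i * y i))" for x y
  proof -
    have "defect F x y = (\<Sum>i<m. \<Sum>j<m. \<Sum>l<m. (cnj (x i) * cnj (b l i)) * (b l j * y j))"
      unfolding form by (intro sum.cong refl) (simp add: b sum_distrib_left sum_distrib_right mult.assoc)
    also have "\<dots> = (\<Sum>l<m. \<Sum>i<m. \<Sum>j<m. (cnj (x i) * cnj (b l i)) * (b l j * y j))"
      by (subst (2) sum.swap) (intro sum.cong refl sum.swap)
    also have "\<dots> = (\<Sum>l<m. cnj (\<Sum>i<m. b l i * x i) * (\<Sum>i<m. b l i * y i))"
      unfolding cnj_sum sum_product by (intro sum.cong) auto
    finally show ?thesis .
  qed
  then show ?thesis by blast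
qed

text \<open>
  With \<open>\<beta>\<close> the factor of the defect, send a vector \<open>x\<close> to the finitely supported family
  \<open>\<beta>\<^sub>l (Z\<^sup>w\<^sup>* x)\<close> indexed by \<open>l\<close> and short words \<open>w\<close>. By telescoping this map is contractive. The sum below
  pairs the family of \<open>u\<close> with \<open>f\<close> times the family of \<open>v\<close>, so it is controlled by the multiplier bound
  and the Cauchy-Schwarz inequality.
\<close>

lemma truncated_poisson_bound:
  assumes f: "l2_multiplier c f" and F: "finite F"
  shows "(cmod (\<Sum>b\<in>short_words F N. \<Sum>k\<le>length b.
      nc_coeff f (take k b) * defect F (word_adj b u) (word_adj (drop k b) v)))\<^sup>2 \<le> c * nrm u * nrm v"
proof -
  let ?W = "short_words F N"
  have W: "finite ?W" by (rule finite_short_words[OF F])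
  obtain b where b: "\<And>x y. defect F x y = (\<Sum>l<m. cnj (\<Sum>i<m. b l i * x i) * (\<Sum>i<m. b l i * y i))"
    using defect_factorisation[OF F] by blast
  define \<beta> where "\<beta> l x = (\<Sum>i<m. b l i * x i)" for l x
  have factor: "defect F x y = (\<Sum>l<m. cnj (\<beta> l x) * \<beta> l y)" for x y
    by (simp add: b \<beta>_def)
  have total: "(\<Sum>l<m. \<Sum>w\<in>?W. (cmod (\<beta> l (word_adj w x)))\<^sup>2) \<le> nrm x" for x
  proof -
    have "of_real (\<Sum>l<m. \<Sum>w\<in>?W. (cmod (\<beta> l (word_adj w x)))\<^sup>2)
        = (\<Sum>w\<in>?W. defect F (word_adj w x) (word_adj w x))"
      unfolding factor of_real_sum complex_norm_square
      by (subst sum.swap) (intro sum.cong refl mult.commute)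
    also have "\<dots> = of_real (nrm x - (\<Sum>w\<in>level_words F (Suc N). nrm (word_adj w x)))"
      by (simp add: sum_defect_short_words[OF F] ip_self)
    finally have "(\<Sum>l<m. \<Sum>w\<in>?W. (cmod (\<beta> l (word_adj w x)))\<^sup>2)
        = nrm x - (\<Sum>w\<in>level_words F (Suc N). nrm (word_adj w x))"
      by (simp only: of_real_eq_iff)
    then show ?thesis by (simp add: sum_nonneg nrm_nonneg)
  qed
  define G where "G l = Nc_series (\<lambda>w. if w \<in> ?W then \<beta> l (word_adj w v) else 0)" for l
  have G: "l2 (nc_coeff (G l))" "sqnorm (nc_coeff (G l)) = (\<Sum>w\<in>?W. (cmod (\<beta> l (word_adj w v)))\<^sup>2)" for l
    using l2_finite_support[OF W, of "nc_coeff (G l)"] by (auto simp: G_def)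
  have "(\<Sum>w\<in>?W. \<Sum>k\<le>length w. nc_coeff f (take k w) * defect F (word_adj w u) (word_adj (drop k w) v))
      = (\<Sum>w\<in>?W. \<Sum>l<m. cnj (\<beta> l (word_adj w u)) * nc_coeff (f * G l) w)"
  proof (rule sum.cong[OF refl])
    fix w assume w: "w \<in> ?W"
    have "(\<Sum>k\<le>length w. nc_coeff f (take k w) * defect F (word_adj w u) (word_adj (drop k w) v))
        = (\<Sum>k\<le>length w. \<Sum>l<m. cnj (\<beta> l (word_adj w u)) * (nc_coeff f (take k w) * nc_coeff (G l) (drop k w)))"
    proof (rule sum.cong[OF refl])
      fix k
      have "drop k w \<in> ?W" using w by (auto simp: short_words_def dest: in_set_dropD)
      then show "nc_coeff f (take k w) * defect F (word_adj w u) (word_adj (drop k w) v)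
          = (\<Sum>l<m. cnj (\<beta> l (word_adj w u)) * (nc_coeff f (take k w) * nc_coeff (G l) (drop k w)))"
        unfolding factor sum_distrib_left by (intro sum.cong refl) (simp add: G_def)
    qed
    also have "\<dots> = (\<Sum>l<m. cnj (\<beta> l (word_adj w u)) * nc_coeff (f * G l) w)"
      unfolding times_nc_series.rep_eq sum_distrib_left by (rule sum.swap)
    finally show "(\<Sum>k\<le>length w. nc_coeff f (take k w) * defect F (word_adj w u) (word_adj (drop k w) v))
        = (\<Sum>l<m. cnj (\<beta> l (word_adj w u)) * nc_coeff (f * G l) w)" .
  qed
  also have "\<dots> = (\<Sum>l<m. \<Sum>w\<in>?W. cnj (\<beta> l (word_adj w u)) * nc_coeff (f * G l) w)"
    by (rule sum.swap)
  also have "\<dots> = (\<Sum>p\<in>{..<m} \<times> ?W. cnj (\<beta> (fst p) (word_adj (snd p) u)) * nc_coeff (f * G (fst p)) (snd p))"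
    by (simp add: sum.cartesian_product')
  also have "(cmod \<dots>)\<^sup>2 \<le> (\<Sum>p\<in>{..<m} \<times> ?W. (cmod (\<beta> (fst p) (word_adj (snd p) u)))\<^sup>2)
      * (\<Sum>p\<in>{..<m} \<times> ?W. (cmod (nc_coeff (f * G (fst p)) (snd p)))\<^sup>2)"
    by (rule cmod_sum_cnj_mult_squared_le)
  also have "\<dots> = (\<Sum>l<m. \<Sum>w\<in>?W. (cmod (\<beta> l (word_adj w u)))\<^sup>2)
      * (\<Sum>l<m. \<Sum>w\<in>?W. (cmod (nc_coeff (f * G l) w))\<^sup>2)"
    by (simp add: sum.cartesian_product')
  also have "\<dots> \<le> nrm u * (c * nrm v)"
  proof (intro mult_mono total)
    have "(\<Sum>l<m. \<Sum>w\<in>?W. (cmod (nc_coeff (f * G l) w))\<^sup>2) \<le> (\<Sum>l<m. c * sqnorm (nc_coeff (G l)))"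
    proof (rule sum_mono)
      fix l
      have "l2 (nc_coeff (f * G l))" "sqnorm (nc_coeff (f * G l)) \<le> c * sqnorm (nc_coeff (G l))"
        using f G(1)[of l] by (auto simp: l2_multiplier_def)
      then show "(\<Sum>w\<in>?W. (cmod (nc_coeff (f * G l) w))\<^sup>2) \<le> c * sqnorm (nc_coeff (G l))"
        using sum_le_sqnorm[OF _ W] order_trans by blast
    qed
    also have "\<dots> \<le> c * nrm v"
      unfolding sum_distrib_left[symmetric] G(2)
      by (intro mult_left_mono total l2_multiplier_const_nonneg[OF f])
    finally show "(\<Sum>l<m. \<Sum>w\<in>?W. (cmod (nc_coeff (f * G l) w))\<^sup>2) \<le> c * nrm v" .
  qed (auto simp: sum_nonneg nrm_nonneg)
  finally show ?thesis by (simp add: ac_simps)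
qed

text \<open>
  The part that telescoping does not remove. In it the lengths of \<open>a\<close> and \<open>w\<close> add up to \<open>N + 1\<close>, and
  the level bounds give at least the factor \<open>r\<^sup>2\<close> per letter after squaring; the factor \<open>N + 1\<close> counts the
  possible lengths of \<open>a\<close>.
\<close>

lemma truncation_error_bound:
  assumes f: "l2 (nc_coeff f)" and F: "finite F"
  shows "(cmod (\<Sum>a\<in>short_words F N. nc_coeff f a *
      (\<Sum>w\<in>level_words F (Suc (N - length a)). ip (word_adj w (word_adj a u)) (word_adj w v))))\<^sup>2
    \<le> sqnorm (nc_coeff f) * (real (Suc N) * (r\<^sup>2) ^ Suc N * nrm u * nrm v)"
proof -
  let ?W = "short_words F N"
  have W: "finite ?W" by (rule finite_short_words[OF F])
  define e where "e a = (\<Sum>w\<in>level_words F (Suc (N - length a)). ip (word_adj w (word_adj a u)) (word_adj w v))"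
    for a
  have r2: "0 \<le> r\<^sup>2" "r\<^sup>2 \<le> 1" using r by (auto simp: power_le_one)
  have e_le: "(cmod (e a))\<^sup>2 \<le> (r\<^sup>2) ^ (Suc (N - length a)) * nrm (word_adj a u) * nrm v" for a
  proof -
    let ?j = "Suc (N - length a)"
    let ?P = "level_words F ?j \<times> {..<m}"
    have "e a = (\<Sum>p\<in>?P. cnj (word_adj (fst p) (word_adj a u) (snd p)) * word_adj (fst p) v (snd p))"
      by (simp add: e_def ip_def sum.cartesian_product')
    then have "(cmod (e a))\<^sup>2 \<le> (\<Sum>p\<in>?P. (cmod (word_adj (fst p) (word_adj a u) (snd p)))\<^sup>2)
        * (\<Sum>p\<in>?P. (cmod (word_adj (fst p) v (snd p)))\<^sup>2)"
      by (simp only: cmod_sum_cnj_mult_squared_le)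
    also have "\<dots> = (\<Sum>w\<in>level_words F ?j. nrm (word_adj w (word_adj a u))) * (\<Sum>w\<in>level_words F ?j. nrm (word_adj w v))"
      by (simp add: nrm_def sum.cartesian_product')
    also have "\<dots> \<le> (r ^ (2 * ?j) * nrm (word_adj a u)) * (r ^ (2 * ?j) * nrm v)"
      by (intro mult_mono nrm_level_le F mult_nonneg_nonneg sum_nonneg nrm_nonneg) (use r in auto)
    also have "\<dots> \<le> (r ^ (2 * ?j) * nrm (word_adj a u)) * (1 * nrm v)"
      by (intro mult_left_mono mult_right_mono mult_nonneg_nonneg nrm_nonneg power_le_one) (use r in auto)
    finally show ?thesis by (simp only: power_mult mult_1)
  qed
  have "(cmod (\<Sum>a\<in>?W. nc_coeff f a * e a))\<^sup>2 \<le> (\<Sum>a\<in>?W. (cmod (nc_coeff f a))\<^sup>2) * (\<Sum>a\<in>?W. (cmod (e a))\<^sup>2)"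
    using cmod_sum_cnj_mult_squared_le[of "\<lambda>a. cnj (nc_coeff f a)" e ?W] by simp
  also have "\<dots> \<le> sqnorm (nc_coeff f) * (real (Suc N) * (r\<^sup>2) ^ Suc N * nrm u * nrm v)"
  proof (intro mult_mono sum_le_sqnorm f W)
    have "(\<Sum>a\<in>?W. (cmod (e a))\<^sup>2) \<le> (\<Sum>a\<in>?W. (r\<^sup>2) ^ (Suc (N - length a)) * nrm (word_adj a u) * nrm v)"
      by (intro sum_mono e_le)
    also have "\<dots> = (\<Sum>j\<le>N. (r\<^sup>2) ^ (Suc (N - j)) * (\<Sum>a\<in>level_words F j. nrm (word_adj a u))) * nrm v"
      unfolding sum_short_words[OF F] sum_distrib_left sum_distrib_right
      by (intro sum.cong) (auto simp: level_words_def)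
    also have "\<dots> \<le> (\<Sum>j\<le>N. (r\<^sup>2) ^ Suc N * nrm u) * nrm v"
    proof (intro mult_right_mono sum_mono nrm_nonneg)
      fix j assume j: "j \<in> {..N}"
      have "(r\<^sup>2) ^ (Suc (N - j)) * (\<Sum>a\<in>level_words F j. nrm (word_adj a u))
          \<le> (r\<^sup>2) ^ (Suc (N - j)) * ((r\<^sup>2) ^ j * nrm u)"
        using nrm_level_le[OF F, where j = j and y = u] r2 by (intro mult_left_mono) (auto simp: power_mult)
      also have "\<dots> = (r\<^sup>2) ^ Suc N * nrm u"
        using j by (simp add: mult.assoc[symmetric] power_add[symmetric] Suc_diff_le del: power_Suc)
      finally show "(r\<^sup>2) ^ (Suc (N - j)) * (\<Sum>a\<in>level_words F j. nrm (word_adj a u)) \<le> (r\<^sup>2) ^ Suc N * nrm u" .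
    qed
    finally show "(\<Sum>a\<in>?W. (cmod (e a))\<^sup>2) \<le> real (Suc N) * (r\<^sup>2) ^ Suc N * nrm u * nrm v"
      by (simp add: mult.assoc)
  qed (auto simp: sqnorm_nonneg sum_nonneg)
  finally show ?thesis by (simp only: e_def)
qed

lemma partial_sum_bound:
  assumes f: "l2_multiplier c f" and f2: "l2 (nc_coeff f)" and F: "finite F"
  shows "cmod (\<Sum>a\<in>short_words F N. nc_coeff f a * ip (word_adj a u) v)
    \<le> sqrt (c * nrm u * nrm v) + sqrt (sqnorm (nc_coeff f) * (real (Suc N) * (r\<^sup>2) ^ Suc N * nrm u * nrm v))"
proof -
  let ?W = "short_words F N"
  let ?e = "\<lambda>a. \<Sum>w\<in>level_words F (Suc (N - length a)). ip (word_adj w (word_adj a u)) (word_adj w v)"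
  let ?P = "\<Sum>b\<in>?W. \<Sum>k\<le>length b. nc_coeff f (take k b) * defect F (word_adj b u) (word_adj (drop k b) v)"
  have "?P = (\<Sum>b\<in>?W. \<Sum>k\<le>length b. nc_coeff f (take k b)
      * defect F (word_adj (drop k b) (word_adj (take k b) u)) (word_adj (drop k b) v))"
    by (simp flip: word_adj_append)
  also have "\<dots> = (\<Sum>a\<in>?W. \<Sum>w\<in>short_words F (N - length a). nc_coeff f a
      * defect F (word_adj w (word_adj a u)) (word_adj w v))"
    by (rule sum_splittings_short_words[OF F, where h = "\<lambda>a w. nc_coeff f a
          * defect F (word_adj w (word_adj a u)) (word_adj w v)"])
  also have "\<dots> = (\<Sum>a\<in>?W. nc_coeff f a * ip (word_adj a u) v) - (\<Sum>a\<in>?W. nc_coeff f a * ?e a)"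
    by (simp add: sum_distrib_left[symmetric] sum_defect_short_words[OF F] right_diff_distrib sum_subtractf)
  finally have eq: "(\<Sum>a\<in>?W. nc_coeff f a * ip (word_adj a u) v) = ?P + (\<Sum>a\<in>?W. nc_coeff f a * ?e a)"
    by simp
  have "cmod ?P \<le> sqrt (c * nrm u * nrm v)"
    by (rule real_le_rsqrt[OF truncated_poisson_bound[OF f F]])
  moreover have "cmod (\<Sum>a\<in>?W. nc_coeff f a * ?e a)
      \<le> sqrt (sqnorm (nc_coeff f) * (real (Suc N) * (r\<^sup>2) ^ Suc N * nrm u * nrm v))"
    by (rule real_le_rsqrt[OF truncation_error_bound[OF f2 F]])
  ultimately show ?thesis unfolding eq by (intro order_trans[OF norm_triangle_ineq] add_mono)
qed

lemma truncation_error_tendsto_0: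
  "(\<lambda>N. sqrt (c * (real (Suc N) * (r\<^sup>2) ^ Suc N * a * b))) \<longlonglongrightarrow> 0"
proof -
  have "r\<^sup>2 < 1" using r by (simp add: power_less_one_iff)
  then have "(\<lambda>N. real N * (r\<^sup>2) ^ N) \<longlonglongrightarrow> 0"
    by (intro powser_times_n_limit_0) simp
  then have "(\<lambda>N. real (Suc N) * (r\<^sup>2) ^ Suc N) \<longlonglongrightarrow> 0" by (rule LIMSEQ_Suc)
  then have "(\<lambda>N. sqrt (c * ((real (Suc N) * (r\<^sup>2) ^ Suc N) * a * b))) \<longlonglongrightarrow> sqrt (c * (0 * a * b))"
    by (intro tendsto_intros)
  then show ?thesis by simp
qed

lemma nc_eval_has_sum:
  assumes f: "l2 (nc_coeff f)" and v: "v \<in> carrier_vec m"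
  shows "((\<lambda>w. nc_coeff f w * ip (word_adj w u) (\<lambda>j. v $ j)) has_sum ip u (\<lambda>i. (nc_eval m f Z *\<^sub>v v) $ i)) UNIV"
proof -
  let ?z = "\<lambda>i j w. nc_coeff f w * word_eval m Z w $$ (i,j)"
  have "?z i j summable_on UNIV" if "i < m" "j < m" for i j
    using l2_inner_summable[of "\<lambda>w. cnj (nc_coeff f w)" "\<lambda>w. word_eval m Z w $$ (i,j)"] f
      l2_word_eval_entry[OF that] by (simp add: l2_def)
  then have "(?z i j has_sum (nc_eval m f Z $$ (i,j))) UNIV" if "i < m" "j < m" for i j
    using that by (simp add: nc_eval_def)
  then have hs: "((\<lambda>w. \<Sum>i<m. \<Sum>j<m. cnj (u i) * v $ j * ?z i j w) has_sum
      (\<Sum>i<m. \<Sum>j<m. cnj (u i) * v $ j * (nc_eval m f Z $$ (i,j)))) UNIV"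
    by (intro has_sum_finite_sum has_sum_cmult_right) auto
  have "(\<Sum>i<m. \<Sum>j<m. cnj (u i) * v $ j * ?z i j w) = nc_coeff f w * ip (word_adj w u) (\<lambda>j. v $ j)" for w
  proof -
    have "(\<Sum>i<m. \<Sum>j<m. cnj (u i) * v $ j * ?z i j w)
        = (\<Sum>j<m. \<Sum>i<m. nc_coeff f w * (cnj (u i) * word_eval m Z w $$ (i,j) * v $ j))"
      by (subst sum.swap) (simp add: ac_simps)
    also have "\<dots> = (\<Sum>j<m. nc_coeff f w * ((\<Sum>i<m. cnj (u i) * word_eval m Z w $$ (i,j)) * v $ j))"
      by (simp add: sum_distrib_left sum_distrib_right)
    finally show ?thesis by (simp add: sum_word_eval ip_def sum_distrib_left)
  qed
  moreover have "(\<Sum>i<m. \<Sum>j<m. cnj (u i) * v $ j * (nc_eval m f Z $$ (i,j)))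
      = ip u (\<lambda>i. (nc_eval m f Z *\<^sub>v v) $ i)"
    unfolding ip_def
    by (intro sum.cong refl) (use v in \<open>auto simp: nc_eval_def scalar_prod_def atLeast0LessThan sum_distrib_left intro!: sum.cong\<close>)
  ultimately show ?thesis using hs by simp
qed

text \<open>
  It suffices to bound the pairing of \<open>f(Z) v\<close> with \<open>u = f(Z) v\<close>. Partial sums over all short words
  in a finite alphabet approximate it, because they exhaust the finite sets of words.
\<close>

lemma von_neumann_inequality:
  assumes f: "l2_multiplier c f" and f2: "l2 (nc_coeff f)" and v: "v \<in> carrier_vec m"
  shows "vec_norm2 (nc_eval m f Z *\<^sub>v v) \<le> sqrt c * vec_norm2 v"
proof -
  let ?v = "\<lambda>j. v $ j"
  define u where "u = (\<lambda>i. (nc_eval m f Z *\<^sub>v v) $ i)"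
  have nrm_u: "nrm u = (vec_norm2 (nc_eval m f Z *\<^sub>v v))\<^sup>2"
    by (simp add: u_def nrm_def vec_norm2_squared nc_eval_def)
  have nrm_v: "nrm ?v = (vec_norm2 v)\<^sup>2" using v by (simp add: nrm_def vec_norm2_squared)
  have "cmod (ip u u) \<le> sqrt (c * nrm u * nrm ?v) + \<epsilon>" if \<epsilon>: "0 < \<epsilon>" for \<epsilon>
  proof -
    let ?t = "\<lambda>w. nc_coeff f w * ip (word_adj w u) ?v"
    have "(?t has_sum ip u u) UNIV" unfolding u_def by (rule nc_eval_has_sum[OF f2 v])
    then have "\<forall>\<^sub>F T in finite_subsets_at_top UNIV. dist (sum ?t T) (ip u u) < \<epsilon>"
      using \<epsilon> by (simp add: has_sum_def tendsto_iff)
    then obtain T0 where T0: "finite T0"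
      "\<And>T. finite T \<Longrightarrow> T0 \<subseteq> T \<Longrightarrow> dist (sum ?t T) (ip u u) < \<epsilon>"
      unfolding eventually_finite_subsets_at_top by (metis subset_UNIV)
    define F where "F = \<Union> (set ` T0)"
    define N0 where "N0 = Max (insert 0 (length ` T0))"
    have F: "finite F" using T0(1) by (simp add: F_def)
    have "cmod (ip u u) \<le> \<epsilon> + (sqrt (c * nrm u * nrm ?v)
        + sqrt (sqnorm (nc_coeff f) * (real (Suc N) * (r\<^sup>2) ^ Suc N * nrm u * nrm ?v)))" if N: "N \<ge> N0" for N
    proof -
      have "length w \<le> N0" if "w \<in> T0" for w using T0(1) that by (simp add: N0_def)
      then have "T0 \<subseteq> short_words F N" using N by (force simp: short_words_def F_def)
      then have "dist (sum ?t (short_words F N)) (ip u u) < \<epsilon>"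
        by (intro T0(2) finite_short_words F)
      moreover have "cmod (ip u u) \<le> dist (sum ?t (short_words F N)) (ip u u) + cmod (sum ?t (short_words F N))"
        using norm_triangle_sub[of "ip u u" "sum ?t (short_words F N)"] by (simp add: dist_norm norm_minus_commute)
      ultimately show ?thesis using partial_sum_bound[OF f f2 F, where N = N and u = u and v = ?v] by linarith
    qed
    moreover have "(\<lambda>N. \<epsilon> + (sqrt (c * nrm u * nrm ?v)
        + sqrt (sqnorm (nc_coeff f) * (real (Suc N) * (r\<^sup>2) ^ Suc N * nrm u * nrm ?v))))
        \<longlonglongrightarrow> \<epsilon> + (sqrt (c * nrm u * nrm ?v) + 0)"
      by (intro tendsto_add tendsto_const truncation_error_tendsto_0)
    ultimately have "cmod (ip u u) \<le> \<epsilon> + (sqrt (c * nrm u * nrm ?v) + 0)"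
      by (intro LIMSEQ_le_const) auto
    then show ?thesis by simp
  qed
  then have "cmod (ip u u) \<le> sqrt (c * nrm u * nrm ?v)" by (rule field_le_epsilon)
  then have "nrm u \<le> sqrt (nrm u) * sqrt (c * nrm ?v)"
    by (simp add: ip_self nrm_nonneg real_sqrt_mult mult.left_commute)
  moreover have "nrm u = sqrt (nrm u) * sqrt (nrm u)" by (simp add: nrm_nonneg)
  ultimately have "sqrt (nrm u) * sqrt (nrm u) \<le> sqrt (nrm u) * sqrt (c * nrm ?v)" by simp
  then have "sqrt (nrm u) \<le> sqrt (c * nrm ?v)"
  proof (cases "nrm u = 0")
    case False
    then have "0 < sqrt (nrm u)" using nrm_nonneg[of u] by simp
    then show ?thesis using \<open>sqrt (nrm u) * sqrt (nrm u) \<le> sqrt (nrm u) * sqrt (c * nrm ?v)\<close>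
      by (rule mult_left_le_imp_le[rotated])
  qed (simp add: nrm_nonneg l2_multiplier_const_nonneg[OF f])
  then show ?thesis by (simp add: nrm_u nrm_v real_sqrt_mult vec_norm2_nonneg)
qed

end

lemma l2_multiplier_imp_Hinf:
  fixes f :: "'a nc_series"
  assumes f: "l2_multiplier c f"
  shows "f \<in> Hinf"
proof -
  have "l2 (nc_coeff (1 :: 'a nc_series))"
    by (rule l2_finite_support[of "{[]}"]) (auto simp: one_nc_series.rep_eq)
  then have "l2 (nc_coeff (f * 1))" using f unfolding l2_multiplier_def by blast
  then have f2: "l2 (nc_coeff f)" by simp
  have "vec_norm2 (nc_eval m f Z *\<^sub>v v) \<le> sqrt c * vec_norm2 v"
    if Z: "Z \<in> row_ball m" and v: "v \<in> carrier_vec m" for m Z v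
  proof -
    have carrier: "\<And>k. Z k \<in> carrier_mat m m" using Z by (simp add: row_ball_def)
    have "\<exists>r. 0 \<le> r \<and> r < 1 \<and> (\<forall>F x. finite F \<longrightarrow> (\<forall>k\<in>F. x k \<in> carrier_vec m) \<longrightarrow>
          vec_norm2 (vec m (\<lambda>i. \<Sum>k\<in>F. (Z k *\<^sub>v x k) $ i)) \<le> r * sqrt (\<Sum>k\<in>F. (vec_norm2 (x k))\<^sup>2))"
      using Z unfolding row_ball_def mem_Collect_eq by (rule conjunct2)
    then obtain r where r: "0 \<le> r" "r < 1"
      and bound: "\<forall>F x. finite F \<longrightarrow> (\<forall>k\<in>F. x k \<in> carrier_vec m) \<longrightarrow>
          vec_norm2 (vec m (\<lambda>i. \<Sum>k\<in>F. (Z k *\<^sub>v x k) $ i)) \<le> r * sqrt (\<Sum>k\<in>F. (vec_norm2 (x k))\<^sup>2)"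
      by (elim exE conjE)
    interpret row_contraction m Z r
      by (rule row_contraction.intro) (use carrier r bound in \<open>simp_all\<close>)
    show ?thesis by (rule von_neumann_inequality[OF f f2 v])
  qed
  then show ?thesis using f2 unfolding Hinf_def H2_def l2_def by blast
qed

lemma Hinf_iff_l2_multiplier: "f \<in> Hinf \<longleftrightarrow> (\<exists>c. l2_multiplier c f)"
  using Hinf_imp_l2_multiplier l2_multiplier_imp_Hinf by blast

section \<open>Columns of series\<close>

text \<open>
  All coefficients of a column as one family, zero in the rows that the column does not have, so that
  the results on square-summable families apply to columns.
\<close>

definition cof :: "'a nc_series vec \<Rightarrow> nat \<times> 'a list \<Rightarrow> complex" where
  "cof h = (\<lambda>(i,w). if i < dim_vec h then nc_coeff (h $ i) w else 0)"

lemma nc_coeff_simps [simp]: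
  "nc_coeff (f + g) w = nc_coeff f w + nc_coeff g w"
  "nc_coeff (f - g) w = nc_coeff f w - nc_coeff g w"
  "nc_coeff 0 w = 0"
  by (transfer; simp)+

lemma cof_has_sum:
  assumes h: "h \<in> carrier_vec n" and l2: "\<And>i. i < n \<Longrightarrow> l2 (nc_coeff (h $ i))"
  shows "((\<lambda>p. (cmod (cof h p))\<^sup>2) has_sum (\<Sum>i<n. sqnorm (nc_coeff (h $ i)))) UNIV"
proof -
  have "((\<lambda>p. (cmod (cof h p))\<^sup>2) has_sum sqnorm (nc_coeff (h $ i))) (Pair i ` UNIV)" if i: "i < n" for i
  proof -
    have inj: "inj_on (Pair i) UNIV" by (simp add: inj_on_def)
    have "((\<lambda>w. (cmod (nc_coeff (h $ i) w))\<^sup>2) has_sum sqnorm (nc_coeff (h $ i))) UNIV"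
      using l2[OF i] by (simp add: l2_def sqnorm_def)
    then show ?thesis
      unfolding has_sum_reindex[OF inj] using h i by (simp add: comp_def cof_def)
  qed
  then have "((\<lambda>p. (cmod (cof h p))\<^sup>2) has_sum (\<Sum>i<n. sqnorm (nc_coeff (h $ i)))) (\<Union>i<n. Pair i ` UNIV)"
    by (intro sum_has_sum) auto
  moreover have "((\<lambda>p. (cmod (cof h p))\<^sup>2) has_sum s) (\<Union>i<n. Pair i ` UNIV)
      \<longleftrightarrow> ((\<lambda>p. (cmod (cof h p))\<^sup>2) has_sum s) UNIV" for s
    by (rule has_sum_cong_neutral) (use h in \<open>auto simp: cof_def image_iff\<close>)
  ultimately show ?thesis by blast
qed

lemma l2_cof_entry:
  assumes h: "h \<in> carrier_vec n" and l2: "l2 (cof h)" and i: "i < n"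
  shows "l2 (nc_coeff (h $ i))" "sqnorm (nc_coeff (h $ i)) \<le> sqnorm (cof h)"
proof -
  have "(\<Sum>w\<in>W. (cmod (nc_coeff (h $ i) w))\<^sup>2) \<le> sqnorm (cof h)" if W: "finite W" for W
  proof -
    have "(\<Sum>w\<in>W. (cmod (nc_coeff (h $ i) w))\<^sup>2) = (\<Sum>p\<in>Pair i ` W. (cmod (cof h p))\<^sup>2)"
      using h i by (subst sum.reindex) (auto simp: inj_on_def cof_def)
    then show ?thesis using sum_le_sqnorm[OF l2, of "Pair i ` W"] W by simp
  qed
  then show "l2 (nc_coeff (h $ i))" "sqnorm (nc_coeff (h $ i)) \<le> sqnorm (cof h)"
    using l2I by blast+
qed

lemma l2_cof_iff: "h \<in> carrier_vec n \<Longrightarrow> l2 (cof h) \<longleftrightarrow> (\<forall>i<n. l2 (nc_coeff (h $ i)))"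
  using cof_has_sum[of h n] l2_cof_entry(1)[of h n] unfolding l2_def has_sum_iff by blast

lemma sqnorm_cof: "h \<in> carrier_vec n \<Longrightarrow> l2 (cof h) \<Longrightarrow> sqnorm (cof h) = (\<Sum>i<n. sqnorm (nc_coeff (h $ i)))"
  using cof_has_sum[of h n] l2_cof_iff[of h n] unfolding sqnorm_def by (auto simp: has_sum_iff)

lemma cof_add: "h \<in> carrier_vec n \<Longrightarrow> g \<in> carrier_vec n \<Longrightarrow> cof (h + g) = (\<lambda>p. cof h p + cof g p)"
  by (auto simp: cof_def fun_eq_iff)

lemma cof_sum_bound:
  assumes h: "h \<in> carrier_vec n"
    and bound: "\<And>W. finite W \<Longrightarrow> (\<Sum>i<n. \<Sum>w\<in>W. (cmod (nc_coeff (h $ i) w))\<^sup>2) \<le> c"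
  shows "l2 (cof h)" "sqnorm (cof h) \<le> c"
proof -
  have "(\<Sum>p\<in>B. (cmod (cof h p))\<^sup>2) \<le> c" if B: "finite B" for B
  proof -
    let ?C = "{..<n} \<times> snd ` B"
    have "(\<Sum>p\<in>B. (cmod (cof h p))\<^sup>2) = (\<Sum>p\<in>B \<inter> ?C. (cmod (cof h p))\<^sup>2)"
    proof (intro sum.mono_neutral_right B ballI)
      fix p assume p: "p \<in> B - B \<inter> ?C"
      then have "snd p \<in> snd ` B" by blast
      then have "\<not> fst p < n" using p by (cases p) auto
      then show "(cmod (cof h p))\<^sup>2 = 0" using h by (cases p) (simp add: cof_def)
    qed blast
    also have "\<dots> \<le> (\<Sum>p\<in>?C. (cmod (cof h p))\<^sup>2)"
      using B by (intro sum_mono2) auto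
    also have "\<dots> = (\<Sum>i<n. \<Sum>w\<in>snd ` B. (cmod (nc_coeff (h $ i) w))\<^sup>2)"
      using h by (simp add: sum.cartesian_product' cof_def)
    also have "\<dots> \<le> c" using B by (intro bound) simp
    finally show ?thesis .
  qed
  then show "l2 (cof h)" "sqnorm (cof h) \<le> c" using l2I by blast+
qed

lemma sum_le_sqnorm_cof:
  assumes h: "h \<in> carrier_vec n" and l2: "l2 (cof h)" and W: "finite W"
  shows "(\<Sum>i<n. \<Sum>w\<in>W. (cmod (nc_coeff (h $ i) w))\<^sup>2) \<le> sqnorm (cof h)"
proof -
  have "(\<Sum>i<n. \<Sum>w\<in>W. (cmod (nc_coeff (h $ i) w))\<^sup>2) = (\<Sum>p\<in>{..<n} \<times> W. (cmod (cof h p))\<^sup>2)"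
    using h by (simp add: sum.cartesian_product' cof_def)
  then show ?thesis using sum_le_sqnorm[OF l2, of "{..<n} \<times> W"] W by simp
qed

section \<open>Bounded matrices\<close>

text \<open>
  The constant again refers to squared norms.
\<close>

definition l2_bounded :: "nat \<Rightarrow> ('a nc_series vec \<Rightarrow> 'b \<Rightarrow> complex) \<Rightarrow> bool" where
  "l2_bounded n T \<longleftrightarrow> (\<exists>c. \<forall>h\<in>carrier_vec n. l2 (cof h) \<longrightarrow> l2 (T h) \<and> sqnorm (T h) \<le> c * sqnorm (cof h))"

lemma l2_boundedD:
  assumes "l2_bounded n T"
  shows "\<exists>c\<ge>0. \<forall>h\<in>carrier_vec n. l2 (cof h) \<longrightarrow> l2 (T h) \<and> sqnorm (T h) \<le> c * sqnorm (cof h)"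
proof -
  obtain c where c: "\<forall>h\<in>carrier_vec n. l2 (cof h) \<longrightarrow> l2 (T h) \<and> sqnorm (T h) \<le> c * sqnorm (cof h)"
    using assms unfolding l2_bounded_def by (rule exE)
  have "l2 (T h) \<and> sqnorm (T h) \<le> \<bar>c\<bar> * sqnorm (cof h)" if h: "h \<in> carrier_vec n" "l2 (cof h)" for h
    using c[rule_format, OF h] mult_right_mono[OF abs_ge_self sqnorm_nonneg, of c "cof h"] by linarith
  then show ?thesis by (intro exI[of _ "\<bar>c\<bar>"] conjI ballI impI) simp_all
qed

lemma l2_boundedI:
  assumes "\<And>h. h \<in> carrier_vec n \<Longrightarrow> l2 (cof h) \<Longrightarrow> l2 (T h)"
    "\<And>h. h \<in> carrier_vec n \<Longrightarrow> l2 (cof h) \<Longrightarrow> sqnorm (T h) \<le> c * sqnorm (cof h)"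
  shows "l2_bounded n T"
  using assms unfolding l2_bounded_def by blast

lemma l2_bounded_cong:
  assumes "\<And>h. h \<in> carrier_vec n \<Longrightarrow> S h = T h"
  shows "l2_bounded n S \<longleftrightarrow> l2_bounded n T"
  unfolding l2_bounded_def using assms by (intro ex_cong1 ball_cong) auto

lemma l2_bounded_add:
  assumes "l2_bounded n S" "l2_bounded n T"
  shows "l2_bounded n (\<lambda>h b. S h b + T h b)"
proof -
  obtain c where c: "\<forall>h\<in>carrier_vec n. l2 (cof h) \<longrightarrow> l2 (S h) \<and> sqnorm (S h) \<le> c * sqnorm (cof h)"
    using assms(1) unfolding l2_bounded_def by (rule exE)
  obtain d where d: "\<forall>h\<in>carrier_vec n. l2 (cof h) \<longrightarrow> l2 (T h) \<and> sqnorm (T h) \<le> d * sqnorm (cof h)"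
    using assms(2) unfolding l2_bounded_def by (rule exE)
  show ?thesis
  proof (rule l2_boundedI)
    fix h :: "'a nc_series vec" assume h: "h \<in> carrier_vec n" "l2 (cof h)"
    note S = c[rule_format, OF h] and T = d[rule_format, OF h]
    show "l2 (\<lambda>b. S h b + T h b)" by (rule l2_add(1)[OF conjunct1[OF S] conjunct1[OF T]])
    have "sqnorm (\<lambda>b. S h b + T h b) \<le> 2 * sqnorm (S h) + 2 * sqnorm (T h)"
      by (rule l2_add(2)[OF conjunct1[OF S] conjunct1[OF T]])
    also have "\<dots> \<le> (2 * c + 2 * d) * sqnorm (cof h)"
      using conjunct2[OF S] conjunct2[OF T] by (simp add: algebra_simps)
    finally show "sqnorm (\<lambda>b. S h b + T h b) \<le> (2 * c + 2 * d) * sqnorm (cof h)" .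
  qed
qed

lemma l2_bounded_sum:
  assumes "\<And>j. j \<in> J \<Longrightarrow> l2_bounded n (T j)" "finite J"
  shows "l2_bounded n (\<lambda>h b. \<Sum>j\<in>J. T j h b)"
  using assms(2,1)
proof (induction J)
  case empty
  show ?case by (rule l2_boundedI[of _ _ 0]) (auto simp: l2_def sqnorm_def)
next
  case (insert j J)
  then show ?case by (simp add: l2_bounded_add)
qed

lemma l2_bounded_entries:
  assumes T: "\<And>h. h \<in> carrier_vec n \<Longrightarrow> T h \<in> carrier_vec m"
    and entries: "\<And>i. i < m \<Longrightarrow> l2_bounded n (\<lambda>h. nc_coeff (T h $ i))"
  shows "l2_bounded n (\<lambda>h. cof (T h))"
proof -
  obtain c where c: "\<And>i h. i < m \<Longrightarrow> h \<in> carrier_vec n \<Longrightarrow> l2 (cof h) \<Longrightarrow> l2 (nc_coeff (T h $ i))"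
    "\<And>i h. i < m \<Longrightarrow> h \<in> carrier_vec n \<Longrightarrow> l2 (cof h) \<Longrightarrow> sqnorm (nc_coeff (T h $ i)) \<le> c i * sqnorm (cof h)"
    using entries unfolding l2_bounded_def by metis
  show ?thesis
  proof (rule l2_boundedI)
    fix h :: "'a nc_series vec" assume h: "h \<in> carrier_vec n" "l2 (cof h)"
    show l2: "l2 (cof (T h))" unfolding l2_cof_iff[OF T[OF h(1)]] using c(1) h by blast
    show "sqnorm (cof (T h)) \<le> (\<Sum>i<m. c i) * sqnorm (cof h)"
      unfolding sqnorm_cof[OF T[OF h(1)] l2] sum_distrib_right by (intro sum_mono c(2)) (use h in auto)
  qed
qed

lemma l2_bounded_comp:
  assumes S: "l2_bounded n (\<lambda>h. cof (S h))" and T: "l2_bounded m T"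
    and carrier: "\<And>h. h \<in> carrier_vec n \<Longrightarrow> S h \<in> carrier_vec m"
  shows "l2_bounded n (\<lambda>h. T (S h))"
proof -
  obtain c where c: "\<forall>h\<in>carrier_vec n. l2 (cof h) \<longrightarrow> l2 (cof (S h)) \<and> sqnorm (cof (S h)) \<le> c * sqnorm (cof h)"
    using S unfolding l2_bounded_def by (rule exE)
  obtain d where d0: "0 \<le> d"
    and d: "\<forall>h\<in>carrier_vec m. l2 (cof h) \<longrightarrow> l2 (T h) \<and> sqnorm (T h) \<le> d * sqnorm (cof h)"
    using l2_boundedD[OF T] by (elim exE conjE)
  show ?thesis
  proof (rule l2_boundedI)
    fix h :: "'a nc_series vec" assume h: "h \<in> carrier_vec n" "l2 (cof h)"
    note Sh = c[rule_format, OF h]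
    note TSh = d[rule_format, OF carrier[OF h(1)] conjunct1[OF Sh]]
    show "l2 (T (S h))" by (rule conjunct1[OF TSh])
    have "sqnorm (T (S h)) \<le> d * sqnorm (cof (S h))" by (rule conjunct2[OF TSh])
    also have "\<dots> \<le> d * (c * sqnorm (cof h))" by (rule mult_left_mono[OF conjunct2[OF Sh] d0])
    finally show "sqnorm (T (S h)) \<le> (d * c) * sqnorm (cof h)" by (simp add: mult.assoc)
  qed
qed

lemma mult_mat_vec_index_sum:
  "F \<in> carrier_mat n n \<Longrightarrow> h \<in> carrier_vec n \<Longrightarrow> i < n \<Longrightarrow> (F *\<^sub>v h) $ i = (\<Sum>j<n. F $$ (i,j) * h $ j)"
  by (auto simp: scalar_prod_def atLeast0LessThan)

lemma Hinf_mat_iff_l2_bounded: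
  fixes F :: "'a nc_series mat"
  shows "F \<in> Hinf_mat n \<longleftrightarrow> F \<in> carrier_mat n n \<and> l2_bounded n (\<lambda>h. cof (F *\<^sub>v h))"
proof (intro iffI conjI)
  assume F: "F \<in> Hinf_mat n"
  then show carrier: "F \<in> carrier_mat n n" by (simp add: Hinf_mat_def)
  show "l2_bounded n (\<lambda>h. cof (F *\<^sub>v h))"
  proof (rule l2_bounded_entries)
    fix i assume i: "i < n"
    have "l2_bounded n (\<lambda>h w. \<Sum>j<n. nc_coeff (F $$ (i,j) * h $ j) w)"
    proof (rule l2_bounded_sum)
      fix j assume "j \<in> {..<n}"
      then have j: "j < n" by simp
      have "F $$ (i,j) \<in> Hinf" using F i j by (simp add: Hinf_mat_def)
      then obtain c where c: "l2_multiplier c (F $$ (i,j))" using Hinf_imp_l2_multiplier by blast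
      have "0 \<le> c" by (rule l2_multiplier_const_nonneg[OF c])
      show "l2_bounded n (\<lambda>h. nc_coeff (F $$ (i,j) * h $ j))"
      proof (rule l2_boundedI)
        fix h :: "'a nc_series vec" assume h: "h \<in> carrier_vec n" "l2 (cof h)"
        have l2: "l2 (nc_coeff (h $ j))" by (rule l2_cof_entry[OF h j])
        then show "l2 (nc_coeff (F $$ (i,j) * h $ j))" using c by (simp add: l2_multiplier_def)
        have "sqnorm (nc_coeff (F $$ (i,j) * h $ j)) \<le> c * sqnorm (nc_coeff (h $ j))"
          using c l2 by (simp add: l2_multiplier_def)
        also have "\<dots> \<le> c * sqnorm (cof h)"
          using \<open>0 \<le> c\<close> l2_cof_entry(2)[OF h j] by (rule mult_left_mono[rotated])
        finally show "sqnorm (nc_coeff (F $$ (i,j) * h $ j)) \<le> c * sqnorm (cof h)" .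
      qed
    qed simp
    moreover have "nc_coeff ((F *\<^sub>v h) $ i) = (\<lambda>w. \<Sum>j<n. nc_coeff (F $$ (i,j) * h $ j) w)"
      if "h \<in> carrier_vec n" for h
      unfolding mult_mat_vec_index_sum[OF carrier that i] by (rule ext) (rule nc_coeff_sum)
    ultimately show "l2_bounded n (\<lambda>h. nc_coeff ((F *\<^sub>v h) $ i))"
      by (subst l2_bounded_cong)
  qed (rule mult_mat_vec_carrier[OF carrier])
next
  assume *: "F \<in> carrier_mat n n \<and> l2_bounded n (\<lambda>h. cof (F *\<^sub>v h))"
  then have carrier: "F \<in> carrier_mat n n" by (rule conjunct1)
  obtain c where bound: "\<forall>h\<in>carrier_vec n. l2 (cof h) \<longrightarrow>
      l2 (cof (F *\<^sub>v h)) \<and> sqnorm (cof (F *\<^sub>v h)) \<le> c * sqnorm (cof h)"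
    using conjunct2[OF *] unfolding l2_bounded_def by (rule exE)
  have c: "l2 (cof (F *\<^sub>v h))" "sqnorm (cof (F *\<^sub>v h)) \<le> c * sqnorm (cof h)"
    if "h \<in> carrier_vec n" "l2 (cof h)" for h
    using bspec[OF bound that(1)] that(2) by simp_all
  have "l2_multiplier c (F $$ (i,j))" if i: "i < n" and j: "j < n" for i j
    unfolding l2_multiplier_def
  proof (intro allI impI)
    fix g :: "'a nc_series" assume g: "l2 (nc_coeff g)"
    define h where "h = vec n (\<lambda>l. if l = j then g else 0)"
    have h: "h \<in> carrier_vec n" by (simp add: h_def)
    have l2h: "l2 (cof h)" unfolding l2_cof_iff[OF h] using g by (simp add: h_def l2_def)
    have "sqnorm (cof h) = (\<Sum>l<n. if l = j then sqnorm (nc_coeff g) else 0)"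
      unfolding sqnorm_cof[OF h l2h] by (intro sum.cong refl) (simp add: h_def sqnorm_def)
    then have norm_h: "sqnorm (cof h) = sqnorm (nc_coeff g)" using j by simp
    have "(F *\<^sub>v h) $ i = (\<Sum>l<n. if l = j then F $$ (i,l) * g else 0)"
      unfolding mult_mat_vec_index_sum[OF carrier h i] by (intro sum.cong refl) (simp add: h_def)
    then have "(F *\<^sub>v h) $ i = F $$ (i,j) * g" using j by simp
    then have entry: "l2 (nc_coeff (F $$ (i,j) * g))"
      "sqnorm (nc_coeff (F $$ (i,j) * g)) \<le> sqnorm (cof (F *\<^sub>v h))"
      using l2_cof_entry[OF mult_mat_vec_carrier[OF carrier h] c(1)[OF h l2h] i] by simp_all
    then show "l2 (nc_coeff (F $$ (i,j) * g)) \<and> sqnorm (nc_coeff (F $$ (i,j) * g)) \<le> c * sqnorm (nc_coeff g)"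
      using c(2)[OF h l2h] norm_h by simp
  qed
  then have "F $$ (i,j) \<in> Hinf" if "i < n" "j < n" for i j
    by (rule l2_multiplier_imp_Hinf[OF _]) (use that in blast)+
  then show "F \<in> Hinf_mat n" using carrier by (simp add: Hinf_mat_def)
qed

lemma Hinf_mat_carrier: "F \<in> Hinf_mat n \<Longrightarrow> F \<in> carrier_mat n n"
  by (simp add: Hinf_mat_def)

lemma Hinf_mat_mult:
  assumes F: "F \<in> Hinf_mat n" and G: "G \<in> Hinf_mat n"
  shows "F * G \<in> Hinf_mat n"
proof -
  note carrier = Hinf_mat_carrier[OF F] Hinf_mat_carrier[OF G]
  have "l2_bounded n (\<lambda>h. cof (F *\<^sub>v (G *\<^sub>v h)))"
  proof (rule l2_bounded_comp[of n "\<lambda>h. G *\<^sub>v h" n "\<lambda>h. cof (F *\<^sub>v h)"])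
    show "l2_bounded n (\<lambda>h. cof (G *\<^sub>v h))" using G unfolding Hinf_mat_iff_l2_bounded by (rule conjunct2)
    show "l2_bounded n (\<lambda>h. cof (F *\<^sub>v h))" using F unfolding Hinf_mat_iff_l2_bounded by (rule conjunct2)
  qed (rule mult_mat_vec_carrier[OF carrier(2)])
  then have "l2_bounded n (\<lambda>h. cof ((F * G) *\<^sub>v h))"
    by (subst l2_bounded_cong[where T = "\<lambda>h. cof (F *\<^sub>v (G *\<^sub>v h))"])
       (simp_all add: assoc_mult_mat_vec[OF carrier])
  then show ?thesis unfolding Hinf_mat_iff_l2_bounded using mult_carrier_mat[OF carrier] by blast
qed

lemma Hinf_diff: "f \<in> Hinf \<Longrightarrow> g \<in> Hinf \<Longrightarrow> f - g \<in> Hinf"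
proof -
  assume "f \<in> Hinf" "g \<in> Hinf"
  then obtain c d where c: "l2_multiplier c f" and d: "l2_multiplier d g"
    by (auto simp: Hinf_iff_l2_multiplier)
  have "l2_multiplier (2 * c + 2 * d) (f - g)"
    unfolding l2_multiplier_def
  proof (intro allI impI)
    fix h :: "'a nc_series" assume h: "l2 (nc_coeff h)"
    have f: "l2 (nc_coeff (f * h))" "sqnorm (nc_coeff (f * h)) \<le> c * sqnorm (nc_coeff h)"
      and g: "l2 (nc_coeff (g * h))" "sqnorm (nc_coeff (g * h)) \<le> d * sqnorm (nc_coeff h)"
      using c d h by (auto simp: l2_multiplier_def)
    have eq: "nc_coeff ((f - g) * h) = (\<lambda>w. nc_coeff (f * h) w + (- nc_coeff (g * h) w))"
      by (simp add: left_diff_distrib fun_eq_iff)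
    show "l2 (nc_coeff ((f - g) * h)) \<and> sqnorm (nc_coeff ((f - g) * h)) \<le> (2 * c + 2 * d) * sqnorm (nc_coeff h)"
      unfolding eq
      using l2_add[OF f(1) l2_uminus[OF g(1)]] f(2) g(2) by (simp add: sqnorm_uminus algebra_simps)
  qed
  then show ?thesis by (auto simp: Hinf_iff_l2_multiplier)
qed

lemma nc_const_in_Hinf: "(nc_const c :: 'a nc_series) \<in> Hinf"
proof -
  have "nc_coeff (nc_const c * g) = (\<lambda>w. c * nc_coeff g w)" for g :: "'a nc_series"
    by (simp add: fun_eq_iff nc_coeff_const_mult)
  then have "l2_multiplier ((cmod c)\<^sup>2) (nc_const c :: 'a nc_series)" unfolding l2_multiplier_def
    by (simp add: sqnorm_scale)
  then show ?thesis by (auto simp: Hinf_iff_l2_multiplier)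
qed

lemma ampliation_in_Hinf_mat: "P \<in> carrier_mat n n \<Longrightarrow> ampliation P \<in> Hinf_mat n"
  by (auto simp: Hinf_mat_def ampliation_def nc_const_in_Hinf)

section \<open>Formal matrices over series\<close>

definition const_part :: "'a nc_series mat \<Rightarrow> complex mat" where
  "const_part F = map_mat (\<lambda>f. nc_coeff f []) F"

lemma coeff_mult_mat:
  assumes "A \<in> carrier_mat n n" "B \<in> carrier_mat n n" "i < n" "j < n"
  shows "nc_coeff ((A * B) $$ (i,j)) w
    = (\<Sum>l<n. \<Sum>k\<le>length w. nc_coeff (A $$ (i,l)) (take k w) * nc_coeff (B $$ (l,j)) (drop k w))"
  using assms by (simp add: scalar_prod_def atLeast0LessThan nc_coeff_sum times_nc_series.rep_eq)

lemma coeff_mult_mat_vec: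
  assumes "F \<in> carrier_mat n n" "h \<in> carrier_vec n" "i < n"
  shows "nc_coeff ((F *\<^sub>v h) $ i) w
    = (\<Sum>l<n. \<Sum>k\<le>length w. nc_coeff (F $$ (i,l)) (take k w) * nc_coeff (h $ l) (drop k w))"
  using assms by (simp add: scalar_prod_def atLeast0LessThan nc_coeff_sum times_nc_series.rep_eq)

definition agree_upto :: "nat \<Rightarrow> nat \<Rightarrow> 'a nc_series mat \<Rightarrow> 'a nc_series mat \<Rightarrow> bool" where
  "agree_upto n N A B \<longleftrightarrow> (\<forall>i<n. \<forall>j<n. \<forall>w. length w \<le> N \<longrightarrow> nc_coeff (A $$ (i,j)) w = nc_coeff (B $$ (i,j)) w)"

lemma agree_uptoD:
  "agree_upto n N A B \<Longrightarrow> i < n \<Longrightarrow> j < n \<Longrightarrow> length w \<le> N \<Longrightarrow> nc_coeff (A $$ (i,j)) w = nc_coeff (B $$ (i,j)) w"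
  by (simp add: agree_upto_def)

lemma agree_upto_mult:
  assumes "A \<in> carrier_mat n n" "A' \<in> carrier_mat n n" "B \<in> carrier_mat n n" "B' \<in> carrier_mat n n"
    and "agree_upto n N A A'" "agree_upto n N B B'"
  shows "agree_upto n N (A * B) (A' * B')"
  unfolding agree_upto_def
proof (intro allI impI)
  fix i j and w :: "'a list" assume ij: "i < n" "j < n" and w: "length w \<le> N"
  show "nc_coeff ((A * B) $$ (i,j)) w = nc_coeff ((A' * B') $$ (i,j)) w"
    unfolding coeff_mult_mat[OF assms(1,3) ij] coeff_mult_mat[OF assms(2,4) ij]
    by (intro sum.cong refl arg_cong2[of _ _ _ _ "(*)"] agree_uptoD[OF assms(5)] agree_uptoD[OF assms(6)])
       (use ij w in auto)
qed

lemma agree_upto_all_imp_eq: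
  assumes "A \<in> carrier_mat n n" "B \<in> carrier_mat n n" "\<And>N. agree_upto n N A B"
  shows "A = B"
proof (rule eq_matI)
  fix i j assume "i < dim_row B" "j < dim_col B"
  then have "i < n" "j < n" using assms by auto
  then show "A $$ (i,j) = B $$ (i,j)"
    by (intro nc_series_eqI agree_uptoD[OF assms(3)]) auto
qed (use assms in auto)

text \<open>
  Since \<open>T = 1 - \<Theta>\<close> has no constant term, the coefficients of the geometric series at words of length
  at most \<open>k\<close> are those of its partial sum \<open>G k\<close>, and \<open>S\<close> can be assembled from these.
\<close>

lemma formal_inverse:
  fixes \<Theta> :: "'a nc_series mat"
  assumes \<Theta>: "\<Theta> \<in> carrier_mat n n" and const: "const_part \<Theta> = 1\<^sub>m n"
  obtains S where "S \<in> carrier_mat n n" "\<Theta> * S = 1\<^sub>m n" "S * \<Theta> = 1\<^sub>m n"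
proof -
  define T where "T = 1\<^sub>m n - \<Theta>"
  have T: "T \<in> carrier_mat n n" unfolding T_def by (rule minus_carrier_mat[OF \<Theta>])
  have T0: "nc_coeff (T $$ (i,j)) [] = 0" if "i < n" "j < n" for i j
  proof -
    have "nc_coeff (\<Theta> $$ (i,j)) [] = const_part \<Theta> $$ (i,j)" using \<Theta> that by (simp add: const_part_def)
    then show ?thesis using \<Theta> that by (simp add: T_def const one_nc_series.rep_eq)
  qed
  define G where "G k = ((\<lambda>X. 1\<^sub>m n + T * X) ^^ k) (1\<^sub>m n)" for k :: nat
  have G_Suc: "G (Suc k) = 1\<^sub>m n + T * G k" for k by (simp add: G_def)
  have G: "G k \<in> carrier_mat n n" for k by (induction k) (use T in \<open>auto simp: G_def\<close>)
  have TG: "T * G k \<in> carrier_mat n n" for k using T G by (rule mult_carrier_mat)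
  have G_index: "G (Suc k) $$ (i,j) = 1\<^sub>m n $$ (i,j) + (T * G k) $$ (i,j)" if "i < n" "j < n" for i j k
    unfolding G_Suc using carrier_matD[OF TG[of k]] that by (simp del: index_mult_mat)
  have comm: "T * G k = G k * T" for k
  proof (induction k)
    case 0
    then show ?case using T by (simp add: G_def)
  next
    case (Suc k)
    have "T * G (Suc k) = T + T * (T * G k)"
      unfolding G_Suc using mult_add_distrib_mat[OF T one_carrier_mat TG] T by simp
    also have "T * (T * G k) = T * G k * T"
      by (metis Suc assoc_mult_mat[OF T G T])
    also have "T + T * G k * T = G (Suc k) * T"
      unfolding G_Suc using add_mult_distrib_mat[OF one_carrier_mat TG T] T by simp
    finally show ?case .
  qed
  have step: "agree_upto n k (G k) (G (Suc k))" for k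
  proof (induction k)
    case 0
    show ?case
      unfolding agree_upto_def
    proof (intro allI impI)
      fix i j and w :: "'a list" assume ij: "i < n" "j < n" and w: "length w \<le> 0"
      have "G (Suc 0) = 1\<^sub>m n + T" using T by (simp add: G_def)
      then have "G (Suc 0) $$ (i,j) = (1\<^sub>m n + T) $$ (i,j)" by simp
      also have "\<dots> = 1\<^sub>m n $$ (i,j) + T $$ (i,j)" using T ij by simp
      finally show "nc_coeff (G 0 $$ (i,j)) w = nc_coeff (G (Suc 0) $$ (i,j)) w"
        using T0[OF ij] w by (simp add: G_def)
    qed
  next
    case (Suc k)
    show ?case
      unfolding agree_upto_def
    proof (intro allI impI)
      fix i j and w :: "'a list" assume ij: "i < n" "j < n" and w: "length w \<le> Suc k"
      have "nc_coeff ((T * G k) $$ (i,j)) w = nc_coeff ((T * G (Suc k)) $$ (i,j)) w"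
        unfolding coeff_mult_mat[OF T G ij]
      proof (intro sum.cong refl)
        fix l q assume l: "l \<in> {..<n}" and q: "q \<in> {..length w}"
        show "nc_coeff (T $$ (i,l)) (take q w) * nc_coeff (G k $$ (l,j)) (drop q w)
            = nc_coeff (T $$ (i,l)) (take q w) * nc_coeff (G (Suc k) $$ (l,j)) (drop q w)"
        proof (cases "q = 0")
          case True
          then show ?thesis using T0[of i l] ij l by simp
        next
          case False
          then have "length (drop q w) \<le> k" using w by simp
          then show ?thesis using agree_uptoD[OF Suc, of l j "drop q w"] l ij by simp
        qed
      qed
      then show "nc_coeff (G (Suc k) $$ (i,j)) w = nc_coeff (G (Suc (Suc k)) $$ (i,j)) w"
        by (simp only: G_index[OF ij] nc_coeff_simps)
    qed
  qed
  have chain: "agree_upto n k (G k) (G l)" if "k \<le> l" for k l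
    using that
  proof (induction l rule: dec_induct)
    case base
    show ?case by (simp add: agree_upto_def)
  next
    case (step l)
    then show ?case using \<open>\<And>k. agree_upto n k (G k) (G (Suc k))\<close>[of l] by (simp add: agree_upto_def)
  qed
  define S where "S = mat n n (\<lambda>(i,j). Nc_series (\<lambda>w. nc_coeff (G (length w) $$ (i,j)) w))"
  have S: "S \<in> carrier_mat n n" by (simp add: S_def)
  have SG: "agree_upto n k S (G k)" for k
    unfolding agree_upto_def using chain by (auto simp: S_def agree_upto_def)
  have residue: "agree_upto n k (G k - T * G k) (1\<^sub>m n)" for k
    unfolding agree_upto_def
  proof (intro allI impI)
    fix i j and w :: "'a list" assume ij: "i < n" "j < n" and w: "length w \<le> k"
    have "nc_coeff (G k $$ (i,j)) w = nc_coeff (G (Suc k) $$ (i,j)) w"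
      by (rule agree_uptoD[OF step ij w])
    then show "nc_coeff ((G k - T * G k) $$ (i,j)) w = nc_coeff (1\<^sub>m n $$ (i,j)) w"
      unfolding G_Suc using carrier_matD[OF TG[of k]] ij by (simp del: index_mult_mat)
  qed
  have \<Theta>T: "\<Theta> = 1\<^sub>m n - T" using \<Theta> by (auto simp: T_def)
  have \<Theta>G: "\<Theta> * G k = G k - T * G k" for k
    unfolding \<Theta>T using minus_mult_distrib_mat[OF one_carrier_mat T G, of k] left_mult_one_mat[OF G[of k]] by simp
  have G\<Theta>: "G k * \<Theta> = G k - T * G k" for k
    unfolding \<Theta>T using mult_minus_distrib_mat[OF G one_carrier_mat T, of k] right_mult_one_mat[OF G[of k]] comm by simp
  have refl: "agree_upto n k \<Theta> \<Theta>" for k by (simp add: agree_upto_def)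
  have "agree_upto n k (\<Theta> * S) (1\<^sub>m n)" for k
    using agree_upto_mult[OF \<Theta> \<Theta> S G refl SG, of k] residue[of k] unfolding \<Theta>G by (simp add: agree_upto_def)
  then have "\<Theta> * S = 1\<^sub>m n" by (intro agree_upto_all_imp_eq[of _ n]) (use \<Theta> S in auto)
  moreover have "agree_upto n k (S * \<Theta>) (1\<^sub>m n)" for k
    using agree_upto_mult[OF S G \<Theta> \<Theta> SG refl, of k] residue[of k] unfolding G\<Theta> by (simp add: agree_upto_def)
  then have "S * \<Theta> = 1\<^sub>m n" by (intro agree_upto_all_imp_eq[of _ n]) (use \<Theta> S in auto)
  ultimately show ?thesis using that S by blast
qed

text \<open>
  The columns \<open>strip k h\<close> are the components in \<open>h = h\<^sub>0 + (\<Sum>k. (strip k h) Z\<^sub>k)\<close>, where \<open>h\<^sub>0\<close> is the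
  constant term; the letters stand on the right, where they commute with the action of matrices.
\<close>

definition strip :: "'a \<Rightarrow> 'a nc_series vec \<Rightarrow> 'a nc_series vec" where
  "strip k h = map_vec (\<lambda>f. Nc_series (\<lambda>w. nc_coeff f (w @ [k]))) h"

lemma strip_carrier: "h \<in> carrier_vec n \<Longrightarrow> strip k h \<in> carrier_vec n"
  by (simp add: strip_def)

lemma coeff_strip: "h \<in> carrier_vec n \<Longrightarrow> i < n \<Longrightarrow> nc_coeff (strip k h $ i) w = nc_coeff (h $ i) (w @ [k])"
  by (simp add: strip_def)

lemma vec_series_eqI:
  assumes "g \<in> carrier_vec n" "h \<in> carrier_vec n"
    "\<And>i w. i < n \<Longrightarrow> nc_coeff (g $ i) w = nc_coeff (h $ i) w"
  shows "g = h"
  by (rule eq_vecI) (use assms in \<open>auto intro: nc_series_eqI\<close>)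

lemma coeff_mult_mat_vec_snoc:
  assumes F: "F \<in> carrier_mat n n" and h: "h \<in> carrier_vec n" and i: "i < n"
  shows "nc_coeff ((F *\<^sub>v h) $ i) (w @ [k]) = nc_coeff ((F *\<^sub>v strip k h) $ i) w
    + (\<Sum>l<n. nc_coeff (F $$ (i,l)) (w @ [k]) * nc_coeff (h $ l) [])"
  unfolding coeff_mult_mat_vec[OF F h i] coeff_mult_mat_vec[OF F strip_carrier[OF h] i] sum.distrib[symmetric]
  by (intro sum.cong refl) (simp add: coeff_strip[OF h])

lemma strip_mult_mat_vec:
  assumes F: "F \<in> carrier_mat n n" and h: "h \<in> carrier_vec n" and h0: "\<And>i. i < n \<Longrightarrow> nc_coeff (h $ i) [] = 0"
  shows "strip k (F *\<^sub>v h) = F *\<^sub>v strip k h"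
proof (rule vec_series_eqI)
  note Fh = mult_mat_vec_carrier[OF F h]
  show "strip k (F *\<^sub>v h) \<in> carrier_vec n" by (rule strip_carrier[OF Fh])
  show "F *\<^sub>v strip k h \<in> carrier_vec n" by (rule mult_mat_vec_carrier[OF F strip_carrier[OF h]])
  fix i w assume i: "i < n"
  show "nc_coeff (strip k (F *\<^sub>v h) $ i) w = nc_coeff ((F *\<^sub>v strip k h) $ i) w"
    unfolding coeff_strip[OF Fh i] coeff_mult_mat_vec_snoc[OF F h i] by (simp add: h0)
qed

lemma strip_has_sum:
  assumes h: "h \<in> carrier_vec n" and l2: "l2 (cof (strip k h))"
  shows "((\<lambda>p. (cmod (cof h p))\<^sup>2) has_sum sqnorm (cof (strip k h))) (range (\<lambda>(i,w). (i, w @ [k])))"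
proof -
  have inj: "inj (\<lambda>(i :: nat, w). (i, w @ [k]))" by (auto simp: inj_on_def)
  have "(cmod (cof h (i, w @ [k])))\<^sup>2 = (cmod (cof (strip k h) (i,w)))\<^sup>2" for i w
    by (simp add: cof_def strip_def)
  then have "(\<lambda>p. (cmod (cof h p))\<^sup>2) \<circ> (\<lambda>(i,w). (i, w @ [k])) = (\<lambda>p. (cmod (cof (strip k h) p))\<^sup>2)"
    by (simp add: fun_eq_iff)
  then show ?thesis
    unfolding has_sum_reindex[OF inj] using l2 by (simp add: l2_def sqnorm_def)
qed

lemma sum_strip_le:
  assumes h: "h \<in> carrier_vec n" and l2: "l2 (cof h)"
  shows "l2 (cof (strip k h))"
    and "finite K \<Longrightarrow> (\<Sum>k\<in>K. sqnorm (cof (strip k h))) \<le> sqnorm (cof h)"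
proof -
  show l2s: "l2 (cof (strip k h))" for k
  proof (rule cof_sum_bound(1)[OF strip_carrier[OF h]])
    fix W :: "'a list set" assume W: "finite W"
    have "(\<Sum>w\<in>W. (cmod (nc_coeff (strip k h $ i) w))\<^sup>2) = (\<Sum>w\<in>(\<lambda>w. w @ [k]) ` W. (cmod (nc_coeff (h $ i) w))\<^sup>2)"
      if "i < n" for i
      by (subst sum.reindex) (auto simp: inj_on_def coeff_strip[OF h that])
    then have "(\<Sum>i<n. \<Sum>w\<in>W. (cmod (nc_coeff (strip k h $ i) w))\<^sup>2)
        = (\<Sum>i<n. \<Sum>w\<in>(\<lambda>w. w @ [k]) ` W. (cmod (nc_coeff (h $ i) w))\<^sup>2)" by simp
    also have "\<dots> \<le> sqnorm (cof h)" by (rule sum_le_sqnorm_cof[OF h l2]) (simp add: W)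
    finally show "(\<Sum>i<n. \<Sum>w\<in>W. (cmod (nc_coeff (strip k h $ i) w))\<^sup>2) \<le> sqnorm (cof h)" .
  qed
  assume K: "finite K"
  let ?A = "\<lambda>k. range (\<lambda>(i :: nat, w). (i, w @ [k]))"
  have "((\<lambda>p. (cmod (cof h p))\<^sup>2) has_sum (\<Sum>k\<in>K. sqnorm (cof (strip k h)))) (\<Union>k\<in>K. ?A k)"
    by (intro sum_has_sum K strip_has_sum[OF h l2s]) auto
  moreover have "((\<lambda>p. (cmod (cof h p))\<^sup>2) has_sum sqnorm (cof h)) UNIV"
    using l2 by (simp add: l2_def sqnorm_def)
  ultimately show "(\<Sum>k\<in>K. sqnorm (cof (strip k h))) \<le> sqnorm (cof h)"
    by (rule has_sum_mono2) auto
qed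

lemma sqnorm_eq_sum_strip:
  assumes h: "h \<in> carrier_vec n" and h0: "\<And>i. i < n \<Longrightarrow> nc_coeff (h $ i) [] = 0" and K: "finite K"
    and l2: "\<And>k. k \<in> K \<Longrightarrow> l2 (cof (strip k h))"
    and zero: "\<And>k i w. k \<notin> K \<Longrightarrow> i < n \<Longrightarrow> nc_coeff (strip k h $ i) w = 0"
  shows "l2 (cof h)" "sqnorm (cof h) = (\<Sum>k\<in>K. sqnorm (cof (strip k h)))"
proof -
  let ?A = "\<lambda>k. range (\<lambda>(i :: nat, w). (i, w @ [k]))"
  have "((\<lambda>p. (cmod (cof h p))\<^sup>2) has_sum (\<Sum>k\<in>K. sqnorm (cof (strip k h)))) (\<Union>k\<in>K. ?A k)"
    by (intro sum_has_sum K strip_has_sum[OF h l2]) auto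
  moreover have "((\<lambda>p. (cmod (cof h p))\<^sup>2) has_sum s) (\<Union>k\<in>K. ?A k)
      \<longleftrightarrow> ((\<lambda>p. (cmod (cof h p))\<^sup>2) has_sum s) UNIV" for s
  proof (rule has_sum_cong_neutral)
    fix p assume p: "p \<in> UNIV - (\<Union>k\<in>K. ?A k)"
    obtain i w where iw: "p = (i,w)" by (cases p)
    show "(cmod (cof h p))\<^sup>2 = 0"
    proof (cases "i < n")
      case True
      show ?thesis
      proof (cases w rule: rev_cases)
        case Nil
        then show ?thesis using h0[OF True] by (simp add: iw cof_def)
      next
        case (snoc u k)
        have "k \<notin> K"
        proof
          assume "k \<in> K"
          moreover have "p \<in> ?A k" unfolding iw snoc by (rule range_eqI[of _ _ "(i,u)"]) simp
          ultimately show False using p by blast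
        qed
        then show ?thesis using zero[of k i u] True h by (simp add: iw cof_def snoc coeff_strip[OF h True])
      qed
    qed (use h iw in \<open>simp add: cof_def\<close>)
  qed auto
  ultimately have "((\<lambda>p. (cmod (cof h p))\<^sup>2) has_sum (\<Sum>k\<in>K. sqnorm (cof (strip k h)))) UNIV" by blast
  then show "l2 (cof h)" "sqnorm (cof h) = (\<Sum>k\<in>K. sqnorm (cof (strip k h)))"
    by (auto simp: l2_def sqnorm_def has_sum_iff)
qed

section \<open>The wandering subspace of an idempotent\<close>

lemma coeff_mult_const_right: "nc_coeff (f * nc_const c) w = c * nc_coeff f w"
proof -
  have "nc_coeff (f * nc_const c) w
      = (\<Sum>k\<le>length w. nc_coeff f (take k w) * (if drop k w = [] then c else 0))"
    by (simp add: times_nc_series.rep_eq nc_const_def)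
  also have "\<dots> = (\<Sum>k\<le>length w. if k = length w then c * nc_coeff f w else 0)"
    by (intro sum.cong) auto
  finally show ?thesis by simp
qed

lemma sum_short_words_Suc:
  assumes "finite F"
  shows "(\<Sum>w\<in>short_words F (Suc N). h w) = h [] + (\<Sum>k\<in>F. \<Sum>u\<in>short_words F N. h (u @ [k]))"
proof -
  have "level_words F 0 = {[]}" by (auto simp: level_words_def)
  moreover have "(\<Sum>j\<le>N. \<Sum>w\<in>level_words F j. \<Sum>k\<in>F. h (w @ [k]))
      = (\<Sum>k\<in>F. \<Sum>u\<in>short_words F N. h (u @ [k]))"
    unfolding sum_short_words[OF assms, symmetric] by (rule sum.swap)
  ultimately show ?thesis
    by (simp add: sum_short_words[OF assms, of h "Suc N"] sum.atMost_Suc_shift sum_level_words_Suc[OF assms]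
        del: sum.atMost_Suc)
qed

lemma sqnorm_combination_bound:
  assumes "finite J" "\<And>j. j \<in> J \<Longrightarrow> l2 (y j)"
  shows "\<exists>c\<ge>0. \<forall>a. sqnorm (\<lambda>b. \<Sum>j\<in>J. a j * y j b) \<le> c * (\<Sum>j\<in>J. (cmod (a j))\<^sup>2)"
  using assms
proof induction
  case empty
  show ?case by (auto simp: sqnorm_def)
next
  case (insert j J)
  then obtain c where c: "0 \<le> c" "\<And>a. sqnorm (\<lambda>b. \<Sum>j\<in>J. a j * y j b) \<le> c * (\<Sum>j\<in>J. (cmod (a j))\<^sup>2)"
    by auto
  let ?d = "2 * sqnorm (y j) + 2 * c"
  have "sqnorm (\<lambda>b. \<Sum>i\<in>insert j J. a i * y i b) \<le> ?d * (\<Sum>i\<in>insert j J. (cmod (a i))\<^sup>2)" for a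
  proof -
    have yj: "l2 (\<lambda>b. a j * y j b)" by (rule sqnorm_scale) (use insert in auto)
    have "l2 (\<lambda>b. \<Sum>i\<in>J. a i * y i b)"
      by (rule l2_inner_sum_right(1)[of J "\<lambda>b. 0"]) (use insert in \<open>simp_all add: sqnorm_scale l2_def[of "\<lambda>b. 0"]\<close>)
    then have "sqnorm (\<lambda>b. a j * y j b + (\<Sum>i\<in>J. a i * y i b))
        \<le> 2 * sqnorm (\<lambda>b. a j * y j b) + 2 * sqnorm (\<lambda>b. \<Sum>i\<in>J. a i * y i b)"
      by (rule l2_add(2)[OF yj])
    also have "\<dots> \<le> 2 * ((cmod (a j))\<^sup>2 * sqnorm (y j)) + 2 * (c * (\<Sum>i\<in>J. (cmod (a i))\<^sup>2))"
      using c(2)[of a] by (simp add: sqnorm_scale)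
    also have "\<dots> \<le> ?d * ((cmod (a j))\<^sup>2 + (\<Sum>i\<in>J. (cmod (a i))\<^sup>2))"
    proof -
      have "0 \<le> c * (cmod (a j))\<^sup>2" "0 \<le> sqnorm (y j) * (\<Sum>i\<in>J. (cmod (a i))\<^sup>2)"
        using c(1) by (auto intro!: mult_nonneg_nonneg sum_nonneg sqnorm_nonneg)
      then show ?thesis by (simp add: algebra_simps)
    qed
    finally show ?thesis using insert by simp
  qed
  moreover have "0 \<le> ?d" using c(1) sqnorm_nonneg[of "y j"] by simp
  ultimately show ?case by blast
qed

text \<open>
  The columns of \<open>A\<close> lie in the range of \<open>E\<close>, have the same constant terms as the columns of \<open>E\<close>, and are
  orthogonal to the elements of that range without constant term. The predicate \<open>fixed\<close> below says that
  the matrix of constant terms of \<open>E\<close> fixes every coefficient vector of \<open>g\<close>. For such \<open>g\<close>, \<open>A g\<close> is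
  the sum of \<open>leading g\<close>, a combination of wandering vectors, and of \<open>rest g\<close>, which has no constant
  term.
\<close>

locale wandering_frame =
  fixes n :: nat and E A :: "'a nc_series mat"
  assumes E: "E \<in> carrier_mat n n" and A: "A \<in> carrier_mat n n" and EA: "E * A = A"
    and A0: "\<And>i j. i < n \<Longrightarrow> j < n \<Longrightarrow> nc_coeff (A $$ (i,j)) [] = nc_coeff (E $$ (i,j)) []"
    and l2_col: "\<And>j. j < n \<Longrightarrow> l2 (cof (col A j))"
    and orth: "\<And>j y. j < n \<Longrightarrow> y \<in> carrier_vec n \<Longrightarrow> E *\<^sub>v y = y \<Longrightarrow> (\<And>i. i < n \<Longrightarrow> nc_coeff (y $ i) [] = 0)
      \<Longrightarrow> l2 (cof y) \<Longrightarrow> l2_inner (cof y) (cof (col A j)) = 0"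
begin

definition fixed :: "'a nc_series vec \<Rightarrow> bool" where
  "fixed g \<longleftrightarrow> g \<in> carrier_vec n \<and>
     (\<forall>i<n. \<forall>w. (\<Sum>l<n. nc_coeff (E $$ (i,l)) [] * nc_coeff (g $ l) w) = nc_coeff (g $ i) w)"

definition leading :: "'a nc_series vec \<Rightarrow> 'a nc_series vec" where
  "leading g = A *\<^sub>v map_vec (\<lambda>f. nc_const (nc_coeff f [])) g"

definition rest :: "'a nc_series vec \<Rightarrow> 'a nc_series vec" where
  "rest g = A *\<^sub>v (g - map_vec (\<lambda>f. nc_const (nc_coeff f [])) g)"

lemma fixed_carrier: "fixed g \<Longrightarrow> g \<in> carrier_vec n" by (simp add: fixed_def)

lemma fixed_strip: "fixed g \<Longrightarrow> fixed (strip k g)"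
  by (auto simp: fixed_def strip_carrier coeff_strip[where n = n])

lemma leading_carrier: "g \<in> carrier_vec n \<Longrightarrow> leading g \<in> carrier_vec n"
  unfolding leading_def by (intro mult_mat_vec_carrier[OF A]) simp

lemma rest_carrier: "g \<in> carrier_vec n \<Longrightarrow> rest g \<in> carrier_vec n"
  unfolding rest_def by (intro mult_mat_vec_carrier[OF A]) simp

lemma A_split:
  assumes "g \<in> carrier_vec n"
  shows "A *\<^sub>v g = leading g + rest g"
proof -
  let ?c = "map_vec (\<lambda>f. nc_const (nc_coeff f [])) g"
  have c: "?c \<in> carrier_vec n" using assms by simp
  have "g = ?c + (g - ?c)" using assms by auto
  then have "A *\<^sub>v g = A *\<^sub>v (?c + (g - ?c))" by simp
  also have "\<dots> = leading g + rest g"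
    unfolding leading_def rest_def by (rule mult_add_distrib_mat_vec[OF A c]) (use assms in simp)
  finally show ?thesis .
qed

lemma cof_leading:
  assumes g: "g \<in> carrier_vec n"
  shows "cof (leading g) = (\<lambda>p. \<Sum>j<n. nc_coeff (g $ j) [] * cof (col A j) p)"
proof (rule ext)
  fix p :: "nat \<times> 'a list" obtain i w where p: "p = (i,w)" by (cases p)
  let ?c = "map_vec (\<lambda>f. nc_const (nc_coeff f [])) g"
  show "cof (leading g) p = (\<Sum>j<n. nc_coeff (g $ j) [] * cof (col A j) p)"
  proof (cases "i < n")
    case True
    have "leading g $ i = (\<Sum>j<n. A $$ (i,j) * ?c $ j)"
      unfolding leading_def by (rule mult_mat_vec_index_sum[OF A _ True]) (use g in simp)
    also have "\<dots> = (\<Sum>j<n. A $$ (i,j) * nc_const (nc_coeff (g $ j) []))"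
      using g by (intro sum.cong) auto
    finally have "nc_coeff (leading g $ i) w = (\<Sum>j<n. nc_coeff (g $ j) [] * nc_coeff (A $$ (i,j)) w)"
      by (simp add: nc_coeff_sum coeff_mult_const_right)
    then show ?thesis
      using True A leading_carrier[OF g] by (simp add: p cof_def)
  next
    case False
    then show ?thesis using A leading_carrier[OF g] by (simp add: p cof_def)
  qed
qed

lemma l2_leading:
  assumes g: "g \<in> carrier_vec n"
  shows "l2 (cof (leading g))"
  unfolding cof_leading[OF g]
  by (rule l2_inner_sum_right(1)[of _ "\<lambda>b. 0"]) (auto intro: sqnorm_scale l2_col simp: l2_def[of "\<lambda>b. 0"])

lemma rest_fixed_by_E: "g \<in> carrier_vec n \<Longrightarrow> E *\<^sub>v rest g = rest g"
  unfolding rest_def using assoc_mult_mat_vec[OF E A] EA by simp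

lemma rest_coeff_Nil:
  assumes g: "g \<in> carrier_vec n" and i: "i < n"
  shows "nc_coeff (rest g $ i) [] = 0"
proof -
  have c: "g - map_vec (\<lambda>f. nc_const (nc_coeff f [])) g \<in> carrier_vec n" using g by simp
  show ?thesis
    unfolding rest_def coeff_mult_mat_vec[OF A c i] using g by (simp add: nc_const_def)
qed

text \<open>
  The remainder splits, by last letters, into elements of the form \<open>A g'\<close> again, where \<open>g'\<close> has its
  words shortened by one letter. Both estimates below are inductions along this fact.
\<close>

lemma strip_rest:
  assumes g: "g \<in> carrier_vec n"
  shows "strip k (rest g) = A *\<^sub>v strip k g"
proof -
  let ?d = "g - map_vec (\<lambda>f. nc_const (nc_coeff f [])) g"
  have d: "?d \<in> carrier_vec n" using g by simp
  have "strip k (rest g) = A *\<^sub>v strip k ?d"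
    unfolding rest_def by (rule strip_mult_mat_vec[OF A d]) (use g in \<open>simp add: nc_const_def\<close>)
  also have "strip k ?d = strip k g"
    by (rule vec_series_eqI[OF strip_carrier[OF d] strip_carrier[OF g]])
       (use g in \<open>simp only: coeff_strip[OF d] coeff_strip[OF g], simp add: nc_const_def\<close>)
  finally show ?thesis .
qed

lemma pythagoras:
  assumes g: "g \<in> carrier_vec n" and l2: "l2 (cof (rest g))"
  shows "l2 (cof (A *\<^sub>v g))" "sqnorm (cof (A *\<^sub>v g)) = sqnorm (cof (leading g)) + sqnorm (cof (rest g))"
proof -
  have eq: "cof (A *\<^sub>v g) = (\<lambda>p. cof (rest g) p + cof (leading g) p)"
    unfolding A_split[OF g] cof_add[OF leading_carrier[OF g] rest_carrier[OF g]] by (simp add: add.commute)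
  have zero: "l2_inner (cof (rest g)) (cof (col A j)) = 0" if "j < n" for j
    by (intro orth that rest_carrier g rest_fixed_by_E rest_coeff_Nil l2)
  have l2c: "l2 (\<lambda>p. nc_coeff (g $ j) [] * cof (col A j) p)" if "j < n" for j
    by (rule sqnorm_scale(1)[OF l2_col[OF that]])
  have "l2_inner (cof (rest g)) (cof (leading g))
      = (\<Sum>j<n. l2_inner (cof (rest g)) (\<lambda>p. nc_coeff (g $ j) [] * cof (col A j) p))"
    unfolding cof_leading[OF g] by (rule l2_inner_sum_right(2)[OF _ l2]) (use l2c in auto)
  also have "\<dots> = 0" by (intro sum.neutral) (simp add: l2_inner_scale_right zero)
  finally have "l2_inner (cof (rest g)) (cof (leading g)) = 0" .
  then show "sqnorm (cof (A *\<^sub>v g)) = sqnorm (cof (leading g)) + sqnorm (cof (rest g))"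
    unfolding eq using sqnorm_add[OF l2 l2_leading[OF g]] by simp
  show "l2 (cof (A *\<^sub>v g))" unfolding eq by (rule l2_add(1)[OF l2 l2_leading[OF g]])
qed

lemma leading_coeff_Nil:
  assumes g: "fixed g" and i: "i < n"
  shows "nc_coeff (leading g $ i) [] = nc_coeff (g $ i) []"
proof -
  have carrier: "map_vec (\<lambda>f. nc_const (nc_coeff f [])) g \<in> carrier_vec n" using fixed_carrier[OF g] by simp
  have "nc_coeff (leading g $ i) [] = (\<Sum>l<n. nc_coeff (E $$ (i,l)) [] * nc_coeff (g $ l) [])"
    unfolding leading_def coeff_mult_mat_vec[OF A carrier i]
    using fixed_carrier[OF g] i by (intro sum.cong) (auto simp: A0 nc_const_def)
  then show ?thesis using g i by (simp add: fixed_def)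
qed

lemma constant_le_leading:
  assumes g: "fixed g"
  shows "(\<Sum>i<n. (cmod (nc_coeff (g $ i) []))\<^sup>2) \<le> sqnorm (cof (leading g))"
  using sum_le_sqnorm_cof[OF leading_carrier[OF fixed_carrier[OF g]] l2_leading[OF fixed_carrier[OF g]], of "{[]}"]
  by (simp add: leading_coeff_Nil[OF g])

text \<open>
  Nothing is lost in the induction, since the Pythagorean identity separates the constant term from
  the remainder, and the components \<open>strip k (rest g)\<close> are orthogonal to each other.
\<close>

lemma partial_lower_bound:
  assumes F: "finite F"
  shows "fixed g \<Longrightarrow> l2 (cof (A *\<^sub>v g)) \<Longrightarrow>
    (\<Sum>i<n. \<Sum>w\<in>short_words F N. (cmod (nc_coeff (g $ i) w))\<^sup>2) \<le> sqnorm (cof (A *\<^sub>v g))"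
proof (induction N arbitrary: g)
  case (0 g)
  note c = fixed_carrier[OF \<open>fixed g\<close>]
  have "l2 (\<lambda>p. cof (A *\<^sub>v g) p - cof (leading g) p)" by (rule l2_diff[OF 0(2) l2_leading[OF c]])
  then have rest: "l2 (cof (rest g))"
    unfolding A_split[OF c] cof_add[OF leading_carrier[OF c] rest_carrier[OF c]] by simp
  have "short_words F 0 = {[]}" by (auto simp: short_words_def)
  then show ?case
    using constant_le_leading[OF \<open>fixed g\<close>] pythagoras(2)[OF c rest] sqnorm_nonneg[of "cof (rest g)"] by simp
next
  case (Suc N g)
  note c = fixed_carrier[OF \<open>fixed g\<close>]
  have "l2 (\<lambda>p. cof (A *\<^sub>v g) p - cof (leading g) p)" by (rule l2_diff[OF Suc.prems(2) l2_leading[OF c]])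
  then have rest: "l2 (cof (rest g))"
    unfolding A_split[OF c] cof_add[OF leading_carrier[OF c] rest_carrier[OF c]] by simp
  have l2s: "l2 (cof (A *\<^sub>v strip k g))" for k
    using sum_strip_le(1)[OF rest_carrier[OF c] rest, of k] by (simp only: strip_rest[OF c])
  have "(\<Sum>i<n. \<Sum>w\<in>short_words F (Suc N). (cmod (nc_coeff (g $ i) w))\<^sup>2)
      = (\<Sum>i<n. (cmod (nc_coeff (g $ i) []))\<^sup>2)
        + (\<Sum>i<n. \<Sum>k\<in>F. \<Sum>u\<in>short_words F N. (cmod (nc_coeff (strip k g $ i) u))\<^sup>2)"
    by (simp add: sum_short_words_Suc[OF F] sum.distrib coeff_strip[OF c])
  also have "(\<Sum>i<n. \<Sum>k\<in>F. \<Sum>u\<in>short_words F N. (cmod (nc_coeff (strip k g $ i) u))\<^sup>2)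
      = (\<Sum>k\<in>F. \<Sum>i<n. \<Sum>u\<in>short_words F N. (cmod (nc_coeff (strip k g $ i) u))\<^sup>2)"
    by (rule sum.swap)
  also have "\<dots> \<le> (\<Sum>k\<in>F. sqnorm (cof (A *\<^sub>v strip k g)))"
    by (intro sum_mono Suc.IH fixed_strip Suc.prems l2s)
  also have "\<dots> \<le> sqnorm (cof (rest g))"
    using sum_strip_le(2)[OF rest_carrier[OF c] rest F] by (simp only: strip_rest[OF c])
  finally show ?case
    using constant_le_leading[OF \<open>fixed g\<close>] pythagoras(2)[OF c rest] by linarith
qed

lemma short_words_cover:
  assumes "finite W"
  obtains F N where "finite F" "W \<subseteq> short_words F N"
proof -
  have "length w \<le> Max (insert 0 (length ` W))" if "w \<in> W" for w using assms that by simp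
  then have "W \<subseteq> short_words (\<Union> (set ` W)) (Max (insert 0 (length ` W)))"
    by (force simp: short_words_def)
  then show ?thesis using that[of "\<Union> (set ` W)"] assms by simp
qed

lemma lower_bound:
  assumes g: "fixed g" and l2: "l2 (cof (A *\<^sub>v g))"
  shows "l2 (cof g)" "sqnorm (cof g) \<le> sqnorm (cof (A *\<^sub>v g))"
proof -
  have bound: "(\<Sum>i<n. \<Sum>w\<in>W. (cmod (nc_coeff (g $ i) w))\<^sup>2) \<le> sqnorm (cof (A *\<^sub>v g))" if W: "finite W" for W
  proof -
    obtain F N where F: "finite F" and sub: "W \<subseteq> short_words F N" using short_words_cover[OF W] .
    have "(\<Sum>i<n. \<Sum>w\<in>W. (cmod (nc_coeff (g $ i) w))\<^sup>2)
        \<le> (\<Sum>i<n. \<Sum>w\<in>short_words F N. (cmod (nc_coeff (g $ i) w))\<^sup>2)"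
      by (intro sum_mono sum_mono2 finite_short_words F sub) simp
    also have "\<dots> \<le> sqnorm (cof (A *\<^sub>v g))" by (rule partial_lower_bound[OF F g l2])
    finally show ?thesis .
  qed
  show "l2 (cof g)" "sqnorm (cof g) \<le> sqnorm (cof (A *\<^sub>v g))"
    using cof_sum_bound[OF fixed_carrier[OF g] bound] by blast+
qed

lemma mult_mat_vec_coeff_zero:
  assumes g: "g \<in> carrier_vec n" and "\<And>i w. i < n \<Longrightarrow> nc_coeff (g $ i) w = 0" and i: "i < n"
  shows "nc_coeff ((A *\<^sub>v g) $ i) w = 0"
  unfolding coeff_mult_mat_vec[OF A g i] using assms(2) by simp

text \<open>
  The constant that works for constant columns works for all, because the induction proceeds along
  orthogonal decompositions.
\<close>

lemma upper_bound_finite_support: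
  assumes F: "finite F" and c0: "0 \<le> c"
    and c: "\<And>g. g \<in> carrier_vec n \<Longrightarrow> sqnorm (cof (leading g)) \<le> c * (\<Sum>i<n. (cmod (nc_coeff (g $ i) []))\<^sup>2)"
  shows "fixed g \<Longrightarrow> (\<And>i w. i < n \<Longrightarrow> w \<notin> short_words F N \<Longrightarrow> nc_coeff (g $ i) w = 0) \<Longrightarrow>
    l2 (cof (A *\<^sub>v g)) \<and>
    sqnorm (cof (A *\<^sub>v g)) \<le> c * (\<Sum>i<n. \<Sum>w\<in>short_words F N. (cmod (nc_coeff (g $ i) w))\<^sup>2)"
proof (induction N arbitrary: g)
  case (0 g)
  note carrier = fixed_carrier[OF \<open>fixed g\<close>]
  have "nc_coeff (strip k (rest g) $ i) w = 0" if "i < n" for k i w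
    unfolding strip_rest[OF carrier]
    by (rule mult_mat_vec_coeff_zero[OF strip_carrier[OF carrier] _ that])
       (simp add: coeff_strip[OF carrier] 0(2) short_words_def)
  then have rest: "l2 (cof (rest g))" "sqnorm (cof (rest g)) = 0"
    using sqnorm_eq_sum_strip[OF rest_carrier[OF carrier] rest_coeff_Nil[OF carrier], of "{}"] by simp_all
  have "short_words F 0 = {[]}" by (auto simp: short_words_def)
  then show ?case
    using c[OF carrier] pythagoras[OF carrier rest(1)] rest(2) by simp
next
  case (Suc N g)
  note carrier = fixed_carrier[OF \<open>fixed g\<close>]
  have IH: "l2 (cof (A *\<^sub>v strip k g))"
    "sqnorm (cof (A *\<^sub>v strip k g)) \<le> c * (\<Sum>i<n. \<Sum>w\<in>short_words F N. (cmod (nc_coeff (strip k g $ i) w))\<^sup>2)"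
    if k: "k \<in> F" for k
  proof -
    have supp: "nc_coeff (strip k g $ i) w = 0" if "i < n" "w \<notin> short_words F N" for i w
      unfolding coeff_strip[OF carrier that(1)]
      by (rule Suc.prems(2)[OF that(1)]) (use that k in \<open>auto simp: short_words_def\<close>)
    show "l2 (cof (A *\<^sub>v strip k g))"
      "sqnorm (cof (A *\<^sub>v strip k g)) \<le> c * (\<Sum>i<n. \<Sum>w\<in>short_words F N. (cmod (nc_coeff (strip k g $ i) w))\<^sup>2)"
      using Suc.IH[OF fixed_strip[OF \<open>fixed g\<close>] supp] by simp_all
  qed
  have zero: "nc_coeff (strip k (rest g) $ i) w = 0" if "k \<notin> F" "i < n" for k i w
    unfolding strip_rest[OF carrier]
    by (rule mult_mat_vec_coeff_zero[OF strip_carrier[OF carrier] _ that(2)])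
       (use that in \<open>simp add: coeff_strip[OF carrier] Suc.prems(2) short_words_def\<close>)
  have l2s: "l2 (cof (strip k (rest g)))" if "k \<in> F" for k
    unfolding strip_rest[OF carrier] by (rule IH(1)[OF that])
  have rest: "l2 (cof (rest g))" "sqnorm (cof (rest g)) = (\<Sum>k\<in>F. sqnorm (cof (strip k (rest g))))"
    by (rule sqnorm_eq_sum_strip[OF rest_carrier[OF carrier] _ F],
        erule rest_coeff_Nil[OF carrier], erule l2s, erule zero, assumption)+
  have "sqnorm (cof (A *\<^sub>v g)) = sqnorm (cof (leading g)) + sqnorm (cof (rest g))"
    by (rule pythagoras(2)[OF carrier rest(1)])
  also have "\<dots> \<le> c * (\<Sum>i<n. (cmod (nc_coeff (g $ i) []))\<^sup>2)
      + (\<Sum>k\<in>F. c * (\<Sum>i<n. \<Sum>w\<in>short_words F N. (cmod (nc_coeff (strip k g $ i) w))\<^sup>2))"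
  proof (rule add_mono[OF c[OF carrier]])
    have "sqnorm (cof (rest g)) = (\<Sum>k\<in>F. sqnorm (cof (A *\<^sub>v strip k g)))"
      using rest(2) by (simp only: strip_rest[OF carrier])
    also have "\<dots> \<le> (\<Sum>k\<in>F. c * (\<Sum>i<n. \<Sum>w\<in>short_words F N. (cmod (nc_coeff (strip k g $ i) w))\<^sup>2))"
      by (rule sum_mono) (rule IH(2))
    finally show "sqnorm (cof (rest g))
        \<le> (\<Sum>k\<in>F. c * (\<Sum>i<n. \<Sum>w\<in>short_words F N. (cmod (nc_coeff (strip k g $ i) w))\<^sup>2))" .
  qed
  also have "\<dots> = c * ((\<Sum>i<n. (cmod (nc_coeff (g $ i) []))\<^sup>2)
      + (\<Sum>i<n. \<Sum>k\<in>F. \<Sum>w\<in>short_words F N. (cmod (nc_coeff (strip k g $ i) w))\<^sup>2))"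
    unfolding sum.swap[of _ F "{..<n}"] by (simp only: sum_distrib_left distrib_left)
  also have "\<dots> = c * (\<Sum>i<n. \<Sum>w\<in>short_words F (Suc N). (cmod (nc_coeff (g $ i) w))\<^sup>2)"
    by (simp add: sum_short_words_Suc[OF F] sum.distrib coeff_strip[OF carrier])
  finally show ?case using pythagoras(1)[OF carrier rest(1)] by simp
qed

text \<open>
  The coefficient of \<open>A g\<close> at a word depends only on those of \<open>g\<close> at its suffixes, so each partial sum
  of the norm of \<open>A g\<close> is also one for a truncation of \<open>g\<close> to finitely many words.
\<close>

lemma upper_bound:
  "\<exists>c\<ge>0. \<forall>g. fixed g \<longrightarrow> l2 (cof g) \<longrightarrow> l2 (cof (A *\<^sub>v g)) \<and> sqnorm (cof (A *\<^sub>v g)) \<le> c * sqnorm (cof g)"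
proof -
  obtain c where c0: "0 \<le> c" and c: "\<And>a. sqnorm (\<lambda>p. \<Sum>j<n. a j * cof (col A j) p) \<le> c * (\<Sum>j<n. (cmod (a j))\<^sup>2)"
    using sqnorm_combination_bound[of "{..<n}" "\<lambda>j. cof (col A j)"] l2_col by auto
  have lead: "sqnorm (cof (leading g)) \<le> c * (\<Sum>i<n. (cmod (nc_coeff (g $ i) []))\<^sup>2)" if "g \<in> carrier_vec n" for g
    unfolding cof_leading[OF that] by (rule c)
  have bound: "(\<Sum>i<n. \<Sum>w\<in>W. (cmod (nc_coeff ((A *\<^sub>v g) $ i) w))\<^sup>2) \<le> c * sqnorm (cof g)"
    if g: "fixed g" and l2: "l2 (cof g)" and W: "finite W" for g W
  proof -
    note carrier = fixed_carrier[OF g]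
    obtain F N where F: "finite F" and sub: "W \<subseteq> short_words F N" using short_words_cover[OF W] .
    let ?W = "short_words F N"
    define t where "t = vec n (\<lambda>i. Nc_series (\<lambda>w. if w \<in> ?W then nc_coeff (g $ i) w else 0))"
    have t: "t \<in> carrier_vec n" by (simp add: t_def)
    have t_coeff: "nc_coeff (t $ i) w = (if w \<in> ?W then nc_coeff (g $ i) w else 0)" if "i < n" for i w
      using that by (simp add: t_def)
    have fixed_t: "fixed t" using g t by (simp add: fixed_def t_coeff)
    have At: "nc_coeff ((A *\<^sub>v t) $ i) w = nc_coeff ((A *\<^sub>v g) $ i) w" if i: "i < n" and w: "w \<in> ?W" for i w
      unfolding coeff_mult_mat_vec[OF A t i] coeff_mult_mat_vec[OF A carrier i]
    proof (intro sum.cong refl)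
      fix l k assume "l \<in> {..<n}"
      moreover have "drop k w \<in> ?W" using w by (auto simp: short_words_def dest: in_set_dropD)
      ultimately show "nc_coeff (A $$ (i,l)) (take k w) * nc_coeff (t $ l) (drop k w)
          = nc_coeff (A $$ (i,l)) (take k w) * nc_coeff (g $ l) (drop k w)" by (simp add: t_coeff)
    qed
    have supp: "nc_coeff (t $ i) w = 0" if "i < n" "w \<notin> ?W" for i w using that by (simp add: t_coeff)
    note up = upper_bound_finite_support[OF F c0 lead fixed_t supp]
    have "(\<Sum>i<n. \<Sum>w\<in>W. (cmod (nc_coeff ((A *\<^sub>v g) $ i) w))\<^sup>2)
        \<le> (\<Sum>i<n. \<Sum>w\<in>?W. (cmod (nc_coeff ((A *\<^sub>v g) $ i) w))\<^sup>2)"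
      by (intro sum_mono sum_mono2 finite_short_words F sub) simp
    also have "\<dots> = (\<Sum>i<n. \<Sum>w\<in>?W. (cmod (nc_coeff ((A *\<^sub>v t) $ i) w))\<^sup>2)"
      by (intro sum.cong refl) (simp add: At del: index_mult_mat_vec)
    also have "\<dots> \<le> sqnorm (cof (A *\<^sub>v t))"
      by (rule sum_le_sqnorm_cof[OF mult_mat_vec_carrier[OF A t] conjunct1[OF up] finite_short_words[OF F]])
    also have "\<dots> \<le> c * (\<Sum>i<n. \<Sum>w\<in>?W. (cmod (nc_coeff (t $ i) w))\<^sup>2)" by (rule conjunct2[OF up])
    also have "\<dots> = c * (\<Sum>i<n. \<Sum>w\<in>?W. (cmod (nc_coeff (g $ i) w))\<^sup>2)" by (simp add: t_coeff)
    also have "\<dots> \<le> c * sqnorm (cof g)"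
      by (intro mult_left_mono sum_le_sqnorm_cof carrier l2 finite_short_words F c0)
    finally show ?thesis .
  qed
  show ?thesis
  proof (intro exI[of _ c] conjI allI impI c0)
    fix g assume g: "fixed g" and l2: "l2 (cof g)"
    show "l2 (cof (A *\<^sub>v g))"
      by (rule cof_sum_bound(1)[OF mult_mat_vec_carrier[OF A fixed_carrier[OF g]] bound[OF g l2]])
    show "sqnorm (cof (A *\<^sub>v g)) \<le> c * sqnorm (cof g)"
      by (rule cof_sum_bound(2)[OF mult_mat_vec_carrier[OF A fixed_carrier[OF g]] bound[OF g l2]])
  qed
qed

end

text \<open>
  The range elements without constant term are cut out by equations of which each involves finitely
  many coefficients; they form a set closed under pointwise limits. Column \<open>j\<close> of \<open>A\<close> is the element
  of least norm in the coset of the \<open>j\<close>-th column of \<open>E\<close>.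
\<close>

lemma wandering_frame_exists:
  fixes E :: "'a nc_series mat"
  assumes E: "E \<in> carrier_mat n n" and idem: "E * E = E"
    and l2E: "\<And>j. j < n \<Longrightarrow> l2 (cof (col E j))"
  obtains A where "wandering_frame n E A"
proof -
  define M where "M = {y \<in> carrier_vec n. E *\<^sub>v y = y \<and> (\<forall>i<n. nc_coeff (y $ i) [] = 0)}"
  define V where "V = cof ` M"
  have mem_M: "y \<in> M \<longleftrightarrow> y \<in> carrier_vec n \<and> E *\<^sub>v y = y \<and> (\<forall>i<n. nc_coeff (y $ i) [] = 0)" for y
    by (simp add: M_def)
  have V_iff: "x \<in> V \<longleftrightarrow> (\<forall>i w. \<not> i < n \<longrightarrow> x (i,w) = 0) \<and> (\<forall>i<n. x (i,[]) = 0) \<and>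
      (\<forall>i<n. \<forall>w. (\<Sum>l<n. \<Sum>k\<le>length w. nc_coeff (E $$ (i,l)) (take k w) * x (l, drop k w)) = x (i,w))"
    for x :: "nat \<times> 'a list \<Rightarrow> complex"
  proof
    assume "x \<in> V"
    then obtain y where y: "y \<in> M" "x = cof y" by (auto simp: V_def)
    then have c: "y \<in> carrier_vec n" and Ey: "E *\<^sub>v y = y" and y0: "\<And>i. i < n \<Longrightarrow> nc_coeff (y $ i) [] = 0"
      by (simp_all add: mem_M)
    have "(\<Sum>l<n. \<Sum>k\<le>length w. nc_coeff (E $$ (i,l)) (take k w) * x (l, drop k w)) = x (i,w)" if "i < n" for i w
      using coeff_mult_mat_vec[OF E c that, of w] c that by (simp add: Ey y(2) cof_def del: index_mult_mat_vec)
    then show "(\<forall>i w. \<not> i < n \<longrightarrow> x (i,w) = 0) \<and> (\<forall>i<n. x (i,[]) = 0) \<and>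
      (\<forall>i<n. \<forall>w. (\<Sum>l<n. \<Sum>k\<le>length w. nc_coeff (E $$ (i,l)) (take k w) * x (l, drop k w)) = x (i,w))"
      using c y0 by (simp add: y(2) cof_def)
  next
    assume x: "(\<forall>i w. \<not> i < n \<longrightarrow> x (i,w) = 0) \<and> (\<forall>i<n. x (i,[]) = 0) \<and>
      (\<forall>i<n. \<forall>w. (\<Sum>l<n. \<Sum>k\<le>length w. nc_coeff (E $$ (i,l)) (take k w) * x (l, drop k w)) = x (i,w))"
    define y where "y = vec n (\<lambda>i. Nc_series (\<lambda>w. x (i,w)))"
    have c: "y \<in> carrier_vec n" by (simp add: y_def)
    have yc: "nc_coeff (y $ i) w = x (i,w)" if "i < n" for i w using that by (simp add: y_def)
    have "E *\<^sub>v y = y"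
    proof (rule vec_series_eqI[OF mult_mat_vec_carrier[OF E c] c])
      fix i w assume i: "i < n"
      show "nc_coeff ((E *\<^sub>v y) $ i) w = nc_coeff (y $ i) w"
        unfolding coeff_mult_mat_vec[OF E c i] using x i by (simp add: yc)
    qed
    moreover have "x = cof y"
    proof (rule ext)
      fix p :: "nat \<times> 'a list" show "x p = cof y p" using x c by (cases p) (simp add: cof_def yc)
    qed
    ultimately show "x \<in> V" using x c yc unfolding V_def by (intro image_eqI[of _ _ y]) (simp_all add: mem_M)
  qed
  have ex: "\<exists>a. a \<in> carrier_vec n \<and> E *\<^sub>v a = a \<and> (\<forall>i<n. nc_coeff (a $ i) [] = nc_coeff (E $$ (i,j)) []) \<and> l2 (cof a)
      \<and> (\<forall>y\<in>M. l2 (cof y) \<longrightarrow> l2_inner (cof y) (cof a) = 0)" if j: "j < n" for j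
  proof -
    have add: "(\<lambda>p. x p + y p) \<in> V" if "x \<in> V" "y \<in> V" for x y
      using that unfolding V_iff by (simp add: distrib_left sum.distrib)
    have scale: "(\<lambda>p. c * x p) \<in> V" if "x \<in> V" for c x
      using that unfolding V_iff by (simp add: mult.left_commute[of _ c] flip: sum_distrib_left)
    have closed: "x \<in> V" if f: "\<And>k. f k \<in> V" and lim: "\<And>p. (\<lambda>k. f k p) \<longlonglongrightarrow> x p" for f x
    proof -
      have 1: "x (i,w) = 0" if "\<not> i < n" for i w
        using lim[of "(i,w)"] f that unfolding V_iff by (simp add: LIMSEQ_const_iff)
      have 2: "x (i,[]) = 0" if "i < n" for i
        using lim[of "(i,[])"] f that unfolding V_iff by (simp add: LIMSEQ_const_iff)
      have 3: "(\<Sum>l<n. \<Sum>k\<le>length w. nc_coeff (E $$ (i,l)) (take k w) * x (l, drop k w)) = x (i,w)" if "i < n" for i w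
      proof (rule LIMSEQ_unique)
        show "(\<lambda>q. \<Sum>l<n. \<Sum>k\<le>length w. nc_coeff (E $$ (i,l)) (take k w) * f q (l, drop k w))
            \<longlonglongrightarrow> (\<Sum>l<n. \<Sum>k\<le>length w. nc_coeff (E $$ (i,l)) (take k w) * x (l, drop k w))"
          by (intro tendsto_intros lim)
        have "(\<Sum>l<n. \<Sum>k\<le>length w. nc_coeff (E $$ (i,l)) (take k w) * f q (l, drop k w)) = f q (i,w)" for q
          using f[of q] that unfolding V_iff by simp
        then show "(\<lambda>q. \<Sum>l<n. \<Sum>k\<le>length w. nc_coeff (E $$ (i,l)) (take k w) * f q (l, drop k w)) \<longlonglongrightarrow> x (i,w)"
          using lim[of "(i,w)"] by simp
      qed
      show ?thesis unfolding V_iff using 1 2 3 by blast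
    qed
    have zero: "(\<lambda>p. 0) \<in> V" unfolding V_iff by simp
    have "\<exists>x. l2 x \<and> (\<lambda>p. x p - cof (col E j) p) \<in> V \<and> (\<forall>y\<in>V. l2 y \<longrightarrow> l2_inner x y = 0)"
      by (rule norm_minimal_in_coset; fact add scale closed zero l2E[OF j])
    then obtain x where x: "l2 x" "(\<lambda>p. x p - cof (col E j) p) \<in> V"
      and orth: "\<forall>y\<in>V. l2 y \<longrightarrow> l2_inner x y = 0" by (elim exE conjE)
    obtain y where y: "y \<in> M" "(\<lambda>p. x p - cof (col E j) p) = cof y" using x(2) by (auto simp: V_def)
    have yc: "y \<in> carrier_vec n" and Ey: "E *\<^sub>v y = y" and y0: "\<And>i. i < n \<Longrightarrow> nc_coeff (y $ i) [] = 0"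
      using y(1) by (simp_all add: mem_M)
    have ec: "col E j \<in> carrier_vec n" using E by (simp add: carrier_vecI)
    have Ee: "E *\<^sub>v col E j = col E j" using col_mult2[OF E E j] idem by simp
    let ?a = "col E j + y"
    have "?a \<in> carrier_vec n" using ec yc by simp
    moreover have "E *\<^sub>v ?a = ?a" using mult_add_distrib_mat_vec[OF E ec yc] Ee Ey by simp
    moreover have "nc_coeff (?a $ i) [] = nc_coeff (E $$ (i,j)) []" if "i < n" for i
      using that E j ec yc y0[OF that] by simp
    moreover have xa: "cof ?a = x"
      unfolding cof_add[OF ec yc] y(2)[symmetric] by simp
    moreover have "l2_inner (cof z) x = 0" if "z \<in> M" "l2 (cof z)" for z
    proof -
      have "l2_inner x (cof z) = 0" using orth that by (simp add: V_def)
      moreover have "l2_inner (cof z) x = cnj (l2_inner x (cof z))"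
        by (simp add: l2_inner_def mult.commute flip: infsum_cnj)
      ultimately show ?thesis by simp
    qed
    ultimately show ?thesis using x(1) by (intro exI[of _ ?a]) simp
  qed
  then obtain a where a: "\<And>j. j < n \<Longrightarrow> a j \<in> carrier_vec n \<and> E *\<^sub>v a j = a j
      \<and> (\<forall>i<n. nc_coeff (a j $ i) [] = nc_coeff (E $$ (i,j)) []) \<and> l2 (cof (a j))
      \<and> (\<forall>y\<in>M. l2 (cof y) \<longrightarrow> l2_inner (cof y) (cof (a j)) = 0)"
    by (metis (no_types, lifting))
  define A where "A = mat n n (\<lambda>(i,j). a j $ i)"
  have A: "A \<in> carrier_mat n n" by (simp add: A_def)
  have colA: "col A j = a j" if "j < n" for j using a[OF that] that by (auto simp: A_def)
  have "wandering_frame n E A"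
  proof
    show "E * A = A"
    proof (rule mat_col_eqI)
      fix j assume "j < dim_col A"
      then have j: "j < n" using A by simp
      show "col (E * A) j = col A j" unfolding col_mult2[OF E A j] using colA[OF j] a[OF j] by simp
    qed (use E A in auto)
    fix j assume j: "j < n"
    show "l2 (cof (col A j))" using a[OF j] by (simp add: colA[OF j])
    show "nc_coeff (A $$ (i,j)) [] = nc_coeff (E $$ (i,j)) []" if "i < n" for i
      using a[OF j] that j by (simp add: A_def)
    show "l2_inner (cof y) (cof (col A j)) = 0"
      if "y \<in> carrier_vec n" "E *\<^sub>v y = y" "\<And>i. i < n \<Longrightarrow> nc_coeff (y $ i) [] = 0" "l2 (cof y)" for y
      using a[OF j] that by (simp add: colA[OF j] mem_M)
  qed (use E A in auto)
  then show ?thesis by (rule that)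
qed

section \<open>Constant idempotents\<close>

lemma mat_adjoint_carrier: "A \<in> carrier_mat n n \<Longrightarrow> mat_adjoint A \<in> carrier_mat n n"
  unfolding mat_adjoint_def by (rule carrier_matI) simp_all

lemma mat_adjoint_index: "A \<in> carrier_mat n n \<Longrightarrow> i < n \<Longrightarrow> j < n \<Longrightarrow> mat_adjoint A $$ (i,j) = conjugate (A $$ (j,i))"
  unfolding mat_adjoint_def by (simp add: mat_of_rows_index)

lemma mat_adjoint_mult:
  fixes A B :: "complex mat"
  assumes A: "A \<in> carrier_mat n n" and B: "B \<in> carrier_mat n n"
  shows "mat_adjoint (A * B) = mat_adjoint B * mat_adjoint A"
proof (rule eq_matI)
  note A' = mat_adjoint_carrier[OF A] and B' = mat_adjoint_carrier[OF B] and AB = mult_carrier_mat[OF A B]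
  show "dim_row (mat_adjoint (A * B)) = dim_row (mat_adjoint B * mat_adjoint A)"
    "dim_col (mat_adjoint (A * B)) = dim_col (mat_adjoint B * mat_adjoint A)"
    using carrier_matD[OF mat_adjoint_carrier[OF AB]] carrier_matD[OF mult_carrier_mat[OF B' A']] by simp_all
  fix i j assume "i < dim_row (mat_adjoint B * mat_adjoint A)" "j < dim_col (mat_adjoint B * mat_adjoint A)"
  then have ij: "i < n" "j < n" using carrier_matD[OF mult_carrier_mat[OF B' A']] by simp_all
  have "mat_adjoint (A * B) $$ (i,j) = cnj ((A * B) $$ (j,i))"
    by (simp add: mat_adjoint_index[OF AB ij])
  also have "\<dots> = cnj (\<Sum>l<n. A $$ (j,l) * B $$ (l,i))"
    using ij A B by (simp add: scalar_prod_def atLeast0LessThan)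
  also have "\<dots> = (\<Sum>l<n. mat_adjoint B $$ (i,l) * mat_adjoint A $$ (l,j))"
    unfolding cnj_sum by (intro sum.cong refl) (simp add: mat_adjoint_index[OF A] mat_adjoint_index[OF B] ij)
  also have "\<dots> = (mat_adjoint B * mat_adjoint A) $$ (i,j)"
    using ij A' B' by (simp add: scalar_prod_def atLeast0LessThan)
  finally show "mat_adjoint (A * B) $$ (i,j) = (mat_adjoint B * mat_adjoint A) $$ (i,j)" .
qed

lemma mat_adjoint_adjoint: "A \<in> carrier_mat n n \<Longrightarrow> mat_adjoint (mat_adjoint A) = (A :: complex mat)"
proof (rule eq_matI)
  assume A: "A \<in> carrier_mat n n"
  note A' = mat_adjoint_carrier[OF A]
  show "dim_row (mat_adjoint (mat_adjoint A)) = dim_row A" "dim_col (mat_adjoint (mat_adjoint A)) = dim_col A"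
    using carrier_matD[OF mat_adjoint_carrier[OF A']] carrier_matD[OF A] by simp_all
  fix i j assume "i < dim_row A" "j < dim_col A"
  then have "i < n" "j < n" using carrier_matD[OF A] by simp_all
  then show "mat_adjoint (mat_adjoint A) $$ (i,j) = A $$ (i,j)"
    by (simp add: mat_adjoint_index[OF A'] mat_adjoint_index[OF A])
qed

text \<open>
  The squared norm of \<open>p = A v\<close> is the inner product of \<open>v\<close> with \<open>A\<^sup>* p = 0\<close>.
\<close>

lemma zero_if_orthogonal_range:
  fixes A :: "complex mat"
  assumes A: "A \<in> carrier_mat n n" and v: "v \<in> carrier_vec n"
    and p: "p = A *\<^sub>v v" and "mat_adjoint A *\<^sub>v p = 0\<^sub>v n"
  shows "p = 0\<^sub>v n"
proof -
  note A' = mat_adjoint_carrier[OF A]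
  have pc: "p \<in> carrier_vec n" unfolding p by (rule mult_mat_vec_carrier[OF A v])
  have "of_real (\<Sum>i<n. (cmod (p $ i))\<^sup>2) = (\<Sum>i<n. cnj (p $ i) * p $ i)"
    unfolding of_real_sum by (intro sum.cong refl) (metis complex_norm_square mult.commute)
  also have "\<dots> = (\<Sum>i<n. \<Sum>j<n. cnj (p $ i) * (A $$ (i,j) * v $ j))"
    using A v pc unfolding sum_distrib_left[symmetric]
    by (intro sum.cong refl) (simp add: p scalar_prod_def atLeast0LessThan)
  also have "\<dots> = (\<Sum>j<n. \<Sum>i<n. cnj (p $ i) * (A $$ (i,j) * v $ j))" by (rule sum.swap)
  also have "\<dots> = (\<Sum>j<n. cnj ((mat_adjoint A *\<^sub>v p) $ j) * v $ j)"
  proof (intro sum.cong refl)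
    fix j assume "j \<in> {..<n}"
    then have j: "j < n" by simp
    have "(mat_adjoint A *\<^sub>v p) $ j = (\<Sum>i<n. cnj (A $$ (i,j)) * p $ i)"
      using A' pc j by (simp add: scalar_prod_def atLeast0LessThan mat_adjoint_index[OF A])
    then show "(\<Sum>i<n. cnj (p $ i) * (A $$ (i,j) * v $ j)) = cnj ((mat_adjoint A *\<^sub>v p) $ j) * v $ j"
      by (simp add: sum_distrib_left sum_distrib_right ac_simps)
  qed
  also have "\<dots> = 0" using assms(4) by simp
  finally have "(\<Sum>i<n. (cmod (p $ i))\<^sup>2) = 0" by (simp only: of_real_eq_0_iff)
  then have "p $ i = 0" if "i < n" for i using that by (subst (asm) sum_nonneg_eq_0_iff) auto
  then show ?thesis using pc by (intro eq_vecI) auto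
qed

lemma mat_add_minus_cancel:
  fixes A B :: "'a :: ab_group_add mat"
  assumes "A \<in> carrier_mat nr nc" "B \<in> carrier_mat nr nc"
  shows "A + B - A = B" "B + A - A = B" "A + (B - A) = B" "B - A + A = B"
  by (rule eq_matI, use assms in simp_all)+

text \<open>
  The orthogonal projection onto the range of \<open>E\<close> is \<open>P = E (E + E\<^sup>* - 1)\<^sup>-\<^sup>1\<close>. Since \<open>E\<close> and \<open>P\<close> have the
  same range, \<open>E P = P\<close> and \<open>P E = E\<close>; so \<open>N = E - P\<close> has square zero, and \<open>E = (1 - N) P (1 + N)\<close>.
\<close>

lemma idempotent_similar_to_orthogonal_projection:
  fixes E :: "complex mat"
  assumes E: "E \<in> carrier_mat n n" and idem: "E * E = E"
  obtains P T T' where "orthogonal_projection n P" "T \<in> carrier_mat n n" "T' \<in> carrier_mat n n"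
    "T' * T = 1\<^sub>m n" "T * T' = 1\<^sub>m n" "E = T' * P * T"
proof -
  define G where "G = mat_adjoint E"
  have G: "G \<in> carrier_mat n n" unfolding G_def by (rule mat_adjoint_carrier[OF E])
  have GG: "G * G = G" unfolding G_def mat_adjoint_mult[OF E E, symmetric] idem ..
  have adjG: "mat_adjoint G = E" unfolding G_def by (rule mat_adjoint_adjoint[OF E])
  define H where "H = E + G - 1\<^sub>m n"
  have H: "H \<in> carrier_mat n n" unfolding H_def by (rule minus_carrier_mat[OF one_carrier_mat])
  note EG = mult_carrier_mat[OF E G] and GE = mult_carrier_mat[OF G E]
  have EH: "E * H = E * G"
  proof -
    have "E * H = E * (E + G) - E * 1\<^sub>m n" unfolding H_def by (rule mult_minus_distrib_mat[OF _ add_carrier_mat[OF G] one_carrier_mat]) (fact E G)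
    also have "\<dots> = E + E * G - E" using E G by (simp add: mult_add_distrib_mat[OF E E G] idem)
    finally show ?thesis unfolding mat_add_minus_cancel(1)[OF E EG] .
  qed
  have HG: "H * G = E * G"
  proof -
    have "H * G = (E + G) * G - 1\<^sub>m n * G" unfolding H_def by (rule minus_mult_distrib_mat[OF add_carrier_mat[OF G] one_carrier_mat]) (fact E G)
    also have "\<dots> = E * G + G - G" using E G by (simp add: add_mult_distrib_mat[OF E G G] GG)
    finally show ?thesis unfolding mat_add_minus_cancel(2)[OF G EG] .
  qed
  have GH: "G * H = G * E"
  proof -
    have "G * H = G * (E + G) - G * 1\<^sub>m n" unfolding H_def by (rule mult_minus_distrib_mat[OF _ add_carrier_mat[OF G] one_carrier_mat]) (fact E G)
    also have "\<dots> = G * E + G - G" using E G by (simp add: mult_add_distrib_mat[OF G E G] GG)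
    finally show ?thesis unfolding mat_add_minus_cancel(2)[OF G GE] .
  qed
  have HE: "H * E = G * E"
  proof -
    have "H * E = (E + G) * E - 1\<^sub>m n * E" unfolding H_def by (rule minus_mult_distrib_mat[OF add_carrier_mat[OF G] one_carrier_mat]) (fact E G)
    also have "\<dots> = E + G * E - E" using E G by (simp add: add_mult_distrib_mat[OF E G E] idem)
    finally show ?thesis unfolding mat_add_minus_cancel(1)[OF E GE] .
  qed
  \<comment> \<open>If \<open>H v = 0\<close>, then \<open>E H = E E\<^sup>*\<close> and \<open>E\<^sup>* H = E\<^sup>* E\<close> force \<open>E v\<close> and \<open>E\<^sup>* v\<close>, hence \<open>v\<close>, to vanish.\<close>
  have "det H \<noteq> 0"
  proof
    assume "det H = 0"
    then obtain v where v: "v \<in> carrier_vec n" "v \<noteq> 0\<^sub>v n" "H *\<^sub>v v = 0\<^sub>v n"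
      using det_0_iff_vec_prod_zero[OF H] by blast
    define p q where "p = E *\<^sub>v v" and "q = G *\<^sub>v v"
    have p: "p \<in> carrier_vec n" and q: "q \<in> carrier_vec n"
      unfolding p_def q_def by (rule mult_mat_vec_carrier[OF E v(1)], rule mult_mat_vec_carrier[OF G v(1)])
    have zero_mult: "M *\<^sub>v 0\<^sub>v n = 0\<^sub>v n" if "M \<in> carrier_mat n n" for M :: "complex mat"
      by (rule eq_vecI) (use that in auto)
    have "(G * H) *\<^sub>v v = 0\<^sub>v n" using assoc_mult_mat_vec[OF G H v(1)] v(3) zero_mult[OF G] by simp
    then have Gp: "mat_adjoint E *\<^sub>v p = 0\<^sub>v n"
      unfolding GH p_def using assoc_mult_mat_vec[OF G E v(1)] by (simp add: G_def)
    have "(E * H) *\<^sub>v v = 0\<^sub>v n" using assoc_mult_mat_vec[OF E H v(1)] v(3) zero_mult[OF E] by simp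
    then have Eq: "mat_adjoint G *\<^sub>v q = 0\<^sub>v n"
      unfolding EH q_def adjG using assoc_mult_mat_vec[OF E G v(1)] by simp
    have p0: "p = 0\<^sub>v n" by (rule zero_if_orthogonal_range[OF E v(1) p_def Gp])
    have q0: "q = 0\<^sub>v n" by (rule zero_if_orthogonal_range[OF G v(1) q_def Eq])
    have "H *\<^sub>v v = (E + G) *\<^sub>v v - 1\<^sub>m n *\<^sub>v v"
      unfolding H_def by (rule minus_mult_distrib_mat_vec[OF add_carrier_mat[OF G] one_carrier_mat v(1)])
    also have "(E + G) *\<^sub>v v = p + q" unfolding p_def q_def by (rule add_mult_distrib_mat_vec[OF E G v(1)])
    finally have "0\<^sub>v n = - v" using v by (simp add: p0 q0)
    then have "v = 0\<^sub>v n" using v(1) by (metis uminus_uminus_vec uminus_zero_vec)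
    then show False using v(2) by contradiction
  qed
  then obtain K where K: "K \<in> carrier_mat n n" and KH: "K * H = 1\<^sub>m n" and HK: "H * K = 1\<^sub>m n"
    using det_non_zero_imp_unit[OF H, where b = "()"] unfolding Units_def ring_mat_def by auto
  have cancel: "K * X = Y * K" if X: "X \<in> carrier_mat n n" and Y: "Y \<in> carrier_mat n n" and XH: "X * H = H * Y" for X Y
  proof -
    have "K * X = (K * X) * (H * K)" using X K by (simp add: HK right_mult_one_mat[OF mult_carrier_mat[OF K X]])
    also have "\<dots> = (K * (X * H)) * K"
      using assoc_mult_mat[OF mult_carrier_mat[OF K X] H K] assoc_mult_mat[OF K X H] by simp
    also have "\<dots> = ((K * H) * Y) * K" unfolding XH using assoc_mult_mat[OF K H Y] by simp
    finally show ?thesis using Y by (simp add: KH)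
  qed
  have KE: "K * E = G * K" by (rule cancel[OF E G]) (simp add: EH HG)
  have KG: "K * G = E * K" by (rule cancel[OF G E]) (simp add: GH HE)
  define P where "P = E * K"
  have P: "P \<in> carrier_mat n n" unfolding P_def by (rule mult_carrier_mat[OF E K])
  have EGK: "E * (G * K) = E"
  proof -
    have "E * (G * K) = (E * H) * K" unfolding EH by (rule assoc_mult_mat[OF E G K, symmetric])
    also have "\<dots> = E * (H * K)" by (rule assoc_mult_mat[OF E H K])
    finally show ?thesis using E by (simp add: HK)
  qed
  have PE: "P * E = E" unfolding P_def assoc_mult_mat[OF E K E] KE by (rule EGK)
  have EP: "E * P = P" unfolding P_def assoc_mult_mat[OF E E K, symmetric] idem ..
  have PP: "P * P = P"
  proof -
    have "P * P = P * (E * K)" by (simp only: P_def)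
    also have "\<dots> = (P * E) * K" by (rule assoc_mult_mat[OF P E K, symmetric])
    finally show ?thesis unfolding PE P_def[symmetric] .
  qed
  have "mat_adjoint P = P"
  proof -
    have "mat_adjoint H = H"
    proof (rule eq_matI)
      fix i j assume "i < dim_row H" "j < dim_col H"
      then have ij: "i < n" "j < n" using H by auto
      then have H_index: "H $$ (k,l) = E $$ (k,l) + cnj (E $$ (l,k)) - (if k = l then 1 else 0)"
        if "k < n" "l < n" for k l
        using E G that by (simp add: H_def G_def mat_adjoint_index[OF E])
      show "mat_adjoint H $$ (i,j) = H $$ (i,j)"
        using ij by (simp add: mat_adjoint_index[OF H] H_index)
    qed (use H mat_adjoint_carrier[OF H] in auto)
    define K' where "K' = mat_adjoint K"
    have K': "K' \<in> carrier_mat n n" unfolding K'_def by (rule mat_adjoint_carrier[OF K])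
    have "mat_adjoint (H * K) = mat_adjoint (1\<^sub>m n)" by (simp only: HK)
    moreover have "mat_adjoint (1\<^sub>m n) = (1\<^sub>m n :: complex mat)"
      by (rule eq_matI) (use mat_adjoint_carrier[OF one_carrier_mat[of n]] in \<open>auto simp: mat_adjoint_index[OF one_carrier_mat]\<close>)
    ultimately have "K' * H = 1\<^sub>m n"
      using mat_adjoint_mult[OF H K] \<open>mat_adjoint H = H\<close> by (simp add: K'_def)
    then have "K = (K' * H) * K" using K by simp
    also have "\<dots> = K' * (H * K)" by (rule assoc_mult_mat[OF K' H K])
    finally have "K' = K" using K' by (simp add: HK)
    then have "mat_adjoint P = K * G" unfolding P_def mat_adjoint_mult[OF E K] by (simp add: K'_def G_def)
    then show ?thesis by (simp add: KG P_def)
  qed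
  then have proj: "orthogonal_projection n P" by (simp add: orthogonal_projection_def P PP)
  define N where "N = E - P"
  have N: "N \<in> carrier_mat n n" unfolding N_def by (rule minus_carrier_mat[OF P])
  have NP: "N * P = 0\<^sub>m n n" unfolding N_def minus_mult_distrib_mat[OF E P P] EP PP by (rule minus_r_inv_mat[OF P])
  have PN: "P * N = N" unfolding N_def mult_minus_distrib_mat[OF P E P] PE PP ..
  have EN: "E * N = N" unfolding N_def mult_minus_distrib_mat[OF E E P] idem EP ..
  have NN: "N * N = 0\<^sub>m n n"
  proof -
    have "N * N = E * N - P * N" by (subst (1) N_def) (rule minus_mult_distrib_mat[OF E P N])
    then show ?thesis unfolding EN PN by (simp add: minus_r_inv_mat[OF N])
  qed
  have minus_zero: "X - 0\<^sub>m n n = X" if "X \<in> carrier_mat n n" for X :: "complex mat"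
    by (rule eq_matI) (use that in simp_all)
  define T where "T = 1\<^sub>m n + N"
  define T' where "T' = 1\<^sub>m n - N"
  have T: "T \<in> carrier_mat n n" using N by (simp add: T_def)
  have T': "T' \<in> carrier_mat n n" unfolding T'_def by (rule minus_carrier_mat[OF N])
  have "T' * T = 1\<^sub>m n"
  proof -
    have "T' * T = 1\<^sub>m n * T - N * T" unfolding T'_def by (rule minus_mult_distrib_mat[OF one_carrier_mat N T])
    also have "N * T = N + N * N" unfolding T_def using N by (subst mult_add_distrib_mat[OF N one_carrier_mat N]) simp
    also have "\<dots> = N" using N by (simp add: NN)
    also have "1\<^sub>m n * T = T" by (rule left_mult_one_mat[OF T])
    also have "T - N = 1\<^sub>m n" unfolding T_def by (rule mat_add_minus_cancel(2)[OF N one_carrier_mat])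
    finally show ?thesis .
  qed
  moreover have "T * T' = 1\<^sub>m n"
  proof -
    have "T * T' = 1\<^sub>m n * T' + N * T'" unfolding T_def by (rule add_mult_distrib_mat[OF one_carrier_mat N T'])
    also have "N * T' = N - N * N" unfolding T'_def using N by (subst mult_minus_distrib_mat[OF N one_carrier_mat N]) simp
    also have "\<dots> = N" unfolding NN by (rule minus_zero[OF N])
    also have "1\<^sub>m n * T' = T'" by (rule left_mult_one_mat[OF T'])
    also have "T' + N = 1\<^sub>m n" unfolding T'_def by (rule mat_add_minus_cancel(4)[OF N one_carrier_mat])
    finally show ?thesis .
  qed
  moreover have "E = T' * P * T"
  proof -
    have "T' * P = 1\<^sub>m n * P - N * P" unfolding T'_def by (rule minus_mult_distrib_mat[OF one_carrier_mat N P])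
    then have "T' * P = P" unfolding NP left_mult_one_mat[OF P] minus_zero[OF P] .
    then have "T' * P * T = P + P * N" unfolding T_def using P by (simp add: mult_add_distrib_mat[OF P one_carrier_mat N])
    then show ?thesis unfolding PN unfolding N_def mat_add_minus_cancel(3)[OF P E] by (rule sym)
  qed
  ultimately show ?thesis using that[OF proj T T'] by blast
qed

section \<open>Similarity to a constant idempotent\<close>

lemma coeff_ampliation_mult_vec:
  assumes "P \<in> carrier_mat n n" "h \<in> carrier_vec n" "i < n"
  shows "nc_coeff ((ampliation P *\<^sub>v h) $ i) w = (\<Sum>l<n. P $$ (i,l) * nc_coeff (h $ l) w)"
  unfolding ampliation_acts_coefficientwise[OF assms]
  using assms by (simp add: scalar_prod_def atLeast0LessThan)

lemma const_part_carrier: "E \<in> carrier_mat n n \<Longrightarrow> const_part E \<in> carrier_mat n n"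
  by (simp add: const_part_def)

lemma const_part_index: "E \<in> carrier_mat n n \<Longrightarrow> i < n \<Longrightarrow> j < n \<Longrightarrow> const_part E $$ (i,j) = nc_coeff (E $$ (i,j)) []"
  by (simp add: const_part_def)

lemma const_part_mult:
  assumes A: "A \<in> carrier_mat n n" and B: "B \<in> carrier_mat n n"
  shows "const_part (A * B) = const_part A * const_part B"
proof (rule eq_matI)
  note AB = mult_carrier_mat[OF A B] and A0 = const_part_carrier[OF A] and B0 = const_part_carrier[OF B]
  fix i j assume "i < dim_row (const_part A * const_part B)" "j < dim_col (const_part A * const_part B)"
  then have ij: "i < n" "j < n" using carrier_matD[OF mult_carrier_mat[OF A0 B0]] by simp_all
  have "const_part (A * B) $$ (i,j) = (\<Sum>l<n. const_part A $$ (i,l) * const_part B $$ (l,j))"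
    unfolding const_part_index[OF AB ij] coeff_mult_mat[OF A B ij]
    by (intro sum.cong refl) (simp add: const_part_index[OF A] const_part_index[OF B] ij)
  then show "const_part (A * B) $$ (i,j) = (const_part A * const_part B) $$ (i,j)"
    using A0 B0 ij by (simp add: scalar_prod_def atLeast0LessThan)
qed (use A B in \<open>simp_all add: const_part_def\<close>)

lemma const_part_ampliation: "P \<in> carrier_mat n n \<Longrightarrow> const_part (ampliation P) = P"
  by (rule eq_matI) (auto simp: const_part_def ampliation_def nc_const_def)

lemma ampliation_carrier: "P \<in> carrier_mat n n \<Longrightarrow> ampliation P \<in> carrier_mat n n"
  by (simp add: ampliation_def)

lemma coeff_nc_const: "nc_coeff (nc_const c) w = (if w = [] then c else 0)"
  by (simp add: nc_const_def)

lemma nc_const_simps: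
  "nc_const 0 = 0" "nc_const 1 = 1" "nc_const (a + b) = nc_const a + nc_const b"
  "nc_const (a - b) = nc_const a - nc_const b" "nc_const (a * b) = nc_const a * nc_const b"
  by (rule nc_series_eqI; simp add: coeff_nc_const nc_coeff_const_mult one_nc_series.rep_eq)+

lemma nc_const_sum: "nc_const (\<Sum>i\<in>I. f i) = (\<Sum>i\<in>I. nc_const (f i))"
  by (induction I rule: infinite_finite_induct) (simp_all add: nc_const_simps)

lemma ampliation_mult:
  assumes P: "P \<in> carrier_mat n n" and Q: "Q \<in> carrier_mat n n"
  shows "ampliation (P * Q) = ampliation P * ampliation Q"
  by (rule eq_matI)
     (use P Q in \<open>simp_all add: ampliation_def scalar_prod_def nc_const_sum nc_const_simps\<close>)

lemma ampliation_one: "ampliation (1\<^sub>m n) = 1\<^sub>m n"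
  by (rule eq_matI) (simp_all add: ampliation_def nc_const_simps)

lemma ampliation_add:
  assumes "P \<in> carrier_mat n n" "Q \<in> carrier_mat n n"
  shows "ampliation (P + Q) = ampliation P + ampliation Q"
  by (rule eq_matI) (use assms in \<open>simp_all add: ampliation_def nc_const_simps\<close>)

context wandering_frame
begin

abbreviation Q :: "'a nc_series mat" where "Q \<equiv> ampliation (const_part E)"

lemma Q: "Q \<in> carrier_mat n n" by (rule ampliation_carrier[OF const_part_carrier[OF E]])

lemma fixed_projection:
  assumes idem: "E * E = E" and h: "h \<in> carrier_vec n"
  shows "fixed (Q *\<^sub>v h)"
  unfolding fixed_def
proof (intro conjI allI impI)
  note E0 = const_part_carrier[OF E]
  show Qh: "Q *\<^sub>v h \<in> carrier_vec n" by (rule mult_mat_vec_carrier[OF Q h])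
  fix i w assume i: "i < n"
  have "(\<Sum>l<n. nc_coeff (E $$ (i,l)) [] * nc_coeff ((Q *\<^sub>v h) $ l) w)
      = nc_coeff ((Q *\<^sub>v (Q *\<^sub>v h)) $ i) w"
    unfolding coeff_ampliation_mult_vec[OF E0 Qh i]
    by (intro sum.cong refl) (simp add: const_part_index[OF E] i)
  also have "Q *\<^sub>v (Q *\<^sub>v h) = (Q * Q) *\<^sub>v h" by (rule assoc_mult_mat_vec[OF Q Q h, symmetric])
  also have "Q * Q = Q" by (simp only: ampliation_mult[OF E0 E0, symmetric] const_part_mult[OF E E, symmetric] idem)
  finally show "(\<Sum>l<n. nc_coeff (E $$ (i,l)) [] * nc_coeff ((Q *\<^sub>v h) $ l) w) = nc_coeff ((Q *\<^sub>v h) $ i) w" .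
qed

lemma l2_bounded_Q: "l2_bounded n (\<lambda>h. cof (Q *\<^sub>v h))"
  using ampliation_in_Hinf_mat[OF const_part_carrier[OF E]] unfolding Hinf_mat_iff_l2_bounded by (rule conjunct2)

lemma l2_bounded_frame:
  assumes idem: "E * E = E"
  shows "l2_bounded n (\<lambda>h. cof (A *\<^sub>v (Q *\<^sub>v h)))"
proof -
  obtain c where c0: "0 \<le> c"
    and c: "\<forall>g. fixed g \<longrightarrow> l2 (cof g) \<longrightarrow> l2 (cof (A *\<^sub>v g)) \<and> sqnorm (cof (A *\<^sub>v g)) \<le> c * sqnorm (cof g)"
    using upper_bound by (elim exE conjE)
  obtain d where d: "\<forall>h\<in>carrier_vec n. l2 (cof h) \<longrightarrow> l2 (cof (Q *\<^sub>v h)) \<and> sqnorm (cof (Q *\<^sub>v h)) \<le> d * sqnorm (cof h)"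
    using l2_bounded_Q unfolding l2_bounded_def by (rule exE)
  show ?thesis
  proof (rule l2_boundedI)
    fix h :: "'a nc_series vec" assume h: "h \<in> carrier_vec n" "l2 (cof h)"
    note Qh = d[rule_format, OF h]
    note AQh = c[rule_format, OF fixed_projection[OF idem h(1)] conjunct1[OF Qh]]
    show "l2 (cof (A *\<^sub>v (Q *\<^sub>v h)))" by (rule conjunct1[OF AQh])
    have "sqnorm (cof (A *\<^sub>v (Q *\<^sub>v h))) \<le> c * sqnorm (cof (Q *\<^sub>v h))" by (rule conjunct2[OF AQh])
    also have "\<dots> \<le> c * (d * sqnorm (cof h))" by (rule mult_left_mono[OF conjunct2[OF Qh] c0])
    finally show "sqnorm (cof (A *\<^sub>v (Q *\<^sub>v h))) \<le> (c * d) * sqnorm (cof h)" by (simp only: mult.assoc)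
  qed
qed

text \<open>
  The lower bound for \<open>A\<close> turns the boundedness of \<open>E\<close> into that of the coordinates \<open>Q S h\<close> of \<open>E h\<close>
  in the frame.
\<close>

lemma l2_bounded_coordinates:
  assumes idem: "E * E = E" and S: "S \<in> carrier_mat n n"
    and factor: "E = A * (Q * S)" and bounded: "l2_bounded n (\<lambda>h. cof (E *\<^sub>v h))"
  shows "l2_bounded n (\<lambda>h. cof (Q *\<^sub>v (S *\<^sub>v h)))"
proof -
  obtain c where c: "\<forall>h\<in>carrier_vec n. l2 (cof h) \<longrightarrow> l2 (cof (E *\<^sub>v h)) \<and> sqnorm (cof (E *\<^sub>v h)) \<le> c * sqnorm (cof h)"
    using bounded unfolding l2_bounded_def by (rule exE)
  show ?thesis
  proof (rule l2_boundedI)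
    fix h :: "'a nc_series vec" assume h: "h \<in> carrier_vec n" "l2 (cof h)"
    note Sh = mult_mat_vec_carrier[OF S h(1)]
    note f = fixed_projection[OF idem Sh]
    have "E *\<^sub>v h = (A * (Q * S)) *\<^sub>v h" by (rule arg_cong[of _ _ "\<lambda>X. X *\<^sub>v h", OF factor])
    also have "\<dots> = A *\<^sub>v ((Q * S) *\<^sub>v h)" by (rule assoc_mult_mat_vec[OF A mult_carrier_mat[OF Q S] h(1)])
    also have "(Q * S) *\<^sub>v h = Q *\<^sub>v (S *\<^sub>v h)" by (rule assoc_mult_mat_vec[OF Q S h(1)])
    finally have eq: "E *\<^sub>v h = A *\<^sub>v (Q *\<^sub>v (S *\<^sub>v h))" .
    note Eh = c[rule_format, OF h, unfolded eq]
    note low = lower_bound[OF f conjunct1[OF Eh]]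
    show "l2 (cof (Q *\<^sub>v (S *\<^sub>v h)))" by (rule low(1))
    show "sqnorm (cof (Q *\<^sub>v (S *\<^sub>v h))) \<le> c * sqnorm (cof h)"
      by (rule order_trans[OF low(2) conjunct2[OF Eh]])
  qed
qed

end

lemma Hinf_mat_one_minus:
  fixes E :: "'a nc_series mat"
  assumes E: "E \<in> Hinf_mat n"
  shows "1\<^sub>m n - E \<in> Hinf_mat n"
proof -
  note c = Hinf_mat_carrier[OF E]
  have "(1\<^sub>m n - E) $$ (i,j) \<in> Hinf" if ij: "i < n" "j < n" for i j
  proof -
    have "(1\<^sub>m n - E) $$ (i,j) = nc_const (if i = j then 1 else 0) - E $$ (i,j)"
      using c ij by (simp add: nc_const_simps)
    moreover have "E $$ (i,j) \<in> Hinf" using E ij by (simp add: Hinf_mat_def)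
    ultimately show ?thesis using Hinf_diff[OF nc_const_in_Hinf] by metis
  qed
  then show ?thesis using minus_carrier_mat[OF c] by (simp add: Hinf_mat_def)
qed

lemma Hinf_mat_l2_col:
  assumes E: "E \<in> Hinf_mat n" and j: "j < n"
  shows "l2 (cof (col E j))"
proof -
  note c = Hinf_mat_carrier[OF E]
  have col: "col E j \<in> carrier_vec n" using c by (simp add: carrier_vecI)
  have "l2 (nc_coeff (col E j $ i))" if "i < n" for i
  proof -
    have "E $$ (i,j) \<in> H2" using E that j by (simp add: Hinf_mat_def Hinf_def)
    then show ?thesis using c that j by (simp add: H2_def l2_def)
  qed
  then show ?thesis unfolding l2_cof_iff[OF col] by blast
qed

text \<open>
  The frames of \<open>E\<close> and of \<open>F = 1 - E\<close> combine to \<open>\<Theta>\<close>. Its formal inverse is bounded because its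
  components under \<open>Q\<close> and \<open>1 - Q\<close> are the coordinates of \<open>E h\<close> and \<open>F h\<close>.
\<close>

lemma Hinf_idempotent_similar_to_constant:
  fixes E :: "'a nc_series mat"
  assumes E: "E \<in> Hinf_mat n" and idem: "E * E = E"
  obtains \<Theta> S where "\<Theta> \<in> Hinf_mat n" "S \<in> Hinf_mat n" "\<Theta> * S = 1\<^sub>m n" "S * \<Theta> = 1\<^sub>m n"
    "E = \<Theta> * ampliation (const_part E) * S"
proof -
  note Ec = Hinf_mat_carrier[OF E]
  define F where "F = 1\<^sub>m n - E"
  have F: "F \<in> Hinf_mat n" unfolding F_def by (rule Hinf_mat_one_minus[OF E])
  note Fc = Hinf_mat_carrier[OF F]
  have EF: "E * F = 0\<^sub>m n n"
    unfolding F_def mult_minus_distrib_mat[OF Ec one_carrier_mat Ec] right_mult_one_mat[OF Ec] idem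
    by (rule minus_r_inv_mat[OF Ec])
  have FE: "F * E = 0\<^sub>m n n"
    unfolding F_def minus_mult_distrib_mat[OF one_carrier_mat Ec Ec] left_mult_one_mat[OF Ec] idem
    by (rule minus_r_inv_mat[OF Ec])
  have EF1: "E + F = 1\<^sub>m n" unfolding F_def by (rule mat_add_minus_cancel(3)[OF Ec one_carrier_mat])
  have idemF: "F * F = F"
  proof -
    have "F * F = (E + F) * F" unfolding add_mult_distrib_mat[OF Ec Fc Fc] EF
      by (rule left_add_zero_mat[OF mult_carrier_mat[OF Fc Fc], symmetric])
    then show ?thesis unfolding EF1 left_mult_one_mat[OF Fc] .
  qed
  obtain A where "wandering_frame n E A"
    by (rule wandering_frame_exists[OF Ec idem]) (rule Hinf_mat_l2_col[OF E])
  then interpret A: wandering_frame n E A .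
  obtain B where "wandering_frame n F B"
    by (rule wandering_frame_exists[OF Fc idemF]) (rule Hinf_mat_l2_col[OF F])
  then interpret B: wandering_frame n F B .
  note Q = A.Q and R = B.Q
  note E0 = const_part_carrier[OF Ec] and F0 = const_part_carrier[OF Fc]
  note AQ = mult_carrier_mat[OF A.A Q] and BR = mult_carrier_mat[OF B.A R]
  have c1: "const_part E + const_part F = 1\<^sub>m n"
  proof (rule eq_matI)
    fix i j assume ij: "i < dim_row (1\<^sub>m n :: complex mat)" "j < dim_col (1\<^sub>m n :: complex mat)"
    have "(const_part E + const_part F) $$ (i,j) = nc_coeff ((E + F) $$ (i,j)) []"
      using ij Ec Fc by (simp add: const_part_def)
    then show "(const_part E + const_part F) $$ (i,j) = 1\<^sub>m n $$ (i,j)"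
      using ij by (simp add: EF1 one_nc_series.rep_eq)
  qed (use Ec Fc in \<open>simp_all add: const_part_def\<close>)
  have QR1: "A.Q + B.Q = 1\<^sub>m n"
    unfolding ampliation_add[OF E0 F0, symmetric] c1 by (rule ampliation_one)
  have QQ: "A.Q * A.Q = A.Q"
    unfolding ampliation_mult[OF E0 E0, symmetric] const_part_mult[OF Ec Ec, symmetric] idem ..
  have RR: "B.Q * B.Q = B.Q"
    unfolding ampliation_mult[OF F0 F0, symmetric] const_part_mult[OF Fc Fc, symmetric] idemF ..
  have RQ: "B.Q * A.Q = 0\<^sub>m n n"
  proof -
    have "B.Q * A.Q = ampliation (const_part (F * E))"
      unfolding const_part_mult[OF Fc Ec] by (rule ampliation_mult[OF F0 E0, symmetric])
    also have "\<dots> = 0\<^sub>m n n"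
      unfolding FE by (rule eq_matI) (simp_all add: ampliation_def const_part_def nc_const_simps)
    finally show ?thesis .
  qed
  define \<Theta> where "\<Theta> = A * A.Q + B * B.Q"
  have \<Theta>: "\<Theta> \<in> carrier_mat n n" unfolding \<Theta>_def by (rule add_carrier_mat[OF BR])
  have A0: "const_part A = const_part E"
    by (rule eq_matI) (use A.A Ec in \<open>simp_all add: const_part_def A.A0\<close>)
  have B0: "const_part B = const_part F"
    by (rule eq_matI) (use B.A Fc in \<open>simp_all add: const_part_def B.A0\<close>)
  have "const_part \<Theta> = const_part (A * A.Q) + const_part (B * B.Q)"
    by (rule eq_matI) (use AQ BR in \<open>simp_all add: \<Theta>_def const_part_def carrier_matD[OF AQ] carrier_matD[OF BR] del: index_mult_mat\<close>)
  also have "const_part (A * A.Q) = const_part E"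
    unfolding const_part_mult[OF A.A Q] A0 const_part_ampliation[OF E0] const_part_mult[OF Ec Ec, symmetric] idem ..
  also have "const_part (B * B.Q) = const_part F"
    unfolding const_part_mult[OF B.A R] B0 const_part_ampliation[OF F0] const_part_mult[OF Fc Fc, symmetric] idemF ..
  finally have "const_part \<Theta> = 1\<^sub>m n" unfolding c1 .
  from formal_inverse[OF \<Theta> this] obtain S where S: "S \<in> carrier_mat n n"
    and \<Theta>S: "\<Theta> * S = 1\<^sub>m n" and S\<Theta>: "S * \<Theta> = 1\<^sub>m n" .
  note QS = mult_carrier_mat[OF Q S] and RS = mult_carrier_mat[OF R S]
  have EA: "E * A = A" and FB: "F * B = B" by (rule A.EA, rule B.EA)
  have EB: "E * B = 0\<^sub>m n n"
  proof -
    have "E * B = E * (F * B)" unfolding FB ..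
    also have "\<dots> = (E * F) * B" by (rule assoc_mult_mat[OF Ec Fc B.A, symmetric])
    finally show ?thesis unfolding EF left_mult_zero_mat[OF B.A] .
  qed
  have FA: "F * A = 0\<^sub>m n n"
  proof -
    have "F * A = F * (E * A)" unfolding EA ..
    also have "\<dots> = (F * E) * A" by (rule assoc_mult_mat[OF Fc Ec A.A, symmetric])
    finally show ?thesis unfolding FE left_mult_zero_mat[OF A.A] .
  qed
  have "E * \<Theta> = (E * A) * A.Q + (E * B) * B.Q"
    unfolding \<Theta>_def mult_add_distrib_mat[OF Ec AQ BR] assoc_mult_mat[OF Ec A.A Q] assoc_mult_mat[OF Ec B.A R] ..
  then have E\<Theta>: "E * \<Theta> = A * A.Q"
    unfolding EA EB left_mult_zero_mat[OF R] right_add_zero_mat[OF AQ] .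
  have "F * \<Theta> = (F * A) * A.Q + (F * B) * B.Q"
    unfolding \<Theta>_def mult_add_distrib_mat[OF Fc AQ BR] assoc_mult_mat[OF Fc A.A Q] assoc_mult_mat[OF Fc B.A R] ..
  then have F\<Theta>: "F * \<Theta> = B * B.Q"
    unfolding FA FB left_mult_zero_mat[OF Q] left_add_zero_mat[OF BR] .
  have E_factor: "E = A * (A.Q * S)"
  proof -
    have "E = E * (\<Theta> * S)" unfolding \<Theta>S right_mult_one_mat[OF Ec] ..
    also have "\<dots> = (E * \<Theta>) * S" by (rule assoc_mult_mat[OF Ec \<Theta> S, symmetric])
    finally show ?thesis unfolding E\<Theta> assoc_mult_mat[OF A.A Q S] .
  qed
  have F_factor: "F = B * (B.Q * S)"
  proof -
    have "F = F * (\<Theta> * S)" unfolding \<Theta>S right_mult_one_mat[OF Fc] ..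
    also have "\<dots> = (F * \<Theta>) * S" by (rule assoc_mult_mat[OF Fc \<Theta> S, symmetric])
    finally show ?thesis unfolding F\<Theta> assoc_mult_mat[OF B.A R S] .
  qed
  have \<Theta>Q: "\<Theta> * A.Q = A * A.Q"
  proof -
    have "\<Theta> * A.Q = A * (A.Q * A.Q) + B * (B.Q * A.Q)"
      unfolding \<Theta>_def add_mult_distrib_mat[OF AQ BR Q] assoc_mult_mat[OF A.A Q Q] assoc_mult_mat[OF B.A R Q] ..
    then show ?thesis unfolding QQ RQ right_mult_zero_mat[OF B.A] right_add_zero_mat[OF AQ] .
  qed
  have bounded: "l2_bounded n (\<lambda>h. cof (E *\<^sub>v h))" "l2_bounded n (\<lambda>h. cof (F *\<^sub>v h))"
    by (rule conjunct2[OF E[unfolded Hinf_mat_iff_l2_bounded]], rule conjunct2[OF F[unfolded Hinf_mat_iff_l2_bounded]])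
  have "l2_bounded n (\<lambda>h. cof (\<Theta> *\<^sub>v h))"
  proof (rule iffD2[OF l2_bounded_cong])
    show "l2_bounded n (\<lambda>h p. cof (A *\<^sub>v (A.Q *\<^sub>v h)) p + cof (B *\<^sub>v (B.Q *\<^sub>v h)) p)"
      by (rule l2_bounded_add[OF A.l2_bounded_frame[OF idem] B.l2_bounded_frame[OF idemF]])
    fix h :: "'a nc_series vec" assume h: "h \<in> carrier_vec n"
    show "cof (\<Theta> *\<^sub>v h) = (\<lambda>p. cof (A *\<^sub>v (A.Q *\<^sub>v h)) p + cof (B *\<^sub>v (B.Q *\<^sub>v h)) p)"
      unfolding \<Theta>_def add_mult_distrib_mat_vec[OF AQ BR h] assoc_mult_mat_vec[OF A.A Q h] assoc_mult_mat_vec[OF B.A R h]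
      by (rule cof_add[OF mult_mat_vec_carrier[OF A.A mult_mat_vec_carrier[OF Q h]]
            mult_mat_vec_carrier[OF B.A mult_mat_vec_carrier[OF R h]]])
  qed
  then have \<Theta>_Hinf: "\<Theta> \<in> Hinf_mat n" unfolding Hinf_mat_iff_l2_bounded using \<Theta> by blast
  have "l2_bounded n (\<lambda>h. cof (S *\<^sub>v h))"
  proof (rule iffD2[OF l2_bounded_cong])
    show "l2_bounded n (\<lambda>h p. cof (A.Q *\<^sub>v (S *\<^sub>v h)) p + cof (B.Q *\<^sub>v (S *\<^sub>v h)) p)"
      by (rule l2_bounded_add[OF A.l2_bounded_coordinates[OF idem S E_factor bounded(1)]
            B.l2_bounded_coordinates[OF idemF S F_factor bounded(2)]])
    fix h :: "'a nc_series vec" assume h: "h \<in> carrier_vec n"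
    note Sh = mult_mat_vec_carrier[OF S h]
    have "S *\<^sub>v h = (A.Q + B.Q) *\<^sub>v (S *\<^sub>v h)" unfolding QR1 one_mult_mat_vec[OF Sh] ..
    also have "\<dots> = A.Q *\<^sub>v (S *\<^sub>v h) + B.Q *\<^sub>v (S *\<^sub>v h)" by (rule add_mult_distrib_mat_vec[OF Q R Sh])
    finally have "cof (S *\<^sub>v h) = cof (A.Q *\<^sub>v (S *\<^sub>v h) + B.Q *\<^sub>v (S *\<^sub>v h))" by (rule arg_cong)
    also have "\<dots> = (\<lambda>p. cof (A.Q *\<^sub>v (S *\<^sub>v h)) p + cof (B.Q *\<^sub>v (S *\<^sub>v h)) p)"
      by (rule cof_add[OF mult_mat_vec_carrier[OF Q Sh] mult_mat_vec_carrier[OF R Sh]])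
    finally show "cof (S *\<^sub>v h) = (\<lambda>p. cof (A.Q *\<^sub>v (S *\<^sub>v h)) p + cof (B.Q *\<^sub>v (S *\<^sub>v h)) p)" .
  qed
  then have S_Hinf: "S \<in> Hinf_mat n" unfolding Hinf_mat_iff_l2_bounded using S by blast
  have "E = (A * A.Q) * S" by (rule E_factor[folded assoc_mult_mat[OF A.A Q S]])
  then have "E = \<Theta> * A.Q * S" unfolding \<Theta>Q .
  then show ?thesis by (rule that[OF \<Theta>_Hinf S_Hinf \<Theta>S S\<Theta>])
qed

theorem theoremA1:
  fixes n :: nat and E :: "'a::countable nc_series mat"
  assumes "E \<in> Hinf_mat n" and "E * E = E"
  shows "\<exists>P S S_inv. orthogonal_projection n P
           \<and> S \<in> Hinf_mat n \<and> S_inv \<in> Hinf_mat n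
           \<and> S_inv * S = 1\<^sub>m n \<and> S * S_inv = 1\<^sub>m n
           \<and> E = S_inv * ampliation P * S"
proof -
  note Ec = Hinf_mat_carrier[OF assms(1)]
  obtain \<Theta> S where \<Theta>: "\<Theta> \<in> Hinf_mat n" and S: "S \<in> Hinf_mat n"
    and \<Theta>S: "\<Theta> * S = 1\<^sub>m n" and S\<Theta>: "S * \<Theta> = 1\<^sub>m n"
    and E: "E = \<Theta> * ampliation (const_part E) * S"
    by (rule Hinf_idempotent_similar_to_constant[OF assms])
  have "const_part E * const_part E = const_part E"
    unfolding const_part_mult[OF Ec Ec, symmetric] assms(2) ..
  then obtain P T T' where P: "orthogonal_projection n P"
    and T: "T \<in> carrier_mat n n" and T': "T' \<in> carrier_mat n n"
    and T'T: "T' * T = 1\<^sub>m n" and TT': "T * T' = 1\<^sub>m n" and E0: "const_part E = T' * P * T"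
    by (rule idempotent_similar_to_orthogonal_projection[OF const_part_carrier[OF Ec]])
  have Pc: "P \<in> carrier_mat n n" using P by (simp add: orthogonal_projection_def)
  define a where "a = (ampliation T :: 'a nc_series mat)"
  define a' where "a' = (ampliation T' :: 'a nc_series mat)"
  have aH: "a \<in> Hinf_mat n" and a'H: "a' \<in> Hinf_mat n"
    unfolding a_def a'_def by (rule ampliation_in_Hinf_mat[OF T], rule ampliation_in_Hinf_mat[OF T'])
  note a = Hinf_mat_carrier[OF aH] and a' = Hinf_mat_carrier[OF a'H]
    and Sc = Hinf_mat_carrier[OF S] and \<Theta>c = Hinf_mat_carrier[OF \<Theta>]
    and p = ampliation_carrier[OF Pc, where 'a = 'a]
  have a'a: "a' * a = 1\<^sub>m n" and aa': "a * a' = 1\<^sub>m n"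
    unfolding a_def a'_def ampliation_mult[OF T' T, symmetric] ampliation_mult[OF T T', symmetric] T'T TT'
    by (rule ampliation_one)+
  have "(\<Theta> * a') * (a * S) = \<Theta> * ((a' * a) * S)"
    unfolding assoc_mult_mat[OF \<Theta>c a' mult_carrier_mat[OF a Sc]] assoc_mult_mat[OF a' a Sc] ..
  then have inv1: "(\<Theta> * a') * (a * S) = 1\<^sub>m n" unfolding a'a left_mult_one_mat[OF Sc] \<Theta>S .
  have "(a * S) * (\<Theta> * a') = a * ((S * \<Theta>) * a')"
    unfolding assoc_mult_mat[OF a Sc mult_carrier_mat[OF \<Theta>c a']] assoc_mult_mat[OF Sc \<Theta>c a'] ..
  then have inv2: "(a * S) * (\<Theta> * a') = 1\<^sub>m n" unfolding S\<Theta> left_mult_one_mat[OF a'] aa' .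
  have "ampliation (const_part E) = a' * ampliation P * a"
    unfolding E0 a_def a'_def ampliation_mult[OF mult_carrier_mat[OF T' Pc] T] ampliation_mult[OF T' Pc] ..
  then have "E = \<Theta> * (a' * ampliation P * a) * S" using E by (simp only:)
  also have "\<dots> = (\<Theta> * a') * ampliation P * (a * S)"
    unfolding assoc_mult_mat[OF \<Theta>c mult_carrier_mat[OF mult_carrier_mat[OF a' p] a] Sc]
      assoc_mult_mat[OF mult_carrier_mat[OF a' p] a Sc] assoc_mult_mat[OF a' p mult_carrier_mat[OF a Sc]]
      assoc_mult_mat[OF mult_carrier_mat[OF \<Theta>c a'] p mult_carrier_mat[OF a Sc]]
      assoc_mult_mat[OF \<Theta>c a' mult_carrier_mat[OF p mult_carrier_mat[OF a Sc]]] ..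
  finally have "E = (\<Theta> * a') * ampliation P * (a * S)" .
  then show ?thesis
    using P Hinf_mat_mult[OF aH S] Hinf_mat_mult[OF \<Theta> a'H] inv1 inv2 by blast
qed

end
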